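(* Assume the hidden Gibbs setting described in the context, and let $\theta^*\in\Theta$. Suppose the observed process $(Y_k)_{k\ge0}$ has distribution $\mathbb{P}^U_{\theta^*}$. Let $[\theta^*]=\{\theta\in\Theta:\mathbb{P}^U_\theta=\mathbb{P}^U_{\theta^*}\}$. Then for every open $E\subset\Theta$ containing $[\theta^*]$, \[ \lim_{n\to\infty}\Pi_n(\Theta\setminus E\mid Y_0^{n-1})=0\qquad \mathbb{P}^U_{\theta^*}\text{-almost surely}. \]
   Context: Hidden state space: $\mathcal{X}\subset\mathcal{A}^{\mathbb{Z}}$ ($\mathcal{A}$ finite) is a mixing shift of finite type, i.e. the set of sequences avoiding a fixed finite set of forbidden words, such that for any two words $u,v$ occurring in $\mathcal{X}$ there is $N$ with: for each $m\ge N$ some word $w$ of length $m$ makes $uwv$ occur. The map $S$ is the left shift $(Sx)_i=x_{i+1}$, and the metric is $d_{\mathcal{X}}(x,y)=2^{-n(x,y)}$ with $n(x,y)=\inf\{|m|:x_m\ne y_m\}$. Parameter family: $\Theta$ is a compact metric space with metric $d_\Theta$. $\{f_\theta\}$ is a regular family: for some $r>0$ each $f_\theta$ is $r$-Hölder and $\theta\mapsto f_\theta$ is continuous in the Hölder norm $\|f\|_r=\sup|f|+\sup_{x\ne y}|f(x)-f(y)|/d_{\mathcal{X}}(x,y)^r$. $\mu_\theta$ is the unique $S$-invariant Gibbs measure of $f_\theta$: for some $K>0$ and the pressure $\mathcal{P}(f_\theta)$, \[ K^{-1}\le\mu_\theta(x[0,m-1])/\exp(-m\mathcal{P}(f_\theta)+\textstyle\sum_{k<m}f_\theta(S^kx))\le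 K \] for all $x$ and $m\ge1$. $\Pi_0$ is a fully supported Borel probability measure on $\Theta$. Observations: $\mathcal{U}$ is a complete separable metric space with a $\sigma$-finite Borel measure $m$. $\varphi:\Theta\times\mathcal{X}\times\mathcal{U}\to[0,\infty)$, written $\varphi_\theta(u\mid x)$, is jointly continuous with $\int\varphi_\theta(u\mid x)\,dm(u)=1$ for all $\theta,x$. The process measure $\mathbb{P}^U_\theta$ on $\mathcal{U}^{\mathbb{N}}$ is the law of $(U_k)_{k\ge0}$ generated by drawing $X\sim\mu_\theta$ and then, conditionally on $X$, independent $U_k$ with densities $\varphi_\theta(\cdot\mid S^kX)$ with respect to $m$. Its likelihood is $p_\theta(u_0^{n-1})=\int\prod_{k=0}^{n-1}\varphi_\theta(u_k\mid S^kx)\,d\mu_\theta(x)$. The posterior is \[ \Pi_n(E\mid u_0^{n-1})=\int_Ep_\theta(u_0^{n-1})\,d\Pi_0(\theta)\Big/\int_\Theta p_\theta(u_0^{n-1})\,d\Pi_0(\theta). \] Assumptions on $L(\theta,x,u)=-\log\varphi_\theta(u\mid x)$, where $Y_0$ has the first-coordinate law under $\mathbb{P}^U_{\theta^*}$: - (i) $L$ is continuous. - (ii) There is a measurable $L^*:\mathcal{U}\to\mathbb{R}$ with $\sup_{\theta,x}|L(\theta,x,u)|\le L^*(u)$ and $\mathbb{E}_{\theta^*}[L^*(Y_0)]<\infty$. - (iii) For each $\delta>0$ there is a measurable $\rho_\delta:\mathcal{U}\to(0,\infty)$ with $|L(\theta,x,u)-L(\theta',x',u)|\le\rho_\delta(u)$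 whenever $\max(d_\Theta(\theta,\theta'),d_{\mathcal{X}}(x,x'))\le\delta$, and $\mathbb{E}_{\theta^*}[\rho_\delta(Y_0)]\to0$ as $\delta\to0^+$. - (L2) There exist $\alpha>0$ and a Borel $C:\Theta\times\mathcal{U}\to[0,\infty)$ such that each $L(\theta,\cdot,u)$ is $\alpha$-Hölder on $\mathcal{X}$ with constant $C(\theta,u)$, and for each $\beta>0$, $\sup_{(\theta,x)}\int\exp(\beta C(\theta,u))\varphi_\theta(u\mid x)\,dm(u)<\infty$. *)

theory Defs
  imports "HOL-Probability.Probability"
begin

definition occurs_at :: "'a list \<Rightarrow> (int \<Rightarrow> 'a) \<Rightarrow> int \<Rightarrow> bool" where
  "occurs_at w x i \<longleftrightarrow> (\<forall>j<length w. x (i + int j) = w ! j)"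

definition sft :: "'a list set \<Rightarrow> (int \<Rightarrow> 'a) set" where
  "sft F = {x. \<forall>i. \<forall>w\<in>F. \<not> occurs_at w x i}"

definition occurs_in :: "(int \<Rightarrow> 'a) set \<Rightarrow> 'a list \<Rightarrow> bool" where
  "occurs_in X w \<longleftrightarrow> (\<exists>x\<in>X. \<exists>i. occurs_at w x i)"

definition mixing_sft :: "(int \<Rightarrow> 'a) set \<Rightarrow> bool" where
  "mixing_sft X \<longleftrightarrow> (\<exists>F. finite F \<and> X = sft F) \<and>
     (\<forall>u v. occurs_in X u \<longrightarrow> occurs_in X v \<longrightarrow>
        (\<exists>N. \<forall>m\<ge>N. \<exists>w. length w = m \<and> occurs_in X (u @ w @ v)))"

definition shift :: "(int \<Rightarrow> 'a) \<Rightarrow> (int \<Rightarrow> 'a)" where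
  "shift x = (\<lambda>i. x (i + 1))"

definition dX :: "(int \<Rightarrow> 'a) \<Rightarrow> (int \<Rightarrow> 'a) \<Rightarrow> real" where
  "dX x y = (if x = y then 0
             else 2 powr (- real (LEAST k::nat. \<exists>m::int. nat \<bar>m\<bar> = k \<and> x m \<noteq> y m)))"

text \<open>The measurable space of the hidden states (product sigma-algebra = Borel sets of dX), restricted to X.\<close>
definition hidden_space :: "(int \<Rightarrow> 'a) set \<Rightarrow> (int \<Rightarrow> 'a) measure" where
  "hidden_space X = restrict_space (PiM UNIV (\<lambda>_::int. count_space (UNIV::'a set))) X"

definition holder :: "real \<Rightarrow> (int \<Rightarrow> 'a) set \<Rightarrow> ((int \<Rightarrow> 'a) \<Rightarrow> real) \<Rightarrow> bool" where
  "holder r X g \<longleftrightarrow> (\<exists>B. \<forall>x\<in>X. \<bar>g x\<bar> \<le> B) \<and>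
     (\<exists>H. \<forall>x\<in>X. \<forall>y\<in>X. \<bar>g x - g y\<bar> \<le> H * dX x y powr r)"

text \<open>Hoelder norm; the suprema are of nonnegative quantities (0 inserted to handle empty index sets).\<close>
definition holder_norm :: "real \<Rightarrow> (int \<Rightarrow> 'a) set \<Rightarrow> ((int \<Rightarrow> 'a) \<Rightarrow> real) \<Rightarrow> real" where
  "holder_norm r X g =
     Sup (insert 0 ((\<lambda>x. \<bar>g x\<bar>) ` X)) +
     Sup (insert 0 ((\<lambda>(x, y). \<bar>g x - g y\<bar> / dX x y powr r) ` {(x, y). x \<in> X \<and> y \<in> X \<and> x \<noteq> y}))"

definition regular_family :: "'p::metric_space set \<Rightarrow> (int \<Rightarrow> 'a) set \<Rightarrow> ('p \<Rightarrow> (int \<Rightarrow> 'a) \<Rightarrow> real) \<Rightarrow> bool" where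
  "regular_family \<Theta> X f \<longleftrightarrow> (\<exists>r>0. (\<forall>\<theta>\<in>\<Theta>. holder r X (f \<theta>)) \<and>
     (\<forall>\<theta>\<in>\<Theta>. \<forall>\<epsilon>>0. \<exists>\<delta>>0. \<forall>\<theta>'\<in>\<Theta>. dist \<theta>' \<theta> < \<delta> \<longrightarrow>
        holder_norm r X (\<lambda>x. f \<theta>' x - f \<theta> x) < \<epsilon>))"

definition word :: "(int \<Rightarrow> 'a) \<Rightarrow> nat \<Rightarrow> 'a list" where
  "word x m = map (\<lambda>i. x (int i)) [0..<m]"

definition cylinder :: "(int \<Rightarrow> 'a) set \<Rightarrow> (int \<Rightarrow> 'a) \<Rightarrow> nat \<Rightarrow> (int \<Rightarrow> 'a) set" where
  "cylinder X x m = {y \<in> X. word y m = word x m}"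

definition birkhoff_sum :: "((int \<Rightarrow> 'a) \<Rightarrow> real) \<Rightarrow> nat \<Rightarrow> (int \<Rightarrow> 'a) \<Rightarrow> real" where
  "birkhoff_sum f m x = (\<Sum>k<m. f ((shift ^^ k) x))"

definition pressure :: "(int \<Rightarrow> 'a) set \<Rightarrow> ((int \<Rightarrow> 'a) \<Rightarrow> real) \<Rightarrow> real" where
  "pressure X f = lim (\<lambda>m. ln (\<Sum>w\<in>(\<lambda>x. word x m) ` X.
        exp (SUP y\<in>{y\<in>X. word y m = w}. birkhoff_sum f m y)) / real m)"

definition invariant_gibbs :: "(int \<Rightarrow> 'a) set \<Rightarrow> ((int \<Rightarrow> 'a) \<Rightarrow> real) \<Rightarrow> (int \<Rightarrow> 'a) measure \<Rightarrow> bool" where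
  "invariant_gibbs X f \<mu> \<longleftrightarrow>
     prob_space \<mu> \<and> sets \<mu> = sets (hidden_space X) \<and> space \<mu> = X \<and>
     distr \<mu> \<mu> shift = \<mu> \<and>
     (\<exists>K>0. \<forall>x\<in>X. \<forall>m\<ge>1.
        inverse K \<le> measure \<mu> (cylinder X x m) / exp (- real m * pressure X f + birkhoff_sum f m x) \<and>
        measure \<mu> (cylinder X x m) / exp (- real m * pressure X f + birkhoff_sum f m x) \<le> K)"

definition jointly_continuous ::
  "'p::metric_space set \<Rightarrow> (int \<Rightarrow> 'a) set \<Rightarrow> ('p \<Rightarrow> (int \<Rightarrow> 'a) \<Rightarrow> 'u::metric_space \<Rightarrow> real) \<Rightarrow> bool" where
  "jointly_continuous \<Theta> X g \<longleftrightarrow>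
     (\<forall>\<theta>\<in>\<Theta>. \<forall>x\<in>X. \<forall>u. \<forall>\<epsilon>>0. \<exists>\<delta>>0. \<forall>\<theta>'\<in>\<Theta>. \<forall>x'\<in>X. \<forall>u'.
        dist \<theta>' \<theta> < \<delta> \<and> dX x' x < \<delta> \<and> dist u' u < \<delta> \<longrightarrow> \<bar>g \<theta>' x' u' - g \<theta> x u\<bar> < \<epsilon>)"

definition process_measure ::
  "('p \<Rightarrow> (int \<Rightarrow> 'a) measure) \<Rightarrow> ('p \<Rightarrow> (int \<Rightarrow> 'a) \<Rightarrow> 'u \<Rightarrow> real) \<Rightarrow> 'u measure \<Rightarrow> 'p \<Rightarrow> (nat \<Rightarrow> 'u) measure" where
  "process_measure \<mu> \<phi> m \<theta> =
     bind (\<mu> \<theta>) (\<lambda>x. PiM UNIV (\<lambda>k::nat. density m (\<lambda>u. ennreal (\<phi> \<theta> ((shift ^^ k) x) u))))"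

definition likelihood ::
  "('p \<Rightarrow> (int \<Rightarrow> 'a) measure) \<Rightarrow> ('p \<Rightarrow> (int \<Rightarrow> 'a) \<Rightarrow> 'u \<Rightarrow> real) \<Rightarrow> 'p \<Rightarrow> nat \<Rightarrow> (nat \<Rightarrow> 'u) \<Rightarrow> real" where
  "likelihood \<mu> \<phi> \<theta> n u = (\<integral>x. (\<Prod>k<n. \<phi> \<theta> ((shift ^^ k) x) (u k)) \<partial>\<mu> \<theta>)"

definition posterior ::
  "'p measure \<Rightarrow> ('p \<Rightarrow> (int \<Rightarrow> 'a) measure) \<Rightarrow> ('p \<Rightarrow> (int \<Rightarrow> 'a) \<Rightarrow> 'u \<Rightarrow> real) \<Rightarrow> nat \<Rightarrow> 'p set \<Rightarrow> (nat \<Rightarrow> 'u) \<Rightarrow> real" where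
  "posterior \<Pi>0 \<mu> \<phi> n E u =
     (\<integral>\<theta>. indicator E \<theta> * likelihood \<mu> \<phi> \<theta> n u \<partial>\<Pi>0) / (\<integral>\<theta>. likelihood \<mu> \<phi> \<theta> n u \<partial>\<Pi>0)"

end

theory Submission
  imports Defs
begin

text \<open>
  If \<open>\<theta>\<close> and \<open>\<theta>\<^sup>*\<close> give different process laws, some product test function of finitely many
  coordinates has different means under them. Its empirical average converges almost surely under
  \<open>\<theta>\<^sup>*\<close>, while under \<open>\<theta>\<close> a fixed deviation from the mean has exponentially small probability:
  conditionally on the hidden path this is Hoeffding's inequality, and for the hidden Gibbs measure it
  follows from \<open>\<mu>[uv] \<le> K\<^sup>3 \<mu>[u] \<mu>[v]\<close> by a Chernoff bound over long blocks. A change of measure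
  then shows that the likelihood ratio of \<open>\<theta>\<close> against \<open>\<theta>\<^sup>*\<close> decays exponentially.

  The likelihoods of nearby parameters differ by at most a factor
  \<open>C exp (2 \<eta> n + 2 \<Sum>\<^sub>k \<rho>\<^sub>\<delta> (Y\<^sub>k))\<close>, since their Gibbs measures are comparable on cylinders
  with a constant that is locally uniform in the parameter. The sum is at most a small multiple of \<open>n\<close>
  by a maximal inequality, so the exponential decay extends to a neighbourhood of \<open>\<theta>\<close>; by compactness
  finitely many such neighbourhoods cover the complement of \<open>E\<close>. The same comparison around
  \<open>\<theta>\<^sup>*\<close> bounds the denominator of the posterior from below.
\<close>

section \<open>Words, gluing and Gibbs measures\<close>

text \<open>The hypotheses give a Gibbs constant for each parameter separately, without any control
  in \<theta>, whereas neighbouring parameters can only be compared with one constant on a whole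
  ball. \<open>uniform_gibbs\<close> removes this obstacle: the Gibbs inequality with some constant
  already implies it with a constant computed from the variation of the Birkhoff sums, a bound for
  the pressure, the sup norm of the potential and the gluing gap, and all of these are stable under
  small Hoelder perturbations. The law of large numbers for the hidden measure comes from the same
  word estimates: the lower mixing bound makes the second moment of block sums grow by a factor
  below 4 when the block doubles, hence convergence in mean along the lengths \<open>2^k\<close>. In
  the Chernoff bound each junction of blocks costs the fixed factor \<open>K^3\<close>; it is beaten
  because the exponential parameter is chosen from \<open>K\<close> first and the block length only
  afterwards. If the separation rate is \<open>c\<close>, perturbing the parameter costs at most
  \<open>c / 2\<close> in the numerator. The argument then restarts with the surviving rate for the
  denominator, where again only half of it is spent.\<close>

lemma shift_funpow: "(shift ^^ k) x = (\<lambda>i. x (i + int k))"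
  by (induction k) (auto simp: shift_def algebra_simps)

lemma shift_funpow_add: "(shift ^^ k) ((shift ^^ l) x) = (shift ^^ (l + k)) x"
  by (simp add: shift_funpow algebra_simps)

lemma sft_translate:
  assumes "x \<in> sft F" shows "(\<lambda>i. x (i + k)) \<in> sft F"
proof -
  have "\<not> occurs_at w (\<lambda>i. x (i + k)) i" if "w \<in> F" for w i
    using assms that unfolding sft_def occurs_at_def by (auto simp: ac_simps dest: spec[of _ "i + k"])
  then show ?thesis by (auto simp: sft_def)
qed

section \<open>Words of a sequence, Birkhoff sums and the metric\<close>

lemma length_word [simp]: "length (word x n) = n"
  by (simp add: word_def)

lemma word_nth [simp]: "i < n \<Longrightarrow> word x n ! i = x (int i)"
  by (simp add: word_def)

lemma word_eq_iff: "word x n = word y n \<longleftrightarrow> (\<forall>i<n. x (int i) = y (int i))"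
  by (auto simp: list_eq_iff_nth_eq)

lemma word_append: "word x (n + k) = word x n @ word ((shift ^^ n) x) k"
  by (auto simp: list_eq_iff_nth_eq nth_append shift_funpow)

lemma word_factor: "k + w \<le> n \<Longrightarrow> word ((shift ^^ k) x) w = take w (drop k (word x n))"
  by (auto simp: list_eq_iff_nth_eq shift_funpow add.commute)

lemma birkhoff_sum_add:
  "birkhoff_sum f (n + k) x = birkhoff_sum f n x + birkhoff_sum f k ((shift ^^ n) x)"
proof -
  have "(\<Sum>i<n+k. f ((shift ^^ i) x)) = (\<Sum>i<n. f ((shift ^^ i) x)) + (\<Sum>i<k. f ((shift ^^ (n + i)) x))"
    by (induction k) auto
  then show ?thesis by (simp add: birkhoff_sum_def shift_funpow_add)
qed

lemma dX_nonneg: "0 \<le> dX x y"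
  by (simp add: dX_def)

lemma dX_le:
  assumes "\<And>i. nat \<bar>i\<bar> < j \<Longrightarrow> x i = y i"
  shows "dX x y \<le> 2 powr (- real j)"
proof (cases "x = y")
  case False
  then obtain i where "x i \<noteq> y i" by auto
  then have ex: "\<exists>k. \<exists>i::int. nat \<bar>i\<bar> = k \<and> x i \<noteq> y i" by auto
  have "j \<le> (LEAST k::nat. \<exists>i::int. nat \<bar>i\<bar> = k \<and> x i \<noteq> y i)"
    using LeastI_ex[OF ex] assms by (metis not_le)
  then show ?thesis using False by (simp add: dX_def)
qed (simp add: dX_def)

lemma mixing_sft_translate: "mixing_sft X \<Longrightarrow> x \<in> X \<Longrightarrow> (\<lambda>i. x (i + k)) \<in> X"
  using sft_translate by (auto simp: mixing_sft_def)

text \<open>The gap is uniform because membership in a subshift of finite type is decided by windows of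
  bounded length, so only finitely many pairs of boundary words have to be joined.\<close>

lemma mixing_sft_specification:
  fixes X :: "(int \<Rightarrow> 'a::finite) set"
  assumes "mixing_sft X"
  obtains N where "\<And>x y. x \<in> X \<Longrightarrow> y \<in> X \<Longrightarrow>
    \<exists>z\<in>X. (\<forall>i<0. z i = x i) \<and> (\<forall>i\<ge>0. z (i + int N) = y i)"
proof -
  obtain F :: "'a list set" where F: "finite F" "X = sft F"
    and mix: "\<And>u v. occurs_in X u \<Longrightarrow> occurs_in X v \<Longrightarrow>
        \<exists>N. \<forall>m\<ge>N. \<exists>w. length w = m \<and> occurs_in X (u @ w @ v)"
    using assms by (auto simp: mixing_sft_def)
  \<comment> \<open>All forbidden words have length at most \<open>p\<close>, so \<open>p\<close>
    known letters on each side of the gap shield it from the rest of the sequence.\<close>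
  define p where "p = Max (insert 0 (length ` F))"
  have p: "length w \<le> p" if "w \<in> F" for w
    using F(1) that by (auto simp: p_def)
  have "\<forall>u v. \<exists>N. occurs_in X u \<longrightarrow> occurs_in X v \<longrightarrow> (\<forall>m\<ge>N. \<exists>w. length w = m \<and> occurs_in X (u @ w @ v))"
    using mix by blast
  then obtain n0 where n0: "\<And>u v m. occurs_in X u \<Longrightarrow> occurs_in X v \<Longrightarrow> n0 u v \<le> m \<Longrightarrow>
      \<exists>w. length w = m \<and> occurs_in X (u @ w @ v)"
    by metis
  define S where "S = {u :: 'a list. length u = p}"
  have "finite S"
    using finite_lists_length_eq[of "UNIV :: 'a set" p] by (simp add: S_def)
  then have fin: "finite ((\<lambda>(u, v). n0 u v) ` (S \<times> S))" by simp
  \<comment> \<open>The required gap depends on the pair of boundary words, but there are only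
    finitely many words of length \<open>p\<close>, so one maximum serves all pairs.\<close>
  define N where "N = Max (insert 0 ((\<lambda>(u, v). n0 u v) ` (S \<times> S)))"
  have N: "n0 u v \<le> N" if "u \<in> S" "v \<in> S" for u v
    unfolding N_def using fin that by (intro Max_ge) auto
  show ?thesis
  proof (rule that[of N])
    fix x y assume xy: "x \<in> X" "y \<in> X"
    define u where "u = map (\<lambda>i. x (int i - int p)) [0..<p]"
    define v where "v = map (\<lambda>i. y (int i)) [0..<p]"
    have "occurs_at u x (- int p)" "occurs_at v y 0"
      by (auto simp: occurs_at_def u_def v_def)
    then have "occurs_in X u" "occurs_in X v" using xy by (auto simp: occurs_in_def)
    moreover have "u \<in> S" "v \<in> S" by (auto simp: S_def u_def v_def)
    ultimately obtain w where w: "length w = N" "occurs_in X (u @ w @ v)"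
      using n0 N by blast
    then obtain z0 i0 where z0: "z0 \<in> X" "occurs_at (u @ w @ v) z0 i0"
      by (auto simp: occurs_in_def)
    \<comment> \<open>The translation puts \<open>u\<close> on the positions from \<open>-p\<close>
      to \<open>-1\<close>, the connecting word on \<open>0..<N\<close> and \<open>v\<close> on the
      next \<open>p\<close> positions.\<close>
    define z1 where "z1 = (\<lambda>i. z0 (i + (i0 + int p)))"
    have z1X: "z1 \<in> X" using z0(1) F(2) sft_translate unfolding z1_def by blast
    have len: "length u = p" "length v = p" by (auto simp: u_def v_def)
    have z0_nth: "z0 (i0 + int j) = (u @ w @ v) ! j" if "j < p + N + p" for j
      using z0(2) that len w(1) by (auto simp: occurs_at_def)
    have z1x: "z1 i = x i" if "- int p \<le> i" "i < 0" for i
    proof -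
      have "nat (i + int p) < p" using that by linarith
      then have "z0 (i0 + int (nat (i + int p))) = u ! nat (i + int p)"
        using z0_nth[of "nat (i + int p)"] len by (simp add: nth_append)
      then show ?thesis
        using that \<open>nat (i + int p) < p\<close> by (simp add: z1_def u_def algebra_simps)
    qed
    have z1y: "z1 (i + int N) = y i" if "0 \<le> i" "i < int p" for i
    proof -
      have "z0 (i0 + int (p + N + nat i)) = v ! nat i"
        using z0_nth[of "p + N + nat i"] that len w(1) by (simp add: nth_append)
      then show ?thesis using that by (simp add: z1_def v_def algebra_simps)
    qed
    define z where "z = (\<lambda>i. if i < 0 then x i else if i < int N then z1 i else y (i - int N))"
    have zz1: "z i = z1 i" if "- int p \<le> i" "i < int N + int p" for i
      using that z1x[of i] z1y[of "i - int N"] by (auto simp: z_def)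
    have "\<not> occurs_at q z i" if "q \<in> F" for q i
    proof
      assume oc: "occurs_at q z i"
      have no: "\<not> occurs_at q t k" if "t \<in> X" for t k
        using that \<open>q \<in> F\<close> F(2) by (auto simp: sft_def)
      \<comment> \<open>An occurrence contained in neither half line meets the gap or the junction;
        having length at most \<open>p\<close> it lies inside the window on which \<open>z\<close>
        agrees with \<open>z1\<close>.\<close>
      consider "i + int (length q) \<le> 0" | "i \<ge> int N" | "i + int (length q) > 0" "i < int N" by linarith
      then show False
      proof cases
        case 1
        then have "occurs_at q x i" using oc by (auto simp: occurs_at_def z_def)
        then show False using no xy by blast
      next
        case 2
        then have "occurs_at q y (i - int N)" using oc by (auto simp: occurs_at_def z_def algebra_simps)
        then show False using no xy by blast
      next
        case 3
        have "occurs_at q z1 i" unfolding occurs_at_def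
        proof (intro allI impI)
          fix j assume j: "j < length q"
          have "z (i + int j) = z1 (i + int j)" using 3 j p[OF \<open>q \<in> F\<close>] by (intro zz1) linarith+
          then show "z1 (i + int j) = q ! j" using oc j by (auto simp: occurs_at_def)
        qed
        then show False using no z1X by blast
      qed
    qed
    then have "z \<in> X" using F(2) by (auto simp: sft_def)
    then show "\<exists>z\<in>X. (\<forall>i<0. z i = x i) \<and> (\<forall>i\<ge>0. z (i + int N) = y i)"
      by (intro bexI[of _ z]) (auto simp: z_def)
  qed
qed

text \<open>The pressure is just a real number \<open>P\<close> here, and the Gibbs inequality is
  split into two product estimates valid for all \<open>n\<close>, including 0, where they say
  \<open>1 \<le> K\<close>. With \<open>K\<close> as a parameter the same measure can later be given
  a better constant. \<open>glue\<close> is the specification property with the uniform gap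
  \<open>N\<close>.\<close>

locale gibbs =
  fixes X :: "(int \<Rightarrow> 'a::finite) set" and f :: "(int \<Rightarrow> 'a) \<Rightarrow> real"
    and \<mu> :: "(int \<Rightarrow> 'a) measure" and P K Bf :: real and N :: nat
  assumes prob: "prob_space \<mu>"
    and sets_mu: "sets \<mu> = sets (hidden_space X)"
    and space_mu: "space \<mu> = X"
    and invariant: "distr \<mu> \<mu> shift = \<mu>"
    and translate: "\<And>x k. x \<in> X \<Longrightarrow> (\<lambda>i. x (i + k)) \<in> X"
    and glue: "\<And>x y. x \<in> X \<Longrightarrow> y \<in> X \<Longrightarrow>
      \<exists>z\<in>X. (\<forall>i<0. z i = x i) \<and> (\<forall>i\<ge>0. z (i + int N) = y i)"
    and K_ge1: "1 \<le> K"
    and cyl_le: "\<And>x n. x \<in> X \<Longrightarrow>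
      measure \<mu> (cylinder X x n) \<le> K * exp (birkhoff_sum f n x - real n * P)"
    and cyl_ge: "\<And>x n. x \<in> X \<Longrightarrow>
      exp (birkhoff_sum f n x - real n * P) \<le> K * measure \<mu> (cylinder X x n)"
    and f_bound: "\<And>x. x \<in> X \<Longrightarrow> \<bar>f x\<bar> \<le> Bf"
begin

sublocale prob_space \<mu> by (rule prob)

lemma shift_in: "x \<in> X \<Longrightarrow> (shift ^^ k) x \<in> X"
  using translate by (simp add: shift_funpow)

lemma measurable_coord: "(\<lambda>x. x i) \<in> measurable \<mu> (count_space UNIV)"
proof -
  have "(\<lambda>x. x i) \<in> measurable (hidden_space X) (count_space UNIV)"
    unfolding hidden_space_def by (intro measurable_restrict_space1 measurable_component_singleton) auto
  then show ?thesis using measurable_cong_sets[OF sets_mu refl] by blast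
qed

lemma shift_measurable [measurable]: "shift \<in> measurable \<mu> \<mu>"
proof -
  have "shift \<in> measurable \<mu> (restrict_space (PiM UNIV (\<lambda>_::int. count_space UNIV)) X)"
  proof (intro measurable_restrict_space2)
    show "shift \<in> measurable \<mu> (PiM UNIV (\<lambda>_. count_space UNIV))"
      by (intro measurable_PiM_single') (auto simp: shift_def measurable_coord)
    show "shift \<in> space \<mu> \<rightarrow> X"
      using shift_in[of _ 1] by (auto simp: space_mu)
  qed
  then show ?thesis using measurable_cong_sets[OF refl sets_mu] by (auto simp: hidden_space_def)
qed

lemma funpow_shift_measurable [measurable]: "(shift ^^ k) \<in> measurable \<mu> \<mu>"
  by (induction k) auto

lemma distr_funpow_shift: "distr \<mu> \<mu> (shift ^^ k) = \<mu>"
proof (induction k)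
  case (Suc k)
  have "distr \<mu> \<mu> (shift ^^ Suc k) = distr (distr \<mu> \<mu> (shift ^^ k)) \<mu> shift"
    by (subst distr_distr) auto
  then show ?case using Suc invariant by metis
qed (simp add: distr_id2)

lemma expectation_shift:
  assumes "g \<in> borel_measurable \<mu>"
  shows "expectation (\<lambda>x. g ((shift ^^ k) x)) = (expectation g :: real)"
  using integral_distr[of "shift ^^ k" \<mu> \<mu> g] assms by (simp add: distr_funpow_shift)

lemma word_measurable [measurable]: "(\<lambda>x. word x n) \<in> measurable \<mu> (count_space UNIV)"
proof (subst measurable_count_space_eq_countable)
  have "(\<lambda>x. word x n) -` {v} \<inter> space \<mu> \<in> sets \<mu>" for v
  proof (cases "length v = n")
    case True
    then have eq: "(\<lambda>x. word x n) -` {v} \<inter> space \<mu> = {x\<in>space \<mu>. \<forall>i<n. x (int i) = v ! i}"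
      by (auto simp: list_eq_iff_nth_eq)
    note [measurable] = measurable_coord
    show ?thesis unfolding eq by measurable
  next
    case False
    then have "(\<lambda>x. word x n) -` {v} = {}" by auto
    then show ?thesis by simp
  qed
  then show "(\<lambda>x. word x n) \<in> space \<mu> \<rightarrow> UNIV \<and> (\<forall>v\<in>UNIV. (\<lambda>x. word x n) -` {v} \<inter> space \<mu> \<in> sets \<mu>)"
    by auto
qed auto

lemma word_fun_measurable [measurable]: "(\<lambda>x. F (word x n) :: real) \<in> borel_measurable \<mu>"
  by measurable

text \<open>Words that do not occur in \<open>X\<close> get weight 0, so that sums may run over all
  lists of a given length over the finite alphabet.\<close>

definition cw :: "'a list \<Rightarrow> real" where
  "cw v = measure \<mu> {x\<in>X. word x (length v) = v}"

lemma cw_nonneg: "0 \<le> cw v" by (simp add: cw_def)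

lemma cw_word: "x \<in> X \<Longrightarrow> cw (word x n) = measure \<mu> (cylinder X x n)"
  by (simp add: cw_def cylinder_def)

lemma cw_pos_ex: "cw v \<noteq> 0 \<Longrightarrow> \<exists>x\<in>X. word x (length v) = v"
  using measure_empty[of \<mu>] unfolding cw_def by (metis (mono_tags, lifting) empty_Collect_eq)

lemma finite_words: "finite {v :: 'a list. length v = n}"
  using finite_lists_length_eq[of "UNIV :: 'a set" n] by simp

lemma expectation_word:
  "expectation (\<lambda>x. F (word x n)) = (\<Sum>v | length v = n. F v * cw v)"
  for F :: "'a list \<Rightarrow> real"
proof -
  have m: "{x\<in>X. word x n = v} \<in> sets \<mu>" for v
  proof -
    have "{x\<in>space \<mu>. word x n = v} \<in> sets \<mu>" by measurable
    then show ?thesis by (simp add: space_mu)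
  qed
  have "expectation (\<lambda>x. F (word x n)) =
    expectation (\<lambda>x. \<Sum>v | length v = n. F v * indicator {x\<in>X. word x n = v} x)"
  proof (intro Bochner_Integration.integral_cong refl)
    fix x assume "x \<in> space \<mu>"
    then have "(\<Sum>v | length v = n. F v * indicator {x\<in>X. word x n = v} x)
      = (\<Sum>v | length v = n. if v = word x n then F v else 0)"
      by (intro sum.cong) (auto simp: space_mu)
    then show "F (word x n) = (\<Sum>v | length v = n. F v * indicator {x\<in>X. word x n = v} x)"
      by (simp add: finite_words)
  qed
  also have "\<dots> = (\<Sum>v | length v = n. F v * measure \<mu> {x\<in>X. word x n = v})"
    using m by (subst Bochner_Integration.integral_sum)
       (auto intro!: integrable_real_mult_indicator simp: less_top[symmetric] mult.commute space_mu Int_absorb1 Int_absorb2)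
  also have "\<dots> = (\<Sum>v | length v = n. F v * cw v)"
    by (intro sum.cong) (auto simp: cw_def)
  finally show ?thesis .
qed

lemma sum_cw: "(\<Sum>v | length v = n. cw v) = 1"
  using expectation_word[of "\<lambda>_. 1" n] by (simp add: prob_space)

lemma integrable_word: "integrable \<mu> (\<lambda>x. F (word x n) :: real)"
proof (rule integrable_const_bound[where B = "\<Sum>v | length v = n. \<bar>F v\<bar>"])
  show "AE x in \<mu>. norm (F (word x n)) \<le> (\<Sum>v | length v = n. \<bar>F v\<bar>)"
    by (intro AE_I2) (auto intro!: member_le_sum simp: finite_words)
qed auto

lemma sum_words_add:
  "(\<Sum>v | length v = n + k. F v) = (\<Sum>u | length u = n. \<Sum>v | length v = k. F (u @ v))"
  for F :: "'a list \<Rightarrow> real"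
proof -
  have "(\<Sum>u | length u = n. \<Sum>v | length v = k. F (u @ v)) =
    (\<Sum>(u, v)\<in>{u. length u = n} \<times> {v. length v = k}. F (u @ v))"
    by (simp add: sum.cartesian_product)
  also have "\<dots> = (\<Sum>v | length v = n + k. F v)"
    by (rule sum.reindex_bij_witness[where i = "\<lambda>v. (take n v, drop n v)" and j = "\<lambda>(u, v). u @ v"]) auto
  finally show ?thesis by simp
qed

text \<open>Birkhoff sums are additive along the concatenation. One factor \<open>K\<close> comes
  from the upper Gibbs bound for the long cylinder, two more from the lower bounds for its two
  halves.\<close>

lemma cw_append_le: "cw (u @ v) \<le> K^3 * (cw u * cw v)"
proof (cases "cw (u @ v) = 0")
  case True
  then show ?thesis using K_ge1 cw_nonneg by simp
next
  case False
  let ?n = "length u" and ?k = "length v"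
  obtain x where x: "x \<in> X" "word x (?n + ?k) = u @ v"
    using cw_pos_ex[OF False] by auto
  then have w: "word x ?n = u" "word ((shift ^^ ?n) x) ?k = v"
    using word_append[of x ?n ?k] by auto
  let ?y = "(shift ^^ ?n) x"
  have "cw (u @ v) \<le> K * exp (birkhoff_sum f (?n + ?k) x - real (?n + ?k) * P)"
    using cyl_le[OF x(1), of "?n + ?k"] cw_word[OF x(1), of "?n + ?k"] x(2) by simp
  also have "\<dots> = K * (exp (birkhoff_sum f ?n x - real ?n * P) * exp (birkhoff_sum f ?k ?y - real ?k * P))"
    by (simp add: birkhoff_sum_add exp_add[symmetric] algebra_simps)
  also have "\<dots> \<le> K * ((K * cw u) * (K * cw v))"
    using cyl_ge[OF x(1), of ?n] cw_word[OF x(1), of ?n]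
      cyl_ge[OF shift_in[OF x(1)], of ?k ?n] cw_word[OF shift_in[OF x(1)], of ?n ?k] w K_ge1
    by (intro mult_left_mono mult_mono) (auto simp: cw_nonneg)
  finally show ?thesis by (simp add: power3_eq_cube mult_ac)
qed

lemma birkhoff_abs_le:
  assumes "x \<in> X" shows "\<bar>birkhoff_sum f n x\<bar> \<le> real n * Bf"
proof -
  have "\<bar>birkhoff_sum f n x\<bar> \<le> (\<Sum>k<n. Bf)"
    unfolding birkhoff_sum_def by (intro order_trans[OF sum_abs] sum_mono f_bound shift_in assms)
  then show ?thesis by simp
qed

text \<open>The exponential is a lower bound for the Gibbs weight of any word filling a gap of
  length \<open>N\<close>, and \<open>K^3\<close> is again the price of three Gibbs bounds. The cap
  at 1 keeps \<open>4 - cl\<close> at least 3, which the second moment recursion uses.\<close>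

definition cl :: real where "cl = min 1 (exp (- real N * (\<bar>P\<bar> + Bf)) / K^3)"

lemma cl_pos: "0 < cl" and cl_le1: "cl \<le> 1"
  using K_ge1 by (auto simp: cl_def)

lemma glue_at:
  assumes "x \<in> X" "y \<in> X"
  obtains z where "z \<in> X" "word z n = word x n" "\<And>k. word ((shift ^^ (n + N)) z) k = word y k"
proof -
  have "(\<lambda>i. x (i + int n)) \<in> X" by (rule translate[OF assms(1)])
  from glue[OF this assms(2)] obtain z where z: "z \<in> X" "\<And>i. i < 0 \<Longrightarrow> z i = x (i + int n)"
    "\<And>i. i \<ge> 0 \<Longrightarrow> z (i + int N) = y i" by blast
  show ?thesis
  proof (rule that[of "\<lambda>i. z (i + - int n)"])
    show "(\<lambda>i. z (i + - int n)) \<in> X" by (rule translate[OF z(1)])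
    show "word (\<lambda>i. z (i + - int n)) n = word x n" by (auto simp: word_eq_iff z)
    show "word ((shift ^^ (n + N)) (\<lambda>i. z (i + - int n))) k = word y k" for k
      using z(3) by (auto simp: word_eq_iff shift_funpow algebra_simps)
  qed
qed

text \<open>A single term of the sum suffices: gluing a point of the cylinder of \<open>u\<close> to
  one of \<open>v\<close> produces one gap word \<open>t\<close> for which \<open>u @ t @ v\<close>
  occurs, and the Birkhoff sum over the gap is at least \<open>- N * Bf\<close>.\<close>

lemma gap_ge:
  assumes "length u = n" "length v = k"
  shows "cl * (cw u * cw v) \<le> (\<Sum>t | length t = N. cw (u @ t @ v))"
proof (cases "cw u = 0 \<or> cw v = 0")
  case True
  then show ?thesis using cw_nonneg by (auto intro!: sum_nonneg)
next
  case False
  obtain x y where xy: "x \<in> X" "word x n = u" "y \<in> X" "word y k = v"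
    using cw_pos_ex[of u] cw_pos_ex[of v] False assms by auto
  obtain z where z: "z \<in> X" "word z n = u" "word ((shift ^^ (n + N)) z) k = v"
    using glue_at[OF xy(1,3), of n] xy by metis
  define t where "t = word ((shift ^^ n) z) N"
  let ?z1 = "(shift ^^ n) z" and ?z2 = "(shift ^^ (n + N)) z"
  have wz: "word z (n + N + k) = u @ t @ v"
    using z by (simp add: word_append t_def shift_funpow_add)
  have a1: "cw u * cw v \<le> (K * exp (birkhoff_sum f n z - real n * P)) * (K * exp (birkhoff_sum f k ?z2 - real k * P))"
    using cyl_le[OF z(1), of n] cw_word[OF z(1), of n] z
      cyl_le[OF shift_in[OF z(1)], of "n + N" k] cw_word[OF shift_in[OF z(1)], of "n + N" k] K_ge1
    by (intro mult_mono) (auto simp: cw_nonneg)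
  have a2: "exp (- real N * (\<bar>P\<bar> + Bf)) \<le> exp (birkhoff_sum f N ?z1 - real N * P)"
  proof -
    have "real N * P \<le> real N * \<bar>P\<bar>" by (intro mult_left_mono) auto
    then show ?thesis using birkhoff_abs_le[OF shift_in[OF z(1)], of N n] by (simp add: algebra_simps)
  qed
  have "exp (- real N * (\<bar>P\<bar> + Bf)) * (cw u * cw v) \<le>
     exp (birkhoff_sum f N ?z1 - real N * P) *
     ((K * exp (birkhoff_sum f n z - real n * P)) * (K * exp (birkhoff_sum f k ?z2 - real k * P)))"
    by (rule mult_mono[OF a2 a1]) (auto simp: cw_nonneg)
  also have "\<dots> = K^2 * exp (birkhoff_sum f (n + N + k) z - real (n + N + k) * P)"
    unfolding birkhoff_sum_add[of f "n + N" k z] birkhoff_sum_add[of f n N z]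
    by (simp add: exp_add[symmetric] algebra_simps power2_eq_square)
  also have "\<dots> \<le> K^2 * (K * cw (u @ t @ v))"
    using cyl_ge[OF z(1), of "n + N + k"] cw_word[OF z(1), of "n + N + k"] wz
    by (intro mult_left_mono) auto
  finally have *: "exp (- real N * (\<bar>P\<bar> + Bf)) * (cw u * cw v) \<le> K^3 * cw (u @ t @ v)"
    by (simp add: power3_eq_cube power2_eq_square mult_ac)
  have "cl * (cw u * cw v) \<le> exp (- real N * (\<bar>P\<bar> + Bf)) / K^3 * (cw u * cw v)"
    by (intro mult_right_mono) (auto simp: cl_def cw_nonneg)
  also have "\<dots> \<le> cw (u @ t @ v)" using * K_ge1 by (simp add: field_simps)
  also have "\<dots> \<le> (\<Sum>t | length t = N. cw (u @ t @ v))"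
    by (rule member_le_sum) (auto simp: t_def cw_nonneg finite_words)
  finally show ?thesis .
qed

lemma expectation_append_le:
  fixes F G :: "'a list \<Rightarrow> real"
  assumes "\<And>v. 0 \<le> F v" "\<And>v. 0 \<le> G v"
  shows "expectation (\<lambda>x. F (word x n) * G (word ((shift ^^ n) x) k)) \<le>
    K^3 * (expectation (\<lambda>x. F (word x n)) * expectation (\<lambda>x. G (word x k)))"
proof -
  have "expectation (\<lambda>x. F (word x n) * G (word ((shift ^^ n) x) k)) =
    expectation (\<lambda>x. (\<lambda>v. F (take n v) * G (drop n v)) (word x (n + k)))"
    by (intro Bochner_Integration.integral_cong refl) (simp add: word_append)
  also have "\<dots> = (\<Sum>u | length u = n. \<Sum>v | length v = k. F u * G v * cw (u @ v))"
    unfolding expectation_word[of "\<lambda>v. F (take n v) * G (drop n v)" "n + k"] sum_words_add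
    by (auto intro!: sum.cong)
  also have "\<dots> \<le> (\<Sum>u | length u = n. \<Sum>v | length v = k. F u * G v * (K^3 * (cw u * cw v)))"
    using assms cw_append_le by (intro sum_mono mult_left_mono) auto
  also have "\<dots> = K^3 * (\<Sum>u | length u = n. \<Sum>v | length v = k. (F u * cw u) * (G v * cw v))"
    by (simp add: sum_distrib_left mult_ac)
  also have "\<dots> = K^3 * ((\<Sum>u | length u = n. F u * cw u) * (\<Sum>v | length v = k. G v * cw v))"
    by (simp only: sum_product)
  finally show ?thesis by (simp add: expectation_word)
qed

text \<open>Up to the factor \<open>cl\<close>, two blocks separated by a gap dominate two
  independent copies. \<open>F\<close> is any nonnegative function of the pair, not only a product,
  because it will be a squared difference.\<close>

lemma expectation_gap_ge:
  fixes F :: "'a list \<Rightarrow> 'a list \<Rightarrow> real"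
  assumes "\<And>u v. 0 \<le> F u v"
  shows "cl * (\<Sum>u | length u = n. \<Sum>v | length v = k. F u v * (cw u * cw v)) \<le>
    expectation (\<lambda>x. F (word x n) (word ((shift ^^ (n + N)) x) k))"
proof -
  have "expectation (\<lambda>x. F (word x n) (word ((shift ^^ (n + N)) x) k)) =
    expectation (\<lambda>x. (\<lambda>v. F (take n v) (drop (n + N) v)) (word x (n + (N + k))))"
    by (intro Bochner_Integration.integral_cong refl) (simp add: word_append shift_funpow_add)
  also have "\<dots> = (\<Sum>u | length u = n. \<Sum>t | length t = N. \<Sum>v | length v = k. F u v * cw (u @ t @ v))"
    unfolding expectation_word[of "\<lambda>v. F (take n v) (drop (n + N) v)" "n + (N + k)"] sum_words_add
    by (auto intro!: sum.cong)
  also have "\<dots> = (\<Sum>u | length u = n. \<Sum>v | length v = k. F u v * (\<Sum>t | length t = N. cw (u @ t @ v)))"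
    by (simp add: sum_distrib_left) (intro sum.cong[OF refl] sum.swap)
  also have "\<dots> \<ge> (\<Sum>u | length u = n. \<Sum>v | length v = k. F u v * (cl * (cw u * cw v)))"
    using gap_ge assms by (intro sum_mono mult_left_mono) auto
  finally show ?thesis by (simp add: sum_distrib_left mult_ac)
qed

end

section \<open>Mean ergodic theorem and exponential tails\<close>

lemma abs_birkhoff_sum_le:
  assumes "\<And>k. \<bar>g ((shift ^^ k) x)\<bar> \<le> 1" shows "\<bar>birkhoff_sum g n x\<bar> \<le> real n"
proof -
  have "\<bar>birkhoff_sum g n x\<bar> \<le> (\<Sum>k<n. 1)"
    unfolding birkhoff_sum_def by (intro order_trans[OF sum_abs] sum_mono assms)
  then show ?thesis by simp
qed

lemma birkhoff_word:
  "birkhoff_sum (\<lambda>x. G (word x w)) n x = (\<Sum>k<n. G (take w (drop k (word x (n + w)))))"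
  unfolding birkhoff_sum_def by (intro sum.cong refl, subst word_factor[where n = "n + w"]) auto

context gibbs
begin

lemma birkhoff_measurable [measurable]:
  assumes [measurable]: "g \<in> borel_measurable \<mu>" shows "birkhoff_sum g n \<in> borel_measurable \<mu>"
  unfolding birkhoff_sum_def by measurable

lemma integrable_bounded:
  assumes "F \<in> borel_measurable \<mu>" "\<And>x. x \<in> X \<Longrightarrow> \<bar>F x\<bar> \<le> (B :: real)"
  shows "integrable \<mu> F"
  using assms by (intro integrable_const_bound[where B = B]) (auto simp: space_mu)

lemma expectation_birkhoff:
  assumes "integrable \<mu> g"
  shows "expectation (birkhoff_sum g n) = real n * expectation (g :: _ \<Rightarrow> real)"
proof -
  have [measurable]: "g \<in> borel_measurable \<mu>" using assms by auto
  have "integrable \<mu> (\<lambda>x. g ((shift ^^ k) x))" for k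
    using integrable_distr_eq[of "shift ^^ k" \<mu> \<mu> g] assms by (simp add: distr_funpow_shift)
  then have "expectation (birkhoff_sum g n) = (\<Sum>k<n. expectation (\<lambda>x. g ((shift ^^ k) x)))"
    unfolding birkhoff_sum_def by (subst Bochner_Integration.integral_sum) auto
  then show ?thesis by (simp add: expectation_shift)
qed

text \<open>Parallelogram law: the second moment of a sum over \<open>2 M\<close> steps falls short of four times that over
  \<open>M\<close> steps by the mean square distance of two consecutive blocks, and by the lower mixing bound
  (after inserting a gap) this distance is at least a fixed multiple of the variance.\<close>

lemma second_moment_double:
  fixes G :: "'a list \<Rightarrow> real" and w :: nat
  defines "g \<equiv> \<lambda>x. G (word x w)"
  assumes G: "\<And>v. \<bar>G v\<bar> \<le> 1" and mean: "expectation g = 0"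
  shows "expectation (\<lambda>x. (birkhoff_sum g (2 * M) x)\<^sup>2) \<le>
    (4 - cl) * expectation (\<lambda>x. (birkhoff_sum g M x)\<^sup>2) + 4 * (real (w + N))\<^sup>2"
proof -
  define H where "H v = (\<Sum>k<M. G (take w (drop k v)))" for v
  define B where "B = birkhoff_sum g M"
  define D where "D = w + N"
  have gm [measurable]: "g \<in> borel_measurable \<mu>" unfolding g_def by simp
  have Bm [measurable]: "B \<in> borel_measurable \<mu>" unfolding B_def by simp
  have g1: "\<bar>g x\<bar> \<le> 1" for x by (simp add: g_def G)
  have absb: "\<bar>birkhoff_sum g n x\<bar> \<le> real n" for n x by (rule abs_birkhoff_sum_le) (rule g1)
  have BH: "B x = H (word x (M + w))" for x by (simp add: B_def g_def birkhoff_word H_def)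
  have EB: "expectation B = 0"
    unfolding B_def using mean integrable_bounded[OF gm g1] by (subst expectation_birkhoff) auto
  let ?V = "expectation (\<lambda>x. (B x)\<^sup>2)"
  have V: "?V = (\<Sum>u | length u = M + w. (H u)\<^sup>2 * cw u)"
    using expectation_word[of "\<lambda>v. (H v)\<^sup>2" "M + w"] by (simp add: BH)
  have E0: "(\<Sum>u | length u = M + w. H u * cw u) = 0"
    using expectation_word[of H "M + w"] EB by (simp add: BH[abs_def])
  \<comment> \<open>For independent copies of a centred variable the mean square difference is twice
    the second moment; the cross term vanishes by \<open>E0\<close>.\<close>
  have two: "(\<Sum>u | length u = M + w. \<Sum>v | length v = M + w. (H u - H v)\<^sup>2 * (cw u * cw v)) = 2 * ?V"
  proof -
    have *: "(\<Sum>v | length v = M + w. (H u - H v)\<^sup>2 * (cw u * cw v)) = (H u)\<^sup>2 * cw u + cw u * ?V" for u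
    proof -
      have "(\<Sum>v | length v = M + w. (H u - H v)\<^sup>2 * (cw u * cw v)) =
        (\<Sum>v | length v = M + w. (H u)\<^sup>2 * cw u * cw v - 2 * H u * cw u * (H v * cw v) + cw u * ((H v)\<^sup>2 * cw v))"
        by (intro sum.cong refl) (simp add: power2_eq_square algebra_simps)
      also have "\<dots> = (H u)\<^sup>2 * cw u * (\<Sum>v | length v = M + w. cw v)
         - 2 * H u * cw u * (\<Sum>v | length v = M + w. H v * cw v) + cw u * (\<Sum>v | length v = M + w. (H v)\<^sup>2 * cw v)"
        by (simp add: sum.distrib sum_subtractf sum_distrib_left)
      finally show ?thesis by (simp add: sum_cw E0 V)
    qed
    show ?thesis unfolding * by (simp add: sum.distrib sum_distrib_right[symmetric] sum_cw V)
  qed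
  \<comment> \<open>The block sum \<open>B\<close> reads \<open>M + w\<close> letters, so the
    partner block behind a gap \<open>N\<close> starts at \<open>M + D\<close> with
    \<open>D = w + N\<close>.\<close>
  have low: "cl * (2 * ?V) \<le> expectation (\<lambda>x. (B x - B ((shift ^^ (M + D)) x))\<^sup>2)"
    using expectation_gap_ge[of "\<lambda>u v. (H u - H v)\<^sup>2" "M + w" "M + w"]
    unfolding two by (simp add: BH D_def add_ac)
  \<comment> \<open>Moving a block by \<open>D\<close> steps drops \<open>D\<close> terms at one end
    and adds \<open>D\<close> at the other, so the adjacent block may be replaced by the one behind
    the gap.\<close>
  have near: "\<bar>B ((shift ^^ M) x) - B ((shift ^^ (M + D)) x)\<bar> \<le> 2 * real D" for x
  proof -
    let ?y = "(shift ^^ M) x"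
    have "birkhoff_sum g M ?y + birkhoff_sum g D ((shift ^^ M) ?y) =
          birkhoff_sum g D ?y + birkhoff_sum g M ((shift ^^ D) ?y)"
      using birkhoff_sum_add[of g M D ?y] birkhoff_sum_add[of g D M ?y] by (simp add: add.commute)
    then have "B ?y - B ((shift ^^ D) ?y) = birkhoff_sum g D ?y - birkhoff_sum g D ((shift ^^ M) ?y)"
      by (simp add: B_def)
    then show ?thesis using absb[of D ?y] absb[of D "(shift ^^ M) ?y"]
      by (simp add: shift_funpow_add)
  qed
  have Bab: "\<bar>B x\<bar> \<le> real M" for x unfolding B_def by (rule absb)
  have sq: "(b - c)\<^sup>2 \<le> (2 * real M)\<^sup>2" if "\<bar>b\<bar> \<le> real M" "\<bar>c\<bar> \<le> real M" for b c :: real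
    using that by (intro abs_le_square_iff[THEN iffD1]) auto
  have i1: "integrable \<mu> (\<lambda>x. (B ((shift ^^ k) x))\<^sup>2)" for k
    using Bab by (intro integrable_bounded[where B = "(real M)\<^sup>2"])
       (auto intro!: abs_le_square_iff[THEN iffD1])
  have i2: "integrable \<mu> (\<lambda>x. (B x - B ((shift ^^ k) x))\<^sup>2)" for k
    using Bab sq by (intro integrable_bounded[where B = "(2 * real M)\<^sup>2"]) auto
  \<comment> \<open>The parallelogram law gives minus the squared difference of adjacent blocks;
    \<open>2\<close> and \<open>near\<close> bound this by minus half the squared difference of the
    separated blocks, plus \<open>4 * D^2\<close>.\<close>
  have pt: "(birkhoff_sum g (2 * M) x)\<^sup>2 \<le> 2 * (B x)\<^sup>2 + 2 * (B ((shift ^^ M) x))\<^sup>2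
       - (B x - B ((shift ^^ (M + D)) x))\<^sup>2 / 2 + 4 * (real D)\<^sup>2" for x
  proof -
    let ?b = "B x" and ?c = "B ((shift ^^ M) x)" and ?d = "B ((shift ^^ (M + D)) x)"
    have 1: "(?c - ?d)\<^sup>2 \<le> (2 * real D)\<^sup>2" using near[of x] by (intro abs_le_square_iff[THEN iffD1]) auto
    have 2: "(b - d)\<^sup>2 \<le> 2 * (b - c)\<^sup>2 + 2 * (c - d)\<^sup>2" for b c d :: real
      using zero_le_power2[of "(b - c) - (c - d)"] by (simp add: power2_eq_square algebra_simps)
    have 3: "(b + c)\<^sup>2 = 2 * b\<^sup>2 + 2 * c\<^sup>2 - (b - c)\<^sup>2" for b c :: real
      by (simp add: power2_eq_square algebra_simps)
    have 4: "birkhoff_sum g (2 * M) x = ?b + ?c"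
      using birkhoff_sum_add[of g M M x] by (simp add: B_def mult_2)
    have 5: "(2 * real D)\<^sup>2 = 4 * (real D)\<^sup>2" by (simp add: power_mult_distrib)
    show ?thesis unfolding 4 3 using 1 2[of ?b ?d ?c] unfolding 5 by linarith
  qed
  have "expectation (\<lambda>x. (birkhoff_sum g (2 * M) x)\<^sup>2) \<le> expectation (\<lambda>x. 2 * (B x)\<^sup>2 +
      2 * (B ((shift ^^ M) x))\<^sup>2 - (B x - B ((shift ^^ (M + D)) x))\<^sup>2 / 2 + 4 * (real D)\<^sup>2)"
  proof (rule integral_mono)
    show "integrable \<mu> (\<lambda>x. (birkhoff_sum g (2 * M) x)\<^sup>2)"
      using absb[of "2 * M"] by (intro integrable_bounded[where B = "(real (2 * M))\<^sup>2"])
        (auto intro!: abs_le_square_iff[THEN iffD1] simp del: of_nat_mult)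
    show "integrable \<mu> (\<lambda>x. 2 * (B x)\<^sup>2 + 2 * (B ((shift ^^ M) x))\<^sup>2
         - (B x - B ((shift ^^ (M + D)) x))\<^sup>2 / 2 + 4 * (real D)\<^sup>2)"
      using i1[of 0] i1[of M] i2[of "M + D"] by simp
  qed (rule pt)
  also have "\<dots> = 2 * ?V + 2 * ?V - expectation (\<lambda>x. (B x - B ((shift ^^ (M + D)) x))\<^sup>2) / 2 + 4 * (real D)\<^sup>2"
    using i1[of 0] i1[of M] i2[of "M + D"] expectation_shift[of "\<lambda>x. (B x)\<^sup>2" M]
    by (simp add: prob_space)
  finally show ?thesis using low by (simp add: B_def D_def algebra_simps)
qed

text \<open>The doubling estimate is a recursion with factor \<open>4 - cl\<close> and additive
  error \<open>D\<close>. Adding \<open>D\<close> to the moments absorbs the error since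
  \<open>4 - cl \<ge> 2\<close>, and dividing by \<open>4^k\<close> leaves a geometric sequence of
  ratio \<open>(4 - cl) / 4 < 1\<close>.\<close>

lemma second_moment_tendsto:
  fixes G :: "'a list \<Rightarrow> real" and w :: nat
  assumes "\<And>v. \<bar>G v\<bar> \<le> 1" "expectation (\<lambda>x. G (word x w)) = 0"
  shows "(\<lambda>k. expectation (\<lambda>x. (birkhoff_sum (\<lambda>x. G (word x w)) (2^k) x)\<^sup>2) / 4^k) \<longlonglongrightarrow> 0"
proof -
  define s where "s k = expectation (\<lambda>x. (birkhoff_sum (\<lambda>x. G (word x w)) (2^k) x)\<^sup>2)" for k
  define D where "D = 4 * (real (w + N))\<^sup>2"
  have D0: "0 \<le> D" by (simp add: D_def)
  have s0: "0 \<le> s k" for k by (simp add: s_def)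
  have step: "s (Suc k) \<le> (4 - cl) * s k + D" for k
    using second_moment_double[OF assms, of "2^k"] by (simp add: s_def D_def)
  have bd: "s k + D \<le> (4 - cl)^k * (s 0 + D)" for k
  proof (induction k)
    case (Suc k)
    have "D * 2 \<le> D * (4 - cl)" using cl_le1 D0 by (intro mult_left_mono) auto
    then have "s (Suc k) + D \<le> (4 - cl) * (s k + D)" using step[of k] by (simp add: algebra_simps)
    also have "\<dots> \<le> (4 - cl) * ((4 - cl)^k * (s 0 + D))" using Suc cl_le1 by (intro mult_left_mono) auto
    finally show ?case by (simp add: mult_ac)
  qed simp
  have lim: "(\<lambda>k. ((4 - cl) / 4)^k * (s 0 + D)) \<longlonglongrightarrow> 0"
    using cl_le1 cl_pos by (intro tendsto_mult_left_zero LIMSEQ_realpow_zero) auto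
  have le: "s k / 4^k \<le> ((4 - cl) / 4)^k * (s 0 + D)" for k
  proof -
    have "s k / 4^k \<le> ((4 - cl)^k * (s 0 + D)) / 4^k" using bd[of k] D0 by (intro divide_right_mono) auto
    then show ?thesis by (simp add: power_divide)
  qed
  have "(\<lambda>k. s k / 4^k) \<longlonglongrightarrow> 0"
    using s0 le by (intro tendsto_sandwich[OF always_eventually always_eventually tendsto_const lim]) auto
  then show ?thesis by (simp add: s_def)
qed

text \<open>The second moment bound is applied to the centred function, which is still bounded by 1
  because \<open>G\<close> takes values in the unit interval; nonnegativity of the variance passes
  from the second moment to the mean absolute value.\<close>

lemma mean_ergodic:
  fixes G :: "'a list \<Rightarrow> real" and w :: nat
  defines "g \<equiv> \<lambda>x. G (word x w)"
  assumes G: "\<And>v. 0 \<le> G v" "\<And>v. G v \<le> 1"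
  shows "(\<lambda>k. expectation (\<lambda>x. \<bar>birkhoff_sum g (2^k) x / 2^k - expectation g\<bar>)) \<longlonglongrightarrow> 0"
proof -
  define a where "a = expectation g"
  have gm [measurable]: "g \<in> borel_measurable \<mu>" unfolding g_def by simp
  have ig: "integrable \<mu> g" unfolding g_def by (rule integrable_word)
  have a01: "0 \<le> a" "a \<le> 1" unfolding a_def
  proof -
    show "0 \<le> expectation g" using G by (intro Bochner_Integration.integral_nonneg) (auto simp: g_def)
    have "expectation g \<le> expectation (\<lambda>_. 1)" using G ig by (intro integral_mono) (auto simp: g_def)
    then show "expectation g \<le> 1" by (simp add: prob_space)
  qed
  define G0 where "G0 v = G v - a" for v
  have G01: "\<bar>G0 v\<bar> \<le> 1" for v using G(1)[of v] G(2)[of v] a01 by (auto simp: G0_def)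
  have m0: "expectation (\<lambda>x. G0 (word x w)) = 0"
    using ig by (simp add: G0_def a_def g_def prob_space)
  let ?B = "\<lambda>k. birkhoff_sum (\<lambda>x. G0 (word x w)) (2^k)"
  have B: "birkhoff_sum g (2^k) x / 2^k - a = ?B k x / 2^k" for k x
    by (simp add: birkhoff_sum_def G0_def g_def sum_subtractf field_simps)
  let ?s = "\<lambda>k. expectation (\<lambda>x. (?B k x)\<^sup>2) / 4^k"
  have le: "expectation (\<lambda>x. \<bar>?B k x / 2^k\<bar>) \<le> sqrt (?s k)" for k
  proof -
    let ?Z = "\<lambda>x. \<bar>?B k x / 2^k\<bar>"
    have ab: "\<bar>?B k x\<bar> \<le> 2^k" for x using abs_birkhoff_sum_le[of "\<lambda>x. G0 (word x w)" x "2^k"] G01 by simp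
    have i: "integrable \<mu> ?Z" using ab by (intro integrable_bounded[where B = 1]) (auto simp: field_simps)
    have i2: "integrable \<mu> (\<lambda>x. (?Z x)\<^sup>2)"
      using ab by (intro integrable_bounded[where B = 1]) (auto simp: field_simps power2_le_iff_abs_le)
    have "0 \<le> expectation (\<lambda>x. (?Z x)\<^sup>2) - (expectation ?Z)\<^sup>2"
      using variance_positive[of ?Z] unfolding variance_eq[OF i i2] .
    then have "(expectation ?Z)\<^sup>2 \<le> expectation (\<lambda>x. (?Z x)\<^sup>2)" by simp
    also have "\<dots> = ?s k"
    proof -
      have "((2::real)^k)\<^sup>2 = 4^k" by (simp add: power2_eq_square flip: power_mult_distrib)
      then have "(?Z x)\<^sup>2 = (?B k x)\<^sup>2 / 4^k" for x by (simp add: power_divide)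
      then show ?thesis by simp
    qed
    finally show ?thesis by (rule real_le_rsqrt)
  qed
  have lim: "(\<lambda>k. sqrt (?s k)) \<longlonglongrightarrow> 0"
    using tendsto_real_sqrt[OF second_moment_tendsto[of G0 w, OF G01 m0]] by simp
  have "0 \<le> expectation (\<lambda>x. \<bar>?B k x / 2^k\<bar>)" for k
    by (intro Bochner_Integration.integral_nonneg) auto
  then have "(\<lambda>k. expectation (\<lambda>x. \<bar>?B k x / 2^k\<bar>)) \<longlonglongrightarrow> 0"
    using le by (intro tendsto_sandwich[OF always_eventually always_eventually tendsto_const lim]) auto
  then show ?thesis by (simp add: a_def[symmetric] B)
qed

text \<open>Adjacent blocks are split off one at a time by \<open>expectation_append_le\<close>; no
  gaps are required for an upper bound, and each block costs one factor \<open>K^3\<close>.\<close>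

lemma expectation_prod_blocks_le:
  fixes h :: "'a list \<Rightarrow> real"
  assumes h: "\<And>v. 0 \<le> h v"
  shows "expectation (\<lambda>x. \<Prod>i<q. h (word ((shift ^^ (i * l)) x) l)) \<le>
    (K^3 * expectation (\<lambda>x. h (word x l)))^q"
proof (induction q)
  case (Suc q)
  define F where "F v = (\<Prod>i<q. h (take l (drop (i * l) v)))" for v
  have F: "(\<Prod>i<q. h (word ((shift ^^ (i * l)) x) l)) = F (word x (q * l))" for x
    unfolding F_def
  proof (intro prod.cong refl)
    fix i assume "i \<in> {..<q}"
    then have "Suc i * l \<le> q * l" by (intro mult_right_mono) auto
    then show "h (word ((shift ^^ (i * l)) x) l) = h (take l (drop (i * l) (word x (q * l))))"
      by (subst word_factor) auto
  qed
  have F0: "0 \<le> F v" for v unfolding F_def by (intro prod_nonneg) (auto simp: h)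
  have "expectation (\<lambda>x. \<Prod>i<Suc q. h (word ((shift ^^ (i * l)) x) l)) =
    expectation (\<lambda>x. F (word x (q * l)) * h (word ((shift ^^ (q * l)) x) l))"
    by (simp add: F)
  also have "\<dots> \<le> K^3 * (expectation (\<lambda>x. F (word x (q * l))) * expectation (\<lambda>x. h (word x l)))"
    by (rule expectation_append_le) (auto simp: F0 h)
  also have "\<dots> \<le> K^3 * ((K^3 * expectation (\<lambda>x. h (word x l)))^q * expectation (\<lambda>x. h (word x l)))"
    using Suc K_ge1 unfolding F
    by (intro mult_left_mono mult_right_mono) (auto intro!: Bochner_Integration.integral_nonneg simp: h)
  finally show ?case by (simp add: mult_ac)
qed (simp add: prob_space)

text \<open>Exponential Chebyshev over blocks works as soon as the exponential moment of one block
  is below \<open>1 / K^3\<close>. The mean ergodic theorem provides such a block: a long block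
  exceeds its mean by a linear amount only with a probability small enough to beat both
  \<open>K^3\<close> and the trivial bound \<open>exp \<tau>\<close> of the exponential.\<close>

lemma birkhoff_upper_tail:
  fixes G :: "'a list \<Rightarrow> real" and w :: nat
  defines "g \<equiv> \<lambda>x. G (word x w)"
  assumes G: "\<And>v. 0 \<le> G v" "\<And>v. G v \<le> 1" and eps: "0 < \<epsilon>"
  shows "\<exists>C q. 0 < q \<and> q < 1 \<and> (\<forall>n. prob {x\<in>space \<mu>. real n * (expectation g + \<epsilon>) \<le> birkhoff_sum g n x} \<le> C * q^n)"
proof -
  define a where "a = expectation g"
  have gm [measurable]: "g \<in> borel_measurable \<mu>" unfolding g_def by simp
  have g01: "0 \<le> g x" "g x \<le> 1" for x using G by (auto simp: g_def)
  have a0: "0 \<le> a" unfolding a_def using g01 by (intro Bochner_Integration.integral_nonneg) auto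
  define C0 where "C0 = K^3"
  have C0: "1 \<le> C0" using K_ge1 by (simp add: C0_def one_le_power)
  \<comment> \<open>Chosen so that a good block contributes at most \<open>1 / (4 * C0)\<close>. It
    depends on \<open>C0\<close> and \<epsilon> but not on the block length, which is fixed only
    afterwards.\<close>
  define \<tau> where "\<tau> = 4 * ln (4 * C0) / \<epsilon>"
  have tau0: "0 \<le> \<tau>" using C0 eps by (simp add: \<tau>_def)
  have tau: "exp (- \<tau> * \<epsilon> / 4) = 1 / (4 * C0)"
    using C0 eps by (simp add: \<tau>_def exp_minus field_simps)
  have "(\<lambda>k. expectation (\<lambda>x. \<bar>birkhoff_sum g (2^k) x / 2^k - a\<bar>)) \<longlonglongrightarrow> 0"
    unfolding a_def g_def by (rule mean_ergodic[OF G])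
  then have "eventually (\<lambda>k. expectation (\<lambda>x. \<bar>birkhoff_sum g (2^k) x / 2^k - a\<bar>) < \<epsilon> / (8 * exp \<tau> * C0)) sequentially"
    using eps C0 by (intro order_tendstoD) auto
  moreover have "eventually (\<lambda>k. real w * 4 / \<epsilon> \<le> 2^k) sequentially"
  proof -
    obtain k0 where "real w * 4 / \<epsilon> < 2^k0" using real_arch_pow[of 2 "real w * 4 / \<epsilon>"] by auto
    moreover have "(2::real)^k0 \<le> 2^k" if "k0 \<le> k" for k using that by (intro power_increasing) auto
    ultimately show ?thesis by (intro eventually_sequentiallyI[of k0]) (meson less_imp_le order_trans)
  qed
  ultimately have "eventually (\<lambda>k. expectation (\<lambda>x. \<bar>birkhoff_sum g (2^k) x / 2^k - a\<bar>) < \<epsilon> / (8 * exp \<tau> * C0) \<and>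
      real w * 4 / \<epsilon> \<le> 2^k) sequentially"
    by (rule eventually_conj)
  then obtain k where k: "expectation (\<lambda>x. \<bar>birkhoff_sum g (2^k) x / 2^k - a\<bar>) < \<epsilon> / (8 * exp \<tau> * C0)"
    "real w * 4 / \<epsilon> \<le> 2^k"
    using eventually_happens by force
  define M :: nat where "M = 2^k"
  \<comment> \<open>A sum over \<open>M\<close> steps reads \<open>M + w\<close> letters, so blocks
    have length \<open>l\<close>; the \<open>w\<close> terms skipped in each block are paid for by
    \<open>wl\<close> with \<epsilon>/4.\<close>
  define l where "l = M + w"
  have M0: "0 < M" by (simp add: M_def)
  then have l0: "0 < l" by (simp add: l_def)
  have wl: "real w / real l \<le> \<epsilon> / 4"
  proof -
    have "real w * 4 \<le> \<epsilon> * real M" using k(2) eps by (simp add: M_def field_simps)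
    also have "\<dots> \<le> \<epsilon> * real l" using eps by (simp add: l_def)
    finally show ?thesis using l0 by (simp add: field_simps)
  qed
  define B where "B = birkhoff_sum g M"
  define H where "H v = (\<Sum>j<M. G (take w (drop j v)))" for v
  have BH: "B x = H (word x l)" for x by (simp add: B_def g_def birkhoff_word H_def l_def)
  have Bm [measurable]: "B \<in> borel_measurable \<mu>" unfolding B_def by simp
  have bnn: "0 \<le> birkhoff_sum g n x" and ble: "birkhoff_sum g n x \<le> real n" for n x
    using abs_birkhoff_sum_le[of g x n] g01 by (auto simp: birkhoff_sum_def intro!: sum_nonneg)
  \<comment> \<open>The threshold is \<open>a + 3 * \<epsilon> / 4\<close>: a good block stays below
    \<open>a + \<epsilon> / 2\<close>, and the missing quarter of \<epsilon> is reserved for the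
    skipped terms.\<close>
  define h where "h v = exp (\<tau> * (H v / real l - a - 3 * \<epsilon> / 4))" for v
  let ?bad = "{x\<in>space \<mu>. \<epsilon> / 2 \<le> \<bar>B x / 2^k - a\<bar>}"
  have bad: "prob ?bad \<le> 1 / (4 * exp \<tau> * C0)"
  proof -
    have "prob ?bad \<le> expectation (\<lambda>x. \<bar>B x / 2^k - a\<bar>) / (\<epsilon> / 2)"
    proof (rule integral_Markov_inequality_measure[where A = "{}"])
      have "\<bar>B x / 2^k - a\<bar> \<le> 1 + a" for x
      proof -
        have "0 \<le> B x / 2^k" "B x / 2^k \<le> 1" using bnn[of M x] ble[of M x] by (auto simp: B_def M_def)
        then show ?thesis using a0 by linarith
      qed
      then show "integrable \<mu> (\<lambda>x. \<bar>B x / 2^k - a\<bar>)"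
        by (intro integrable_bounded[where B = "1 + a"]) auto
    qed (use eps in auto)
    also have "\<dots> \<le> (\<epsilon> / (8 * exp \<tau> * C0)) / (\<epsilon> / 2)"
      using k(1) eps by (intro divide_right_mono) (auto simp: B_def M_def)
    finally show ?thesis using eps by (simp add: field_simps)
  qed
  have hle: "h (word x l) \<le> exp (- \<tau> * \<epsilon> / 4) + exp \<tau> * indicator ?bad x" if "x \<in> space \<mu>" for x
  proof (cases "x \<in> ?bad")
    case True
    have "B x \<le> real l" using ble[of M x] by (simp add: B_def l_def)
    then have "B x / real l \<le> 1" using l0 by simp
    then have "B x / real l - a - 3 * \<epsilon> / 4 \<le> 1" using a0 eps by linarith
    then have "\<tau> * (B x / real l - a - 3 * \<epsilon> / 4) \<le> \<tau> * 1" using tau0 by (rule mult_left_mono)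
    then have "h (word x l) \<le> exp \<tau>" by (simp add: h_def BH[symmetric])
    then show ?thesis using True by (simp add: add_increasing)
  next
    case False
    have "B x / real l \<le> B x / real M"
      using bnn[of M x] M0 by (intro divide_left_mono) (auto simp: B_def l_def)
    also have "\<dots> \<le> a + \<epsilon> / 2"
    proof -
      have "\<not> \<epsilon> / 2 \<le> \<bar>B x / 2^k - a\<bar>" using False that by blast
      then show ?thesis unfolding M_def of_nat_power of_nat_numeral by linarith
    qed
    finally have "\<tau> * (B x / real l - a - 3 * \<epsilon> / 4) \<le> \<tau> * (- \<epsilon> / 4)" using tau0 by (intro mult_left_mono) auto
    then show ?thesis using False by (simp add: h_def BH[symmetric])
  qed
  have Eh: "C0 * expectation (\<lambda>x. h (word x l)) \<le> 1 / 2"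
  proof -
    have "expectation (\<lambda>x. h (word x l)) \<le> expectation (\<lambda>x. exp (- \<tau> * \<epsilon> / 4) + exp \<tau> * indicator ?bad x)"
      by (intro integral_mono hle integrable_word)
         (auto intro!: integrable_real_mult_indicator integrable_real_indicator simp: less_top[symmetric])
    also have "\<dots> = exp (- \<tau> * \<epsilon> / 4) + exp \<tau> * prob ?bad"
      by (subst Bochner_Integration.integral_add)
        (auto simp: prob_space less_top[symmetric] intro!: integrable_real_mult_indicator integrable_real_indicator
          arg_cong[where f = prob])
    also have "\<dots> \<le> 1 / (4 * C0) + exp \<tau> * (1 / (4 * exp \<tau> * C0))"
      using bad tau by (intro add_mono mult_left_mono) auto
    finally show ?thesis using C0 by (simp add: field_simps)
  qed
  have blocks: "birkhoff_sum g (q * l) x \<le> (\<Sum>i<q. B ((shift ^^ (i * l)) x) + real w)" for q x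
  proof (induction q)
    case (Suc q)
    let ?y = "(shift ^^ (q * l)) x"
    have "birkhoff_sum g (Suc q * l) x = birkhoff_sum g (q * l) x + birkhoff_sum g (M + w) ?y"
      using birkhoff_sum_add[of g "q * l" l x] by (simp add: l_def add_ac)
    also have "birkhoff_sum g (M + w) ?y \<le> B ?y + real w"
      using ble[of w "(shift ^^ M) ?y"] by (simp add: birkhoff_sum_add B_def)
    finally show ?case using Suc by simp
  qed (simp add: birkhoff_sum_def)
  have tail: "prob {x\<in>space \<mu>. real n * (a + \<epsilon>) \<le> birkhoff_sum g n x} \<le> exp \<tau> * (1/2)^(n div l)" for n
  proof -
    let ?q = "n div l"
    let ?P = "\<lambda>x. \<Prod>i<?q. h (word ((shift ^^ (i * l)) x) l)"
    \<comment> \<open>The incomplete last block contributes at most \<open>l\<close> to the Birkhoff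
      sum, that is 1 after division by \<open>l\<close>; hence the threshold
      \<open>exp (- \<tau>)\<close> instead of 1.\<close>
    have sub: "exp (- \<tau>) \<le> ?P x" if x: "real n * (a + \<epsilon>) \<le> birkhoff_sum g n x" for x
    proof -
      have nql: "n = ?q * l + n mod l" by simp
      have "real ?q * real l \<le> real n"
        by (metis div_times_less_eq_dividend of_nat_le_iff of_nat_mult)
      then have "real ?q * real l * (a + \<epsilon>) \<le> real n * (a + \<epsilon>)" using a0 eps by (intro mult_right_mono) auto
      also have "\<dots> \<le> birkhoff_sum g n x" by (rule x)
      also have "\<dots> = birkhoff_sum g (?q * l) x + birkhoff_sum g (n mod l) ((shift ^^ (?q * l)) x)"
        by (subst nql, subst birkhoff_sum_add) simp
      also have "\<dots> \<le> (\<Sum>i<?q. B ((shift ^^ (i * l)) x) + real w) + real l"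
      proof (intro add_mono blocks)
        have "birkhoff_sum g (n mod l) ((shift ^^ (?q * l)) x) \<le> real (n mod l)" by (rule ble)
        also have "\<dots> \<le> real l" using l0 by (simp add: less_imp_le)
        finally show "birkhoff_sum g (n mod l) ((shift ^^ (?q * l)) x) \<le> real l" .
      qed
      finally have "(real ?q * real l * (a + \<epsilon>)) / real l \<le> ((\<Sum>i<?q. B ((shift ^^ (i * l)) x) + real w) + real l) / real l"
        by (intro divide_right_mono) auto
      then have "real ?q * (a + \<epsilon>) \<le> (\<Sum>i<?q. B ((shift ^^ (i * l)) x) / real l + real w / real l) + 1"
        using l0 by (simp add: add_divide_distrib sum_divide_distrib)
      also have "\<dots> \<le> (\<Sum>i<?q. B ((shift ^^ (i * l)) x) / real l + \<epsilon> / 4) + 1"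
        using wl by (intro add_mono sum_mono) auto
      finally have "- 1 \<le> (\<Sum>i<?q. B ((shift ^^ (i * l)) x) / real l - a - 3 * \<epsilon> / 4)"
        by (simp add: sum.distrib sum_subtractf algebra_simps)
      then have "\<tau> * (- 1) \<le> \<tau> * (\<Sum>i<?q. B ((shift ^^ (i * l)) x) / real l - a - 3 * \<epsilon> / 4)"
        using tau0 by (rule mult_left_mono)
      then have "exp (- \<tau>) \<le> exp (\<Sum>i<?q. \<tau> * (B ((shift ^^ (i * l)) x) / real l - a - 3 * \<epsilon> / 4))"
        by (simp add: sum_distrib_left)
      also have "\<dots> = ?P x" by (simp add: exp_sum h_def BH)
      finally show ?thesis .
    qed
    have P0: "0 \<le> ?P x" for x by (intro prod_nonneg) (auto simp: h_def)
    have iP: "integrable \<mu> ?P"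
    proof -
      define F where "F v = (\<Prod>i<?q. h (take l (drop (i * l) v)))" for v
      have "?P = (\<lambda>x. F (word x (?q * l)))"
      proof (intro ext, unfold F_def, intro prod.cong refl)
        fix x i assume "i \<in> {..<?q}"
        then have "Suc i * l \<le> ?q * l" by (intro mult_right_mono) auto
        then show "h (word ((shift ^^ (i * l)) x) l) = h (take l (drop (i * l) (word x (?q * l))))"
          by (subst word_factor) auto
      qed
      then show ?thesis using integrable_word[of F] by simp
    qed
    have "prob {x\<in>space \<mu>. real n * (a + \<epsilon>) \<le> birkhoff_sum g n x} \<le> prob {x\<in>space \<mu>. exp (- \<tau>) \<le> ?P x}"
      using sub by (intro finite_measure_mono) auto
    also have "\<dots> \<le> expectation ?P / exp (- \<tau>)"
      using P0 by (intro integral_Markov_inequality_measure[where A = "{}"] iP) auto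
    also have "\<dots> = exp \<tau> * expectation ?P" by (simp add: exp_minus field_simps)
    also have "\<dots> \<le> exp \<tau> * (C0 * expectation (\<lambda>x. h (word x l)))^?q"
      unfolding C0_def by (intro mult_left_mono expectation_prod_blocks_le) (auto simp: h_def)
    also have "\<dots> \<le> exp \<tau> * (1/2)^?q"
      using Eh C0 by (intro mult_left_mono power_mono mult_nonneg_nonneg Bochner_Integration.integral_nonneg) (auto simp: h_def)
    finally show ?thesis .
  qed
  \<comment> \<open>The \<open>l\<close>-th root of one half turns decay per block into decay per
    step; rounding in \<open>n div l\<close> costs the factor 2.\<close>
  define r where "r = (1/2 :: real) powr (1 / real l)"
  have "(1/2 :: real) powr (1 / real l) < 1 powr (1 / real l)" using l0 by (intro powr_less_mono2) auto
  then have r: "0 < r" "r < 1" by (simp_all add: r_def)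
  have "(1/2 :: real)^(n div l) \<le> 2 * r^n" for n
  proof -
    have "n < l * (n div l) + l" using dividend_less_times_div[OF l0, of n] by (simp add: add.commute)
    then have "real n < real (l * (n div l) + l)" by linarith
    then have "real n / real l - 1 \<le> real (n div l)" using l0 by (simp add: field_simps)
    then have "(1/2 :: real) powr real (n div l) \<le> (1/2) powr (real n / real l - 1)"
      by (intro powr_mono') auto
    also have "\<dots> = 2 * (1/2) powr (1 / real l * real n)" unfolding powr_diff by simp
    also have "\<dots> = 2 * r powr real n" unfolding r_def powr_powr ..
    finally show ?thesis using r by (simp add: powr_realpow)
  qed
  then have "exp \<tau> * (1/2)^(n div l) \<le> exp \<tau> * (2 * r^n)" for n
    by (intro mult_left_mono) auto
  then have "prob {x\<in>space \<mu>. real n * (a + \<epsilon>) \<le> birkhoff_sum g n x} \<le> exp \<tau> * (2 * r^n)" for n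
    by (rule order_trans[OF tail])
  then show ?thesis using r unfolding a_def mult.assoc[symmetric] by blast
qed

end

section \<open>Concentration and uniform Gibbs constants\<close>

context gibbs
begin

text \<open>The lower tail is the upper tail of \<open>1 - G\<close>, which also takes values in the
  unit interval.\<close>

lemma birkhoff_concentration_word:
  fixes G :: "'a list \<Rightarrow> real" and w :: nat
  defines "g \<equiv> \<lambda>x. G (word x w)"
  assumes G: "\<And>v. 0 \<le> G v" "\<And>v. G v \<le> 1" and eps: "0 < \<epsilon>"
  shows "\<exists>C q. 0 < q \<and> q < 1 \<and>
    (\<forall>n. prob {x\<in>space \<mu>. real n * \<epsilon> \<le> \<bar>birkhoff_sum g n x - real n * expectation g\<bar>} \<le> C * q^n)"
proof -
  have gm [measurable]: "g \<in> borel_measurable \<mu>" unfolding g_def by simp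
  have ig: "integrable \<mu> g" unfolding g_def by (rule integrable_word)
  obtain C1 q1 where 1: "0 < q1" "q1 < 1"
    "\<And>n. prob {x\<in>space \<mu>. real n * (expectation g + \<epsilon>) \<le> birkhoff_sum g n x} \<le> C1 * q1^n"
    using birkhoff_upper_tail[of G \<epsilon> w] G eps unfolding g_def by blast
  let ?g' = "\<lambda>x. 1 - G (word x w)"
  obtain C2 q2 where 2: "0 < q2" "q2 < 1"
    "\<And>n. prob {x\<in>space \<mu>. real n * (expectation ?g' + \<epsilon>) \<le> birkhoff_sum ?g' n x} \<le> C2 * q2^n"
    using birkhoff_upper_tail[of "\<lambda>v. 1 - G v" \<epsilon> w] G eps by auto
  have E': "expectation ?g' = 1 - expectation g"
    using ig by (simp add: g_def prob_space)
  have B': "birkhoff_sum ?g' n x = real n - birkhoff_sum g n x" for n x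
    by (simp add: birkhoff_sum_def g_def sum_subtractf)
  have "C1 \<ge> 0" "C2 \<ge> 0"
    using order_trans[OF measure_nonneg 1(3)[of 0]] order_trans[OF measure_nonneg 2(3)[of 0]] by simp_all
  have "prob {x\<in>space \<mu>. real n * \<epsilon> \<le> \<bar>birkhoff_sum g n x - real n * expectation g\<bar>} \<le> (C1 + C2) * (max q1 q2)^n" for n
  proof -
    have "prob {x\<in>space \<mu>. real n * \<epsilon> \<le> \<bar>birkhoff_sum g n x - real n * expectation g\<bar>} \<le>
      prob ({x\<in>space \<mu>. real n * (expectation g + \<epsilon>) \<le> birkhoff_sum g n x} \<union>
        {x\<in>space \<mu>. real n * (expectation ?g' + \<epsilon>) \<le> birkhoff_sum ?g' n x})"
      unfolding E' B' by (intro finite_measure_mono) (auto simp: algebra_simps abs_if split: if_splits)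
    also have "\<dots> \<le> C1 * q1^n + C2 * q2^n"
      using 1(3)[of n] 2(3)[of n] by (intro order_trans[OF measure_Un_le]) auto
    also have "\<dots> \<le> C1 * (max q1 q2)^n + C2 * (max q1 q2)^n"
      using 1 2 \<open>C1 \<ge> 0\<close> \<open>C2 \<ge> 0\<close> by (intro add_mono mult_left_mono power_mono) auto
    finally show ?thesis by (simp add: algebra_simps)
  qed
  then show ?thesis using 1 2 by (intro exI[of _ "C1 + C2"] exI[of _ "max q1 q2"]) auto
qed

text \<open>A function of the two-sided sequence is approximated by words on \<open>0..<n\<close>
  only after a shift by \<open>j\<close> that moves its window into the nonnegative coordinates;
  invariance of the measure makes the shift harmless. The deviation \<epsilon> splits into
  \<epsilon>/4 for the means, \<epsilon>/4 for the pointwise approximation and \<epsilon>/2 for the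
  word function.\<close>

lemma birkhoff_concentration:
  assumes gm [measurable]: "g \<in> borel_measurable \<mu>"
    and g01: "\<And>x. x \<in> X \<Longrightarrow> 0 \<le> g x" "\<And>x. x \<in> X \<Longrightarrow> g x \<le> (1 :: real)"
    and approx: "\<And>\<delta>. 0 < \<delta> \<Longrightarrow> \<exists>j n G. \<forall>x\<in>X. \<bar>g ((shift ^^ j) x) - G (word x n)\<bar> \<le> \<delta>"
    and eps: "0 < \<epsilon>"
  shows "\<exists>C q. 0 < q \<and> q < 1 \<and>
    (\<forall>n. prob {x\<in>space \<mu>. real n * \<epsilon> \<le> \<bar>birkhoff_sum g n x - real n * expectation g\<bar>} \<le> C * q^n)"
proof -
  obtain j w G0 where G0: "\<And>x. x \<in> X \<Longrightarrow> \<bar>g ((shift ^^ j) x) - G0 (word x w)\<bar> \<le> \<epsilon> / 4"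
    using approx[of "\<epsilon> / 4"] eps by auto
  \<comment> \<open>Clipping to the unit interval does not increase the distance to
    \<open>g\<close>, whose values lie there.\<close>
  define G where "G v = max 0 (min 1 (G0 v))" for v
  define g' where "g' = (\<lambda>x. G (word x w))"
  have gm' [measurable]: "g' \<in> borel_measurable \<mu>" unfolding g'_def by simp
  have G01: "0 \<le> G v" "G v \<le> 1" for v by (auto simp: G_def)
  have close: "\<bar>g ((shift ^^ j) x) - g' x\<bar> \<le> \<epsilon> / 4" if "x \<in> X" for x
    using G0[OF that] g01[OF shift_in[OF that, of j]] by (auto simp: g'_def G_def max_def min_def split: if_splits)
  have ig: "integrable \<mu> (\<lambda>x. g ((shift ^^ j) x))"
    using g01 shift_in by (intro integrable_bounded[where B = 1]) auto
  have ig': "integrable \<mu> g'" unfolding g'_def by (rule integrable_word)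
  have "\<bar>expectation (\<lambda>x. g ((shift ^^ j) x)) - expectation g'\<bar> \<le> expectation (\<lambda>x. \<bar>g ((shift ^^ j) x) - g' x\<bar>)"
    using integral_abs_bound[of \<mu> "\<lambda>x. g ((shift ^^ j) x) - g' x"] ig ig' by simp
  also have "\<dots> \<le> expectation (\<lambda>_. \<epsilon> / 4)"
    using close ig ig' by (intro integral_mono) (auto simp: space_mu)
  finally have E: "\<bar>expectation g - expectation g'\<bar> \<le> \<epsilon> / 4"
    by (simp add: expectation_shift prob_space)
  obtain C q where C: "0 < q" "q < 1"
    "\<And>n. prob {x\<in>space \<mu>. real n * (\<epsilon> / 2) \<le> \<bar>birkhoff_sum g' n x - real n * expectation g'\<bar>} \<le> C * q^n"
    using birkhoff_concentration_word[of G "\<epsilon> / 2" w] G01 eps unfolding g'_def by auto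
  have "prob {x\<in>space \<mu>. real n * \<epsilon> \<le> \<bar>birkhoff_sum g n x - real n * expectation g\<bar>} \<le> C * q^n" for n
  proof -
    have B: "\<bar>birkhoff_sum g n ((shift ^^ j) x) - birkhoff_sum g' n x\<bar> \<le> real n * (\<epsilon> / 4)" if "x \<in> X" for x
    proof -
      have "\<bar>birkhoff_sum g n ((shift ^^ j) x) - birkhoff_sum g' n x\<bar> \<le>
        (\<Sum>k<n. \<bar>g ((shift ^^ j) ((shift ^^ k) x)) - g' ((shift ^^ k) x)\<bar>)"
        unfolding birkhoff_sum_def sum_subtractf[symmetric]
        by (intro order_trans[OF sum_abs]) (simp add: shift_funpow_add add.commute)
      also have "\<dots> \<le> (\<Sum>k<n. \<epsilon> / 4)" by (intro sum_mono close shift_in that)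
      finally show ?thesis by simp
    qed
    let ?A = "{x\<in>space \<mu>. real n * \<epsilon> \<le> \<bar>birkhoff_sum g n x - real n * expectation g\<bar>}"
    have "prob ?A = measure (distr \<mu> \<mu> (shift ^^ j)) ?A" by (simp add: distr_funpow_shift)
    also have "\<dots> = prob ((shift ^^ j) -` ?A \<inter> space \<mu>)" by (rule measure_distr) auto
    also have "\<dots> \<le> prob {x\<in>space \<mu>. real n * (\<epsilon> / 2) \<le> \<bar>birkhoff_sum g' n x - real n * expectation g'\<bar>}"
    proof (intro finite_measure_mono)
      show "(shift ^^ j) -` ?A \<inter> space \<mu> \<subseteq> {x\<in>space \<mu>. real n * (\<epsilon> / 2) \<le> \<bar>birkhoff_sum g' n x - real n * expectation g'\<bar>}"
      proof
        fix x assume x: "x \<in> (shift ^^ j) -` ?A \<inter> space \<mu>"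
        then have 1: "real n * \<epsilon> \<le> \<bar>birkhoff_sum g n ((shift ^^ j) x) - real n * expectation g\<bar>" and "x \<in> X"
          by (auto simp: space_mu)
        note B[OF \<open>x \<in> X\<close>]
        moreover have "\<bar>real n * expectation g - real n * expectation g'\<bar> \<le> real n * (\<epsilon> / 4)"
          using mult_left_mono[OF E, of "real n"] by (simp add: abs_mult right_diff_distrib[symmetric])
        ultimately have "real n * \<epsilon> - real n * (\<epsilon> / 4) - real n * (\<epsilon> / 4) \<le> \<bar>birkhoff_sum g' n x - real n * expectation g'\<bar>"
          using 1 by linarith
        then show "x \<in> {x\<in>space \<mu>. real n * (\<epsilon> / 2) \<le> \<bar>birkhoff_sum g' n x - real n * expectation g'\<bar>}"
          using x by (simp add: mult.commute)
      qed
    qed auto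
    also have "\<dots> \<le> C * q^n" by (rule C)
    finally show ?thesis .
  qed
  then show ?thesis using C by blast
qed

text \<open>By the mean ergodic theorem the measure of a word is the limiting
  frequency of the word under the measures with weights \<open>s v\<close> on long words; the latter only involve
  partition functions \<open>Z\<close>, whose growth is controlled by sub- and supermultiplicativity.\<close>

lemma uniform_gibbs:
  assumes V: "\<And>x y n. x \<in> X \<Longrightarrow> y \<in> X \<Longrightarrow> word x n = word y n \<Longrightarrow>
      \<bar>birkhoff_sum f n x - birkhoff_sum f n y\<bar> \<le> V"
    and V0: "0 \<le> V" and Bf0: "0 \<le> Bf" and Pb: "\<bar>P\<bar> \<le> Pb"
  shows "gibbs X f \<mu> P (exp (16 * V + 3 * (real N * (Pb + Bf)))) Bf N"
proof -
  define Q where "Q = real N * (Pb + Bf)"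
  have Q0: "0 \<le> Q" using Bf0 Pb by (auto simp: Q_def)
  \<comment> \<open>\<open>A\<close> and \<open>c\<close> are the constants of sub- and
    supermultiplicativity of the weights \<open>s\<close>: each exchange of a point for the
    representative of its word costs \<open>exp V\<close>, twice in the first case and three times
    in the second, and \<open>exp (- Q)\<close> bounds the weight of the gap.\<close>
  define A where "A = exp (2 * V)"
  define c where "c = exp (- 3 * V - Q)"
  have A0: "0 < A" and c0: "0 < c" by (auto simp: A_def c_def)
  define e where "e x n = exp (birkhoff_sum f n x - real n * P)" for x n
  define occ where "occ v \<longleftrightarrow> (\<exists>x\<in>X. word x (length v) = v)" for v
  define rep where "rep v = (SOME x. x \<in> X \<and> word x (length v) = v)" for v
  \<comment> \<open>The Gibbs weight at a chosen point of the cylinder, 0 for words that do not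
    occur. It is determined by \<open>f\<close> and \<open>P\<close> without the measure, so the
    estimates \<open>sub\<close> and \<open>sup\<close> are free of \<open>K\<close>.\<close>
  define s where "s v = (if occ v then e (rep v) (length v) else 0)" for v
  have rep: "rep v \<in> X" "word (rep v) (length v) = v" if "occ v" for v
    using someI_ex[of "\<lambda>x. x \<in> X \<and> word x (length v) = v"] that unfolding occ_def rep_def by auto
  have occ_word: "occ (word x n)" if "x \<in> X" for x n using that by (auto simp: occ_def)
  have s0: "0 \<le> s v" for v by (simp add: s_def e_def)
  have e_add: "e x (n + k) = e x n * e ((shift ^^ n) x) k" for x n k
    unfolding e_def birkhoff_sum_add[of f n k x] by (simp add: exp_add[symmetric] algebra_simps)
  have e_var: "e x n \<le> exp V * e y n" if "x \<in> X" "y \<in> X" "word x n = word y n" for x y n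
    using V[OF that] by (simp add: e_def exp_add[symmetric])
  have sx1: "e x n \<le> exp V * s (word x n)" and sx2: "s (word x n) \<le> exp V * e x n" if "x \<in> X" for x n
    using e_var[of x "rep (word x n)" n] e_var[of "rep (word x n)" x n] rep[OF occ_word[OF that, of n]] occ_word[OF that, of n] that
    by (auto simp: s_def)
  have sub: "s (u @ v) \<le> A * (s u * s v)" for u v
  proof (cases "occ (u @ v)")
    case True
    let ?x = "rep (u @ v)" and ?n = "length u" and ?k = "length v"
    have x: "?x \<in> X" "word ?x (?n + ?k) = u @ v" using rep[OF True] by auto
    have w: "word ?x ?n = u" "word ((shift ^^ ?n) ?x) ?k = v"
      using x(2) word_append[of ?x ?n ?k] by auto
    have "s (u @ v) = e ?x ?n * e ((shift ^^ ?n) ?x) ?k"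
      using True by (simp add: s_def e_add)
    also have "\<dots> \<le> (exp V * s u) * (exp V * s v)"
      using sx1[OF x(1), of ?n] sx1[OF shift_in[OF x(1), of ?n], of ?k] w
      by (intro mult_mono) (auto simp: e_def s0)
    finally have "s (u @ v) \<le> (exp V * s u) * (exp V * s v)" .
    moreover have "A = exp V * exp V" by (simp add: A_def exp_add[symmetric])
    ultimately show ?thesis by (simp add: mult_ac)
  qed (use s0 A0 in \<open>simp add: s_def e_def\<close>)
  have sup: "c * (s u * s v) \<le> (\<Sum>t | length t = N. s (u @ t @ v))" for u v
  proof (cases "occ u \<and> occ v")
    case True
    let ?n = "length u" and ?k = "length v"
    obtain z where z: "z \<in> X" "word z ?n = u" "word ((shift ^^ (?n + N)) z) ?k = v"
      using glue_at[of "rep u" "rep v" ?n] rep True by metis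
    define t where "t = word ((shift ^^ ?n) z) N"
    have wz: "word z (?n + N + ?k) = u @ t @ v"
      using z by (simp add: word_append t_def shift_funpow_add)
    have g: "exp (- Q) \<le> e ((shift ^^ ?n) z) N"
    proof -
      have "real N * P \<le> real N * Pb" using Pb by (intro mult_left_mono) auto
      then show ?thesis using birkhoff_abs_le[OF shift_in[OF z(1), of ?n], of N]
        by (simp add: e_def Q_def algebra_simps)
    qed
    have "s u * s v \<le> (exp V * e z ?n) * (exp V * e ((shift ^^ (?n + N)) z) ?k)"
      using sx2[OF z(1), of ?n] sx2[OF shift_in[OF z(1), of "?n + N"], of ?k] z
      by (intro mult_mono) (auto simp: s0 e_def)
    then have "exp (- Q) * (s u * s v) \<le> e ((shift ^^ ?n) z) N * ((exp V * e z ?n) * (exp V * e ((shift ^^ (?n + N)) z) ?k))"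
      by (rule mult_mono[OF g]) (auto simp: s0 e_def)
    also have "\<dots> = exp V * exp V * e z (?n + N + ?k)"
      unfolding e_add[of z "?n + N" ?k] e_add[of z ?n N] by (simp add: mult_ac)
    also have "\<dots> \<le> exp V * exp V * (exp V * s (u @ t @ v))"
      using sx1[OF z(1), of "?n + N + ?k"] wz by (intro mult_left_mono) auto
    also have "\<dots> = (exp V * exp V * exp V) * s (u @ t @ v)" by (simp only: mult.assoc)
    also have "exp V * exp V * exp V = exp (3 * V)" by (simp add: exp_add[symmetric])
    finally have "exp (- Q) * (s u * s v) \<le> exp (3 * V) * s (u @ t @ v)" .
    then have "exp (- 3 * V) * (exp (- Q) * (s u * s v)) \<le> exp (- 3 * V) * (exp (3 * V) * s (u @ t @ v))"
      by (rule mult_left_mono) auto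
    moreover have "exp (- 3 * V) * exp (3 * V) = 1" "exp (- 3 * V) * exp (- Q) = c"
      by (simp_all add: c_def exp_add[symmetric])
    ultimately have "c * (s u * s v) \<le> s (u @ t @ v)"
      by (simp only: mult.assoc[symmetric] mult_1_left)
    also have "\<dots> \<le> (\<Sum>t | length t = N. s (u @ t @ v))"
      by (rule member_le_sum) (auto simp: t_def s0 finite_words)
    finally show ?thesis .
  qed (use s0 in \<open>auto simp: s_def e_def intro!: sum_nonneg\<close>)
  \<comment> \<open>The given constant \<open>K\<close> enters here. It keeps \<open>Z\<close>
    between two positive bounds and multiplies an error term that tends to 0, so it disappears from
    the final estimates.\<close>
  have cs: "cw v \<le> K * s v" "s v \<le> K * cw v" for v
  proof (atomize (full), cases "occ v")
    case True
    then show "cw v \<le> K * s v \<and> s v \<le> K * cw v"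
      using cyl_le[OF rep(1)[OF True], of "length v"] cyl_ge[OF rep(1)[OF True], of "length v"]
        cw_word[OF rep(1)[OF True], of "length v"] rep(2)[OF True]
      by (simp add: s_def e_def)
  next
    case False
    then have "cw v = 0" using cw_pos_ex[of v] by (auto simp: occ_def)
    then show "cw v \<le> K * s v \<and> s v \<le> K * cw v" using False by (simp add: s_def)
  qed
  define Z where "Z n = (\<Sum>v | length v = n. s v)" for n
  have Z0: "0 \<le> Z n" for n by (auto simp: Z_def intro!: sum_nonneg s0)
  have ZK1: "1 \<le> K * Z n" for n
    using sum_mono[of "{v. length v = n}" cw "\<lambda>v. K * s v"] cs by (simp add: Z_def sum_cw sum_distrib_left)
  have ZK2: "Z n \<le> K" for n
  proof -
    have "Z n \<le> (\<Sum>v | length v = n. K * cw v)" unfolding Z_def by (intro sum_mono cs)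
    then show ?thesis by (simp add: sum_distrib_left[symmetric] sum_cw)
  qed
  have Zsub: "Z (n + k) \<le> A * (Z n * Z k)" for n k
  proof -
    have "Z (n + k) \<le> (\<Sum>u | length u = n. \<Sum>v | length v = k. A * (s u * s v))"
      unfolding Z_def sum_words_add by (intro sum_mono sub)
    also have "\<dots> = A * (Z n * Z k)"
      unfolding Z_def sum_product by (simp only: sum_distrib_left)
    finally show ?thesis .
  qed
  have Zsup: "c * (Z n * Z k) \<le> Z (n + N + k)" for n k
  proof -
    have "c * (Z n * Z k) = (\<Sum>u | length u = n. \<Sum>v | length v = k. c * (s u * s v))"
      unfolding Z_def sum_product by (simp only: sum_distrib_left)
    also have "\<dots> \<le> (\<Sum>u | length u = n. \<Sum>v | length v = k. \<Sum>t | length t = N. s (u @ t @ v))"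
      by (intro sum_mono sup)
    also have "\<dots> = (\<Sum>u | length u = n. \<Sum>t | length t = N. \<Sum>v | length v = k. s (u @ t @ v))"
      by (intro sum.cong[OF refl] sum.swap)
    also have "\<dots> = Z (n + N + k)" unfolding Z_def sum_words_add add.assoc ..
    finally show ?thesis .
  qed
  \<comment> \<open>If \<open>A * Z n\<close> were below 1, submultiplicativity would make
    \<open>Z (k * n)\<close> decay exponentially in \<open>k\<close>, against the fixed lower bound
    \<open>1 / K\<close>. This replaces \<open>K\<close> by \<open>A\<close>.\<close>
  have AZ: "1 \<le> A * Z n" for n
  proof (rule ccontr)
    assume "\<not> 1 \<le> A * Z n"
    then have "A * Z n < 1" by simp
    have pw: "Z (k * n) \<le> (A * Z n)^k * K" for k
    proof (induction k)
      case (Suc k)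
      have "Z (Suc k * n) \<le> A * (Z n * Z (k * n))" using Zsub[of n "k * n"] by simp
      also have "\<dots> \<le> A * (Z n * ((A * Z n)^k * K))" using Suc A0 Z0 by (intro mult_left_mono) auto
      finally show ?case by (simp add: mult_ac)
    qed (use ZK2 in simp)
    have "1 \<le> K * ((A * Z n)^k * K)" for k
      using ZK1[of "k * n"] mult_left_mono[OF pw[of k], of K] K_ge1 by linarith
    then have "1 / K^2 \<le> (A * Z n)^k" for k
      using K_ge1 by (simp add: field_simps power2_eq_square)
    moreover obtain k where "(A * Z n)^k < 1 / K^2"
      using real_arch_pow_inv[of "1 / K^2" "A * Z n"] K_ge1 \<open>A * Z n < 1\<close> by auto
    ultimately show False by (meson not_le)
  qed
  \<comment> \<open>The mirror argument: if \<open>c * Z n\<close> exceeded 1, supermultiplicativity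
    with gaps would make \<open>Z\<close> unbounded, against \<open>ZK2\<close>.\<close>
  have cZ: "c * Z n \<le> 1" for n
  proof (rule ccontr)
    assume "\<not> c * Z n \<le> 1"
    then have gt: "1 < c * Z n" by simp
    have pw: "(c * Z n)^k \<le> K * Z (n + k * (N + n))" for k
    proof (induction k)
      case (Suc k)
      have "(c * Z n)^Suc k \<le> (c * Z n) * (K * Z (n + k * (N + n)))"
        using Suc gt by (simp add: mult_left_mono)
      also have "\<dots> = K * (c * (Z (n + k * (N + n)) * Z n))" by simp
      also have "\<dots> \<le> K * Z (n + k * (N + n) + N + n)" using Zsup K_ge1 by (intro mult_left_mono) auto
      finally show ?case by (simp add: algebra_simps)
    qed (use ZK1 in simp)
    have "(c * Z n)^k \<le> K * K" for k
      using pw[of k] mult_left_mono[OF ZK2[of "n + k * (N + n)"], of K] K_ge1 by linarith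
    moreover obtain k where "K * K < (c * Z n)^k" using real_arch_pow[OF gt] by blast
    ultimately show False by (meson not_le)
  qed
  have Zle: "Z n \<le> 1 / c" and Zge: "1 / A \<le> Z n" for n
    using cZ[of n] AZ[of n] c0 A0 by (auto simp: field_simps)
  have word_bounds: "cw w \<le> A^3 / c^2 * s w \<and> s w \<le> A^2 / c^3 * cw w" for w
  proof -
    let ?m = "length w"
    \<comment> \<open>The total weight of all words in which \<open>w\<close> is preceded by
      \<open>i\<close> and followed by \<open>j\<close> letters.\<close>
    define R where "R i j = (\<Sum>u | length u = i. \<Sum>v | length v = j. s (u @ w @ v))" for i j
    have R0: "0 \<le> R i j" for i j unfolding R_def by (intro sum_nonneg s0)
    have R_le: "R i j \<le> A^2 / c^2 * s w" for i j
    proof -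
      have "s (u @ w @ v) \<le> A * (s u * (A * (s w * s v)))" for u v
        using A0 by (intro order_trans[OF sub[of u "w @ v"]] mult_left_mono sub) (auto simp: s0)
      then have "R i j \<le> (\<Sum>u | length u = i. \<Sum>v | length v = j. A * (s u * (A * (s w * s v))))"
        unfolding R_def by (intro sum_mono)
      also have "\<dots> = A^2 * s w * (\<Sum>u | length u = i. \<Sum>v | length v = j. s u * s v)"
        by (simp add: sum_distrib_left power2_eq_square mult_ac)
      also have "\<dots> = A^2 * s w * (Z i * Z j)" unfolding Z_def sum_product ..
      also have "\<dots> \<le> A^2 * s w * (1 / c * (1 / c))"
        using Zle c0 by (intro mult_left_mono mult_mono) (auto simp: s0 Z0)
      finally show ?thesis by (simp add: power2_eq_square)
    qed
    \<comment> \<open>For a lower bound a gap of length \<open>N\<close> is needed on each side of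
      \<open>w\<close>, hence the indices \<open>i + N\<close> and \<open>N + j\<close>.\<close>
    have R_ge: "c^2 / A^2 * s w \<le> R (i + N) (N + j)" for i j
    proof -
      have *: "c * (s u * (c * (s w * s v))) \<le>
          (\<Sum>t | length t = N. \<Sum>t' | length t' = N. s (u @ t @ w @ t' @ v))" for u v
      proof -
        have "c * (s u * (c * (s w * s v))) \<le> c * (s u * (\<Sum>t' | length t' = N. s (w @ t' @ v)))"
          using sup[of w v] c0 s0[of u] by (intro mult_left_mono) auto
        also have "\<dots> = (\<Sum>t' | length t' = N. c * (s u * s (w @ t' @ v)))" by (simp add: sum_distrib_left)
        also have "\<dots> \<le> (\<Sum>t' | length t' = N. \<Sum>t | length t = N. s (u @ t @ w @ t' @ v))"
          by (intro sum_mono sup)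
        also have "\<dots> = (\<Sum>t | length t = N. \<Sum>t' | length t' = N. s (u @ t @ w @ t' @ v))"
          by (rule sum.swap)
        finally show ?thesis .
      qed
      have "c^2 / A^2 * s w = c^2 * s w * (1 / A * (1 / A))" by (simp add: power2_eq_square)
      also have "\<dots> \<le> c^2 * s w * (Z i * Z j)"
        using Zge A0 by (intro mult_left_mono mult_mono) (auto simp: s0 Z0)
      also have "\<dots> = c^2 * s w * (\<Sum>u | length u = i. \<Sum>v | length v = j. s u * s v)"
        unfolding Z_def sum_product ..
      also have "\<dots> = (\<Sum>u | length u = i. \<Sum>v | length v = j. c * (s u * (c * (s w * s v))))"
        by (simp add: sum_distrib_left power2_eq_square mult_ac)
      also have "\<dots> \<le> (\<Sum>u | length u = i. \<Sum>v | length v = j. \<Sum>t | length t = N. \<Sum>t' | length t' = N. s (u @ t @ w @ t' @ v))"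
        by (intro sum_mono *)
      also have "\<dots> = (\<Sum>u | length u = i. \<Sum>t | length t = N. \<Sum>v | length v = j. \<Sum>t' | length t' = N. s (u @ t @ w @ t' @ v))"
        by (intro sum.cong[OF refl] sum.swap)
      also have "\<dots> = (\<Sum>u | length u = i. \<Sum>t | length t = N. \<Sum>t' | length t' = N. \<Sum>v | length v = j. s (u @ t @ w @ t' @ v))"
        by (intro sum.cong[OF refl] sum.swap)
      also have "\<dots> = R (i + N) (N + j)" unfolding R_def sum_words_add by simp
      finally show ?thesis .
    qed
    define G :: "'a list \<Rightarrow> real" where "G v = of_bool (v = w)" for v
    define D where "D k = expectation (\<lambda>x. \<bar>birkhoff_sum (\<lambda>x. G (word x ?m)) (2^k) x / 2^k - cw w\<bar>)" for k
    have EG: "expectation (\<lambda>x. G (word x ?m)) = cw w"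
    proof -
      have "(\<Sum>v | length v = ?m. G v * cw v) = (\<Sum>v | length v = ?m. if v = w then cw v else 0)"
        by (intro sum.cong) (auto simp: G_def)
      then show ?thesis by (simp add: expectation_word finite_words)
    qed
    have D: "D \<longlonglongrightarrow> 0"
      using mean_ergodic[of G ?m] unfolding EG D_def[abs_def] by (auto simp: G_def)
    \<comment> \<open>Occurrences of \<open>w\<close> in words of length \<open>2^k + ?m\<close> are
      counted with weight \<open>s\<close>. Summed over positions this gives the \<open>R\<close>;
      with the frequency replaced by its mean \<open>cw w\<close> it gives \<open>cw w * Z\<close>.
      Since \<open>s \<le> K * cw\<close>, the difference is at most \<open>K\<close> times the mean
      deviation \<open>D k\<close> of the frequency.\<close>
    have main: "\<bar>(\<Sum>i<2^k. R i (2^k - i)) / 2^k - cw w * Z (2^k + ?m)\<bar> \<le> K * D k" for k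
    proof -
      let ?T = "2^k :: nat"
      define F where "F v = (\<Sum>i<?T. G (take ?m (drop i v)))" for v
      have Rs: "(\<Sum>v | length v = ?T + ?m. s v * G (take ?m (drop i v))) = R i (?T - i)" if "i < ?T" for i
      proof -
        have l: "?T + ?m = i + (?m + (?T - i))" using that by simp
        have "(\<Sum>v | length v = ?T + ?m. s v * G (take ?m (drop i v))) =
          (\<Sum>u | length u = i. \<Sum>w' | length w' = ?m. \<Sum>v | length v = ?T - i. s (u @ w' @ v) * G w')"
          unfolding l sum_words_add by (intro sum.cong refl) auto
        also have "\<dots> = (\<Sum>u | length u = i. \<Sum>w' | length w' = ?m. if w' = w then (\<Sum>v | length v = ?T - i. s (u @ w' @ v)) else 0)"
          by (intro sum.cong refl) (auto simp: G_def)
        also have "\<dots> = R i (?T - i)" unfolding R_def by (rule sum.cong[OF refl]) (simp add: finite_words)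
        finally show ?thesis .
      qed
      have e1: "(\<Sum>v | length v = ?T + ?m. s v * F v) = (\<Sum>i<?T. R i (?T - i))"
        unfolding F_def sum_distrib_left by (subst sum.swap) (intro sum.cong refl, use Rs in auto)
      have "(\<Sum>v | length v = ?T + ?m. s v * (F v / 2^k - cw w)) =
          (\<Sum>v | length v = ?T + ?m. s v * F v) / 2^k - cw w * Z (?T + ?m)"
        unfolding Z_def sum_divide_distrib sum_distrib_left right_diff_distrib sum_subtractf
        by (simp add: mult.commute)
      then have "(\<Sum>i<?T. R i (?T - i)) / 2^k - cw w * Z (?T + ?m) =
        (\<Sum>v | length v = ?T + ?m. s v * (F v / 2^k - cw w))"
        unfolding e1 by simp
      also have "\<bar>\<dots>\<bar> \<le> (\<Sum>v | length v = ?T + ?m. K * (\<bar>F v / 2^k - cw w\<bar> * cw v))"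
      proof (intro order_trans[OF sum_abs] sum_mono)
        fix v
        have "\<bar>s v * (F v / 2^k - cw w)\<bar> = s v * \<bar>F v / 2^k - cw w\<bar>" using s0[of v] by (simp add: abs_mult)
        also have "\<dots> \<le> (K * cw v) * \<bar>F v / 2^k - cw w\<bar>" by (intro mult_right_mono cs) auto
        finally show "\<bar>s v * (F v / 2^k - cw w)\<bar> \<le> K * (\<bar>F v / 2^k - cw w\<bar> * cw v)" by (simp add: mult_ac)
      qed
      also have "\<dots> = K * D k"
        unfolding D_def birkhoff_word F_def
        using expectation_word[of "\<lambda>v. \<bar>(\<Sum>i<?T. G (take ?m (drop i v))) / 2^k - cw w\<bar>" "?T + ?m"]
        by (simp add: sum_distrib_left)
      finally show ?thesis .
    qed
    have up: "cw w / A \<le> A^2 / c^2 * s w + K * D k" for k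
    proof -
      have "(\<Sum>i<2^k. R i (2^k - i)) / 2^k \<le> (\<Sum>i<(2^k::nat). A^2 / c^2 * s w) / 2^k"
        by (intro divide_right_mono sum_mono R_le) auto
      moreover have "cw w * (1 / A) \<le> cw w * Z (2^k + ?m)" by (intro mult_left_mono Zge cw_nonneg)
      moreover have "(\<Sum>i<(2^k::nat). A^2 / c^2 * s w) / 2^k = A^2 / c^2 * s w" by simp
      moreover have "cw w * (1 / A) = cw w / A" by simp
      ultimately show ?thesis using main[of k] by linarith
    qed
    \<comment> \<open>Only positions at distance at least \<open>N\<close> from both ends leave room
      for the gaps; at most \<open>2 * N\<close> of the \<open>2^k\<close> positions are lost, a
      vanishing proportion.\<close>
    have low: "(1 - 2 * real N / 2^k) * (c^2 / A^2 * s w) \<le> cw w / c + K * D k" for k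
    proof -
      let ?T = "2^k :: nat" and ?b = "c^2 / A^2 * s w"
      have b0: "0 \<le> ?b" using s0[of w] by simp
      have "real x - 2 * real N \<le> real (x - N - N)" for x by linarith
      then have "real ?T - 2 * real N \<le> real (card {N..<?T - N})" unfolding card_atLeastLessThan .
      then have "(real ?T - 2 * real N) * ?b \<le> real (card {N..<?T - N}) * ?b"
        using b0 by (rule mult_right_mono)
      also have "\<dots> = (\<Sum>i\<in>{N..<?T - N}. ?b)" by simp
      also have "\<dots> \<le> (\<Sum>i\<in>{N..<?T - N}. R i (?T - i))"
      proof (rule sum_mono)
        fix i assume "i \<in> {N..<?T - N}"
        then have "i = (i - N) + N" "?T - i = N + (?T - i - N)" by auto
        then show "?b \<le> R i (?T - i)" using R_ge[of "i - N" "?T - i - N"] by simp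
      qed
      also have "\<dots> \<le> (\<Sum>i<?T. R i (?T - i))" by (intro sum_mono2) (auto simp: R0)
      finally have "((real ?T - 2 * real N) * ?b) / 2^k \<le> (\<Sum>i<?T. R i (?T - i)) / 2^k"
        by (intro divide_right_mono) auto
      moreover have "((real ?T - 2 * real N) * ?b) / 2^k = (1 - 2 * real N / 2^k) * ?b"
        by (simp add: diff_divide_distrib left_diff_distrib)
      moreover have "cw w * Z (2^k + ?m) \<le> cw w * (1 / c)" by (intro mult_left_mono Zle cw_nonneg)
      moreover have "cw w * (1 / c) = cw w / c" by simp
      ultimately show ?thesis using main[of k] by linarith
    qed
    have lim0: "(\<lambda>k. K * D k) \<longlonglongrightarrow> 0" using D by (rule tendsto_mult_right_zero)
    have "cw w / A \<le> A^2 / c^2 * s w + 0"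
      by (rule LIMSEQ_le_const[OF tendsto_add[OF tendsto_const lim0]]) (use up in auto)
    moreover have "1 * (c^2 / A^2 * s w) \<le> cw w / c + 0"
    proof (rule LIMSEQ_le[OF _ tendsto_add[OF tendsto_const lim0]])
      have "(\<lambda>k. 2 * real N * (1/2)^k) \<longlonglongrightarrow> 0"
        by (intro tendsto_mult_right_zero LIMSEQ_realpow_zero) auto
      then have "(\<lambda>k. (1 - 2 * real N * (1/2)^k) * (c^2 / A^2 * s w)) \<longlonglongrightarrow> (1 - 0) * (c^2 / A^2 * s w)"
        by (intro tendsto_mult tendsto_diff tendsto_const)
      then show "(\<lambda>k. (1 - 2 * real N / 2^k) * (c^2 / A^2 * s w)) \<longlonglongrightarrow> 1 * (c^2 / A^2 * s w)"
        by (simp add: power_divide)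
    qed (use low in auto)
    ultimately show ?thesis using A0 c0 by (simp add: field_simps power2_eq_square power3_eq_cube)
  qed
  \<comment> \<open>The exact exponents are \<open>13 * V + 2 * Q\<close> and
    \<open>14 * V + 3 * Q\<close>; both lie below the common \<open>16 * V + 3 * Q\<close>. The
    extra \<open>exp V\<close> passes from the representative to an arbitrary point of the
    cylinder.\<close>
  have K1: "exp V * (A^3 / c^2) \<le> exp (16 * V + 3 * Q)" "exp V * (A^2 / c^3) \<le> exp (16 * V + 3 * Q)"
    using V0 Q0 by (auto simp: A_def c_def exp_of_nat_mult[symmetric] exp_diff[symmetric] exp_add[symmetric])
  show ?thesis unfolding Q_def[symmetric]
  proof (unfold_locales)
    show "1 \<le> exp (16 * V + 3 * Q)" using V0 Q0 by simp
    fix x n assume x: "x \<in> X"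
    have "measure \<mu> (cylinder X x n) \<le> A^3 / c^2 * s (word x n)"
      using word_bounds cw_word[OF x, of n] by metis
    also have "\<dots> \<le> A^3 / c^2 * (exp V * e x n)"
      using sx2[OF x, of n] A0 by (intro mult_left_mono) auto
    also have "\<dots> = (exp V * (A^3 / c^2)) * e x n" by simp
    also have "\<dots> \<le> exp (16 * V + 3 * Q) * e x n" by (intro mult_right_mono K1) (auto simp: e_def)
    finally show "measure \<mu> (cylinder X x n) \<le> exp (16 * V + 3 * Q) * exp (birkhoff_sum f n x - real n * P)"
      by (simp add: e_def)
    have "e x n \<le> exp V * s (word x n)" by (rule sx1[OF x])
    also have "\<dots> \<le> exp V * (A^2 / c^3 * cw (word x n))" using word_bounds by (intro mult_left_mono) auto
    also have "\<dots> = (exp V * (A^2 / c^3)) * measure \<mu> (cylinder X x n)" using cw_word[OF x] by simp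
    also have "\<dots> \<le> exp (16 * V + 3 * Q) * measure \<mu> (cylinder X x n)" by (intro mult_right_mono K1) auto
    finally show "exp (birkhoff_sum f n x - real n * P) \<le> exp (16 * V + 3 * Q) * measure \<mu> (cylinder X x n)"
      by (simp add: e_def)
  qed (use sets_mu space_mu invariant translate glue f_bound in auto)
qed

end

section \<open>The observed process\<close>

lemma indep_vars_coordinates:
  fixes D :: "nat \<Rightarrow> 'u::topological_space measure"
  assumes D: "\<And>k. prob_space (D k)" and sets_D: "\<And>k. sets (D k) = sets borel"
  shows "prob_space.indep_vars (PiM UNIV D) (\<lambda>_. borel) (\<lambda>k y. y k) UNIV"
proof -
  interpret prob_space "PiM UNIV D" by (intro prob_space_PiM D)
  note [measurable_cong] = sets_D
  have comp: "(\<lambda>y. y k) \<in> measurable (PiM UNIV D) borel" for k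
  proof -
    have "(\<lambda>y. y k) \<in> measurable (PiM UNIV D) (D k)" by simp
    then show ?thesis using measurable_cong_sets[OF refl sets_D[of k]] by blast
  qed
  note [measurable] = comp
  show "indep_vars (\<lambda>_. borel) (\<lambda>k y. y k) UNIV"
  proof (subst indep_vars_iff_distr_eq_PiM')
    have 1: "distr (PiM UNIV D) borel (\<lambda>y. y k) = D k" for k
    proof -
      have "distr (PiM UNIV D) (D k) (\<lambda>y. y k) = D k"
        by (intro distr_PiM_component D) auto
      then show ?thesis using distr_cong[OF refl sets_D[of k, symmetric], of "PiM UNIV D" "\<lambda>y. y k" "\<lambda>y. y k"] by simp
    qed
    have s: "sets (PiM UNIV (\<lambda>_::nat. borel)) = sets (PiM UNIV D)"
      by (intro sets_PiM_cong) (auto simp: sets_D)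
    have "distr (PiM UNIV D) (PiM UNIV (\<lambda>_. borel)) (\<lambda>y. \<lambda>i\<in>UNIV. y i) = distr (PiM UNIV D) (PiM UNIV D) (\<lambda>y. y)"
      by (intro distr_cong) (auto simp: s)
    also have "\<dots> = PiM UNIV D" by (rule distr_id2) simp
    finally show "distr (PiM UNIV D) (PiM UNIV (\<lambda>_. borel)) (\<lambda>y. \<lambda>i\<in>UNIV. y i) =
        PiM UNIV (\<lambda>i. distr (PiM UNIV D) borel (\<lambda>y. y i))" by (simp add: 1)
  qed auto
qed

lemma window_expectation:
  fixes D :: "nat \<Rightarrow> 'u::topological_space measure" and g :: "nat \<Rightarrow> 'u \<Rightarrow> real"
  assumes D: "\<And>k. prob_space (D k)" and sets_D: "\<And>k. sets (D k) = sets borel"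
    and gm [measurable]: "\<And>i. g i \<in> borel_measurable borel"
    and g01: "\<And>i u. 0 \<le> g i u" "\<And>i u. g i u \<le> 1"
  shows "(\<integral>y. (\<Prod>i<w. g i (y (k + i))) \<partial>PiM UNIV D) = (\<Prod>i<w. \<integral>u. g i u \<partial>D (k + i))"
proof -
  interpret prob_space "PiM UNIV D" by (intro prob_space_PiM D)
  note [measurable_cong] = sets_D
  have ind: "indep_vars (\<lambda>_. borel) (\<lambda>k y. y k) UNIV" by (rule indep_vars_coordinates[OF D sets_D])
  then have [measurable]: "(\<lambda>y. y k) \<in> measurable (PiM UNIV D) borel" for k
    by (auto simp: indep_vars_def)
  have Zk: "(\<Prod>i<w. g i (y (k + i))) = (\<Prod>j\<in>{k..<k+w}. g (j - k) (y j))" for y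
    by (rule prod.reindex_bij_witness[of _ "\<lambda>j. j - k" "\<lambda>i. k + i"]) auto
  have "indep_vars (\<lambda>_. borel) (\<lambda>i y. g (i - k) (y i)) {k..<k+w}"
    by (rule indep_vars_compose2[OF indep_vars_subset[OF ind]]) auto
  then have "(\<integral>y. (\<Prod>i<w. g i (y (k + i))) \<partial>PiM UNIV D) = (\<Prod>j\<in>{k..<k+w}. expectation (\<lambda>y. g (j - k) (y j)))"
    unfolding Zk using g01
    by (intro indep_vars_lebesgue_integral) (auto intro!: integrable_const_bound[where B = 1])
  also have "\<dots> = (\<Prod>j\<in>{k..<k+w}. \<integral>u. g (j - k) u \<partial>D j)"
  proof (intro prod.cong refl)
    fix j
    have "(\<integral>u. g (j - k) u \<partial>D j) = (\<integral>u. g (j - k) u \<partial>distr (PiM UNIV D) (D j) (\<lambda>y. y j))"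
      by (subst distr_PiM_component) (auto simp: D)
    also have "\<dots> = expectation (\<lambda>y. g (j - k) (y j))" by (rule integral_distr) (auto simp: measurable_cong_sets[OF sets_D refl])
    finally show "expectation (\<lambda>y. g (j - k) (y j)) = (\<integral>u. g (j - k) u \<partial>D j)" by simp
  qed
  also have "\<dots> = (\<Prod>i<w. \<integral>u. g i u \<partial>D (k + i))"
    by (rule prod.reindex_bij_witness[of _ "\<lambda>i. k + i" "\<lambda>j. j - k"]) auto
  finally show ?thesis .
qed

text \<open>Overlapping windows are dependent, but windows whose starting points agree modulo
  \<open>w\<close> are disjoint and hence independent. Hoeffding's inequality is applied to each of
  the \<open>w\<close> residue classes and the results are added; bounding the size of a class by
  \<open>n\<close> gives the stated exponent.\<close>

lemma window_concentration:
  fixes D :: "nat \<Rightarrow> 'u::topological_space measure" and g :: "nat \<Rightarrow> 'u \<Rightarrow> real"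
  assumes D: "\<And>k. prob_space (D k)" and sets_D: "\<And>k. sets (D k) = sets borel"
    and gm [measurable]: "\<And>i. g i \<in> borel_measurable borel"
    and g01: "\<And>i u. 0 \<le> g i u" "\<And>i u. g i u \<le> 1"
    and w: "0 < w" and eps: "0 < \<epsilon>"
  defines "Z \<equiv> \<lambda>k y. \<Prod>i<w. g i (y (k + i))"
    and "z \<equiv> \<lambda>k. \<Prod>i<w. \<integral>u. g i u \<partial>D (k + i)"
  shows "measure (PiM UNIV D) {y\<in>space (PiM UNIV D). real n * \<epsilon> \<le> \<bar>(\<Sum>k<n. Z k y) - (\<Sum>k<n. z k)\<bar>}
    \<le> 2 * real w * exp (- 2 * \<epsilon>\<^sup>2 / (real w)\<^sup>2 * real n)"
proof (cases "n = 0")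
  case True
  interpret prob_space "PiM UNIV D" by (intro prob_space_PiM D)
  show ?thesis using w True by (intro order_trans[OF prob_le_1]) auto
next
  case False
  interpret prob_space "PiM UNIV D" by (intro prob_space_PiM D)
  note [measurable_cong] = sets_D
  have comp: "(\<lambda>y. y k) \<in> measurable (PiM UNIV D) borel" for k
  proof -
    have "(\<lambda>y. y k) \<in> measurable (PiM UNIV D) (D k)" by simp
    then show ?thesis using measurable_cong_sets[OF refl sets_D[of k]] by blast
  qed
  note [measurable] = comp
  have ind: "indep_vars (\<lambda>_. borel) (\<lambda>k y. y k) UNIV" by (rule indep_vars_coordinates[OF D sets_D])
  have Zk: "Z k y = (\<Prod>j\<in>{k..<k+w}. g (j - k) (y j))" for k y
    unfolding Z_def by (rule prod.reindex_bij_witness[of _ "\<lambda>j. j - k" "\<lambda>i. k + i"]) auto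
  have Zm [measurable]: "Z k \<in> borel_measurable (PiM UNIV D)" for k unfolding Z_def by measurable
  have Z01: "0 \<le> Z k y" "Z k y \<le> 1" for k y
    using g01 by (auto simp: Z_def intro!: prod_nonneg prod_le_1)
  have EZ: "expectation (Z k) = z k" for k
    unfolding Z_def z_def by (rule window_expectation[OF D sets_D gm g01])
  define I where "I r = {k\<in>{..<n}. k mod w = r}" for r
  have finI: "finite (I r)" and cardI: "card (I r) \<le> n" for r
    using card_mono[of "{..<n}" "I r"] by (auto simp: I_def)
  \<comment> \<open>The deviation allowed to each residue class: \<open>w\<close> classes below
    \<open>?t\<close> add up to less than \<open>n * \<epsilon>\<close>.\<close>
  let ?t = "real n * \<epsilon> / real w"
  have t0: "0 < ?t" using False eps w by simp
  let ?B = "\<lambda>r. {y\<in>space (PiM UNIV D). ?t \<le> \<bar>(\<Sum>k\<in>I r. Z k y) - (\<Sum>k\<in>I r. z k)\<bar>}"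
  let ?e = "exp (- 2 * \<epsilon>\<^sup>2 / (real w)\<^sup>2 * real n)"
  have each: "prob (?B r) \<le> 2 * ?e" for r
  proof (cases "I r = {}")
    case True
    then have B: "?B r = {}" using t0 by auto
    show ?thesis unfolding B by simp
  next
    case ne: False
    have dis: "disjoint_family_on (\<lambda>k. {k..<k+w}) (I r)"
    proof (unfold disjoint_family_on_def, intro ballI impI)
      fix a b assume ab: "a \<in> I r" "b \<in> I r" "a \<noteq> b"
      have *: "a + w \<le> b" if "a mod w = b mod w" "a < b" for a b :: nat
      proof -
        have "w dvd b - a" using that mod_eq_dvd_iff_nat[of a b w] by simp
        then show ?thesis using that dvd_imp_le[of w "b - a"] by simp
      qed
      have "a mod w = b mod w" using ab by (simp add: I_def)
      then show "{a..<a+w} \<inter> {b..<b+w} = {}" using *[of a b] *[of b a] ab(3) by fastforce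
    qed
    have "indep_vars (\<lambda>_. borel) (\<lambda>k y. \<Prod>j\<in>{k..<k+w}. g (j - k) (restrict (\<lambda>i. y i) {k..<k+w} j)) (I r)"
      by (rule indep_vars_compose2[OF indep_vars_restrict[OF ind _ dis]]) auto
    then have indZ: "indep_vars (\<lambda>_. borel) Z (I r)"
      by (rule indep_vars_cong[THEN iffD1, rotated -1]) (auto simp: Zk fun_eq_iff intro!: prod.cong)
    interpret H: Hoeffding_ineq "PiM UNIV D" "I r" Z "\<lambda>_. 0" "\<lambda>_. 1" "\<Sum>k\<in>I r. expectation (Z k)"
      by unfold_locales (use finI indZ Z01 in auto)
    have "card (I r) > 0" using ne finI by (simp add: card_gt_0_iff)
    have "prob (?B r) \<le> 2 * exp (- 2 * ?t\<^sup>2 / (\<Sum>i\<in>I r. (1 - 0)\<^sup>2))"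
      using H.Hoeffding_ineq_abs_ge[of ?t] t0 \<open>card (I r) > 0\<close> unfolding EZ by simp
    also have "\<dots> \<le> 2 * ?e"
    proof -
      have "2 * ?t\<^sup>2 / real n \<le> 2 * ?t\<^sup>2 / real (card (I r))"
        using \<open>card (I r) > 0\<close> cardI[of r] by (intro divide_left_mono) auto
      moreover have "2 * ?t\<^sup>2 / real n = 2 * \<epsilon>\<^sup>2 / (real w)\<^sup>2 * real n"
        using False by (simp add: power2_eq_square field_simps)
      ultimately show ?thesis by simp
    qed
    finally show ?thesis .
  qed
  have grp: "(\<Sum>r<w. \<Sum>k\<in>I r. h k) = (\<Sum>k<n. h k)" for h :: "nat \<Rightarrow> real"
    unfolding I_def by (rule sum.group) (use w in auto)
  have "{y\<in>space (PiM UNIV D). real n * \<epsilon> \<le> \<bar>(\<Sum>k<n. Z k y) - (\<Sum>k<n. z k)\<bar>} \<subseteq> (\<Union>r<w. ?B r)"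
  proof
    fix y assume y: "y \<in> {y\<in>space (PiM UNIV D). real n * \<epsilon> \<le> \<bar>(\<Sum>k<n. Z k y) - (\<Sum>k<n. z k)\<bar>}"
    show "y \<in> (\<Union>r<w. ?B r)"
    proof (rule ccontr)
      assume "y \<notin> (\<Union>r<w. ?B r)"
      then have lt: "\<bar>(\<Sum>k\<in>I r. Z k y) - (\<Sum>k\<in>I r. z k)\<bar> < ?t" if "r < w" for r
        using y that by (force simp: not_le)
      have "\<bar>(\<Sum>k<n. Z k y) - (\<Sum>k<n. z k)\<bar> = \<bar>\<Sum>r<w. (\<Sum>k\<in>I r. Z k y) - (\<Sum>k\<in>I r. z k)\<bar>"
        by (simp add: sum_subtractf grp)
      also have "\<dots> \<le> (\<Sum>r<w. \<bar>(\<Sum>k\<in>I r. Z k y) - (\<Sum>k\<in>I r. z k)\<bar>)" by (rule sum_abs)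
      also have "\<dots> < (\<Sum>r<w. ?t)" using w lt by (intro sum_strict_mono) auto
      also have "\<dots> = real n * \<epsilon>" using w by simp
      finally show False using y by simp
    qed
  qed
  then have "measure (PiM UNIV D) {y\<in>space (PiM UNIV D). real n * \<epsilon> \<le> \<bar>(\<Sum>k<n. Z k y) - (\<Sum>k<n. z k)\<bar>}
      \<le> prob (\<Union>r<w. ?B r)"
    by (intro finite_measure_mono) auto
  also have "\<dots> \<le> (\<Sum>r<w. prob (?B r))" by (intro finite_measure_subadditive_finite) auto
  also have "\<dots> \<le> (\<Sum>r<w. 2 * ?e)" by (intro sum_mono each)
  finally show ?thesis by simp
qed

lemma measurable_translate_hidden:
  assumes "\<And>x. x \<in> X \<Longrightarrow> (\<lambda>i. x (i + k)) \<in> X"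
  shows "(\<lambda>x i. x (i + k)) \<in> measurable (hidden_space X) (hidden_space X)"
  unfolding hidden_space_def
proof (intro measurable_restrict_space2)
  show "(\<lambda>x i. x (i + k)) \<in> measurable (restrict_space (PiM UNIV (\<lambda>_. count_space UNIV)) X) (PiM UNIV (\<lambda>_. count_space UNIV))"
    by (intro measurable_PiM_single' measurable_restrict_space1 measurable_component_singleton) auto
  show "(\<lambda>x i. x (i + k)) \<in> space (restrict_space (PiM UNIV (\<lambda>_. count_space UNIV)) X) \<rightarrow> X"
    using assms by (auto simp: space_restrict_space)
qed

text \<open>The model for one fixed parameter. \<open>psi_bounded\<close> makes the likelihood
  integrand integrable for every observation sequence, not just almost every one.
  \<open>psi_variation\<close> is uniform continuity of the emission law in the hidden path with
  respect to the \<open>L1\<close> distance; it makes conditional means approximable by functions of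
  finite words.\<close>

locale hidden = gibbs X f \<mu> P K Bf N
  for X :: "(int \<Rightarrow> 'a::finite) set" and f \<mu> P K Bf N +
  fixes m :: "'u::polish_space measure" and \<psi> :: "(int \<Rightarrow> 'a) \<Rightarrow> 'u \<Rightarrow> real"
  assumes sigma_finite_m: "sigma_finite_measure m"
    and sets_m: "sets m = sets borel"
    and psi_pos: "\<And>x u. x \<in> X \<Longrightarrow> 0 < \<psi> x u"
    and psi_cont: "\<And>x u \<epsilon>. x \<in> X \<Longrightarrow> 0 < \<epsilon> \<Longrightarrow>
      \<exists>\<delta>>0. \<forall>x'\<in>X. \<forall>u'. dX x' x < \<delta> \<and> dist u' u < \<delta> \<longrightarrow> \<bar>\<psi> x' u' - \<psi> x u\<bar> < \<epsilon>"
    and psi_prob: "\<And>x. x \<in> X \<Longrightarrow> (\<integral>\<^sup>+u. ennreal (\<psi> x u) \<partial>m) = 1"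
    and psi_bounded: "\<And>u. \<exists>B. \<forall>x\<in>X. \<psi> x u \<le> B"
    and psi_variation: "\<And>\<delta>. 0 < \<delta> \<Longrightarrow> \<exists>j. \<forall>x\<in>X. \<forall>y\<in>X. (\<forall>i. nat \<bar>i\<bar> < j \<longrightarrow> x i = y i) \<longrightarrow>
      (\<integral>\<^sup>+u. ennreal \<bar>\<psi> x u - \<psi> y u\<bar> \<partial>m) \<le> ennreal \<delta>"
begin

sublocale sm: sigma_finite_measure m by (rule sigma_finite_m)

lemma space_m [simp]: "space m = UNIV"
  using sets_eq_imp_space_eq[OF sets_m] by simp

lemma sets_m' [measurable_cong]: "sets m = sets borel" by (rule sets_m)

lemma translate_measurable: "(\<lambda>x i. x (i + k)) \<in> measurable \<mu> \<mu>"
  using measurable_translate_hidden[OF translate] measurable_cong_sets[OF sets_mu sets_mu] by blast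

text \<open>A Caratheodory argument: freezing \<open>x\<close> at a representative of its central
  word on the coordinates from \<open>-j\<close> to \<open>j\<close> gives a function that is
  continuous in \<open>u\<close> for each of countably many words, and these functions converge
  pointwise by continuity of \<psi> in \<open>x\<close>.\<close>

lemma psi_measurable_pair: "(\<lambda>(x, u). \<psi> x u) \<in> borel_measurable (\<mu> \<Otimes>\<^sub>M borel)"
proof -
  define W :: "nat \<Rightarrow> (int \<Rightarrow> 'a) \<Rightarrow> 'a list"
    where "W j x = word (\<lambda>i. x (i + - int j)) (2 * j + 1)" for j x
  define R where "R j v = (SOME z. z \<in> X \<and> W j z = v)" for j v
  have R: "R j (W j x) \<in> X" "W j (R j (W j x)) = W j x" if "x \<in> X" for j x
    using someI_ex[of "\<lambda>z. z \<in> X \<and> W j z = W j x"] that unfolding R_def by blast+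
  have agree: "dX (R j (W j x)) x \<le> 2 powr (- real j)" if "x \<in> X" for j x
  proof (rule dX_le)
    fix i :: int assume i: "nat \<bar>i\<bar> < j"
    have "nat (i + int j) < 2 * j + 1" using i by linarith
    moreover have "\<forall>k<2 * j + 1. R j (W j x) (int k + - int j) = x (int k + - int j)"
      using R(2)[OF that, of j] unfolding W_def by (subst (asm) word_eq_iff)
    ultimately have "R j (W j x) (int (nat (i + int j)) + - int j) = x (int (nat (i + int j)) + - int j)" by blast
    moreover have "int (nat (i + int j)) + - int j = i" using i by linarith
    ultimately show "R j (W j x) i = x i" by simp
  qed
  have psiR: "\<psi> (R j v) \<in> borel_measurable borel" if "v \<in> W j ` X" for j v
  proof -
    have RX: "R j v \<in> X" using that R by auto
    have "continuous_on UNIV (\<psi> (R j v))"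
      unfolding continuous_on_iff
    proof (intro ballI allI impI)
      fix u and \<epsilon> :: real assume "0 < \<epsilon>"
      from psi_cont[OF RX this, of u] obtain \<delta> where "\<delta> > 0"
        and d: "\<forall>x'\<in>X. \<forall>u'. dX x' (R j v) < \<delta> \<and> dist u' u < \<delta> \<longrightarrow> \<bar>\<psi> x' u' - \<psi> (R j v) u\<bar> < \<epsilon>" by blast
      then show "\<exists>d>0. \<forall>x'\<in>UNIV. dist x' u < d \<longrightarrow> dist (\<psi> (R j v) x') (\<psi> (R j v) u) < \<epsilon>"
        using RX by (intro exI[of _ \<delta>]) (auto simp: dist_real_def dX_def)
    qed
    then show ?thesis by (rule borel_measurable_continuous_onI)
  qed
  \<comment> \<open>For words not realised in \<open>X\<close> the choice \<open>R j v\<close> is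
    arbitrary, so the value is set to 0 there.\<close>
  define h where "h j v u = (if v \<in> W j ` X then \<psi> (R j v) u else 0)" for j v u
  have hm: "(\<lambda>(v, u). h j v u) \<in> borel_measurable (count_space UNIV \<Otimes>\<^sub>M borel)" for j
  proof (rule measurable_pair_measure_countable1)
    fix v show "(\<lambda>u. case (v, u) of (v, u) \<Rightarrow> h j v u) \<in> borel_measurable borel"
      using psiR[of v j] by (cases "v \<in> W j ` X") (auto simp: h_def)
  qed auto
  have Wm [measurable]: "W j \<in> measurable \<mu> (count_space UNIV)" for j
    unfolding W_def[abs_def] by (rule measurable_compose[OF translate_measurable word_measurable])
  have "(\<lambda>(x, u). \<psi> x u) \<in> borel_measurable (\<mu> \<Otimes>\<^sub>M borel)"
  proof (rule borel_measurable_LIMSEQ_real[where u = "\<lambda>j p. h j (W j (fst p)) (snd p)"])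
    fix j
    have "(\<lambda>p. (W j (fst p), snd p)) \<in> measurable (\<mu> \<Otimes>\<^sub>M borel) (count_space UNIV \<Otimes>\<^sub>M borel)" by measurable
    from measurable_compose[OF this hm[of j]]
    show "(\<lambda>p. h j (W j (fst p)) (snd p)) \<in> borel_measurable (\<mu> \<Otimes>\<^sub>M borel)" by (simp add: case_prod_beta)
  next
    fix p assume "p \<in> space (\<mu> \<Otimes>\<^sub>M (borel :: 'u measure))"
    then obtain x u where p: "p = (x, u)" "x \<in> X" by (auto simp: space_pair_measure space_mu)
    have "(\<lambda>j. \<psi> (R j (W j x)) u) \<longlonglongrightarrow> \<psi> x u"
    proof (rule LIMSEQ_I)
      fix \<epsilon> :: real assume "0 < \<epsilon>"
      from psi_cont[OF p(2) this, of u] obtain \<delta> where "\<delta> > 0"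
        and d: "\<forall>x'\<in>X. \<forall>u'. dX x' x < \<delta> \<and> dist u' u < \<delta> \<longrightarrow> \<bar>\<psi> x' u' - \<psi> x u\<bar> < \<epsilon>" by blast
      obtain j0 where j0: "(1/2)^j0 < \<delta>" using real_arch_pow_inv[of \<delta> "1/2"] \<open>\<delta> > 0\<close> by auto
      show "\<exists>no. \<forall>j\<ge>no. norm (\<psi> (R j (W j x)) u - \<psi> x u) < \<epsilon>"
      proof (intro exI allI impI)
        fix j assume "j0 \<le> j"
        have "dX (R j (W j x)) x \<le> 2 powr (- real j)" by (rule agree[OF p(2)])
        also have "\<dots> = (1/2)^j" by (simp add: powr_minus powr_realpow power_divide inverse_eq_divide)
        also have "\<dots> \<le> (1/2)^j0" using \<open>j0 \<le> j\<close> by (intro power_decreasing) auto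
        finally show "norm (\<psi> (R j (W j x)) u - \<psi> x u) < \<epsilon>"
          using d R(1)[OF p(2)] j0 \<open>\<delta> > 0\<close> by auto
      qed
    qed
    then show "(\<lambda>j. h j (W j (fst p)) (snd p)) \<longlonglongrightarrow> (case p of (x, u) \<Rightarrow> \<psi> x u)"
      using p by (simp add: h_def)
  qed
  then show ?thesis .
qed

lemma psi_measurable2 [measurable (raw)]:
  assumes "a \<in> measurable M \<mu>" "b \<in> borel_measurable M"
  shows "(\<lambda>p. \<psi> (a p) (b p)) \<in> borel_measurable M"
proof -
  have "(\<lambda>p. (a p, b p)) \<in> measurable M (\<mu> \<Otimes>\<^sub>M borel)" using assms by measurable
  from measurable_compose[OF this psi_measurable_pair] show ?thesis by simp
qed

lemma psi_measurable [measurable]: "x \<in> X \<Longrightarrow> \<psi> x \<in> borel_measurable borel"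
  using psi_measurable2[of "\<lambda>_. x" borel "\<lambda>u. u"] by (auto simp: space_mu)

section \<open>The law of the observations given the hidden path, and its mixture\<close>

definition dens :: "(int \<Rightarrow> 'a) \<Rightarrow> 'u measure" where
  "dens x = density m (\<lambda>u. ennreal (\<psi> x u))"

definition Px :: "(int \<Rightarrow> 'a) \<Rightarrow> (nat \<Rightarrow> 'u) measure" where
  "Px x = PiM UNIV (\<lambda>k. dens ((shift ^^ k) x))"

abbreviation "Y \<equiv> PiM UNIV (\<lambda>_::nat. borel :: 'u measure)"

definition PY :: "(nat \<Rightarrow> 'u) measure" where "PY = bind \<mu> Px"

lemma sets_dens [simp, measurable_cong]: "sets (dens x) = sets borel"
  by (simp add: dens_def sets_m)

lemma space_dens [simp]: "space (dens x) = UNIV"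
  by (simp add: dens_def)

lemma emeasure_dens:
  assumes "x \<in> X" "A \<in> sets borel"
  shows "emeasure (dens x) A = (\<integral>\<^sup>+u. ennreal (\<psi> x u) * indicator A u \<partial>m)"
  unfolding dens_def using assms by (intro emeasure_density) (auto simp: sets_m)

lemma prob_dens: "x \<in> X \<Longrightarrow> prob_space (dens x)"
  using emeasure_dens[of x UNIV] psi_prob[of x] by (intro prob_spaceI) simp

lemma sets_Px [simp, measurable_cong]: "sets (Px x) = sets Y"
  unfolding Px_def by (intro sets_PiM_cong) auto

lemma space_Px [simp]: "space (Px x) = UNIV"
  by (simp add: Px_def space_PiM)

lemma prob_Px: "x \<in> X \<Longrightarrow> prob_space (Px x)"
  unfolding Px_def by (intro prob_space_PiM prob_dens shift_in)

text \<open>It is enough to test finite-dimensional rectangles, which are closed under intersection;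
  there the probability is a finite product of integrals, each measurable in the path.\<close>

lemma Px_measurable: "Px \<in> measurable \<mu> (prob_algebra Y)"
proof (rule measurable_prob_algebra_generated[OF sets_PiM Int_stable_prod_algebra prod_algebra_sets_into_space])
  show "prob_space (Px x)" if "x \<in> space \<mu>" for x using prob_Px that by (simp add: space_mu)
  fix A assume "A \<in> prod_algebra UNIV (\<lambda>_::nat. borel :: 'u measure)"
  then obtain J E where A: "A = prod_emb UNIV (\<lambda>_. borel) J (\<Pi>\<^sub>E j\<in>J. E j)" "finite J"
    "\<And>i. i \<in> J \<Longrightarrow> E i \<in> sets borel" by (auto elim!: prod_algebraE)
  have "emeasure (Px x) A = (\<Prod>j\<in>J. \<integral>\<^sup>+u. ennreal (\<psi> ((shift ^^ j) x) u) * indicator (E j) u \<partial>m)" if x: "x \<in> space \<mu>" for x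
  proof -
    have xX: "x \<in> X" using x by (simp add: space_mu)
    have "A = prod_emb UNIV (\<lambda>k. dens ((shift ^^ k) x)) J (\<Pi>\<^sub>E j\<in>J. E j)"
      unfolding A by (simp add: prod_emb_def)
    then have "emeasure (Px x) A = (\<Prod>j\<in>J. emeasure (dens ((shift ^^ j) x)) (E j))"
      unfolding Px_def using A by (simp add: emeasure_PiM_emb prob_dens shift_in xX)
    also have "\<dots> = (\<Prod>j\<in>J. \<integral>\<^sup>+u. ennreal (\<psi> ((shift ^^ j) x) u) * indicator (E j) u \<partial>m)"
      using A by (intro prod.cong refl emeasure_dens shift_in xX) auto
    finally show ?thesis .
  qed
  then have "(\<lambda>x. emeasure (Px x) A) \<in> borel_measurable \<mu> \<longleftrightarrow>
      (\<lambda>x. \<Prod>j\<in>J. \<integral>\<^sup>+u. ennreal (\<psi> ((shift ^^ j) x) u) * indicator (E j) u \<partial>m) \<in> borel_measurable \<mu>"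
    by (rule measurable_cong)
  also have "\<dots>"
  proof (rule borel_measurable_prod_ennreal)
    fix j assume "j \<in> J"
    then have [measurable]: "E j \<in> sets borel" using A by auto
    show "(\<lambda>x. \<integral>\<^sup>+u. ennreal (\<psi> ((shift ^^ j) x) u) * indicator (E j) u \<partial>m) \<in> borel_measurable \<mu>"
      by measurable
  qed
  finally show "(\<lambda>x. emeasure (Px x) A) \<in> borel_measurable \<mu>" .
qed auto

lemma Px_measurable_sub [measurable]: "Px \<in> measurable \<mu> (subprob_algebra Y)"
  using Px_measurable by (rule measurable_prob_algebraD)

lemma nonempty_mu: "space \<mu> \<noteq> {}" by (rule not_empty)

lemma sets_PY [simp, measurable_cong]: "sets PY = sets Y"
  unfolding PY_def using nonempty_mu by (intro sets_bind) auto

lemma space_PY [simp]: "space PY = UNIV"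
  using sets_eq_imp_space_eq[OF sets_PY] by (simp add: space_PiM)

lemma prob_PY: "prob_space PY"
  unfolding PY_def by (rule prob_space_bind[where S = Y]) (auto simp: prob_Px space_mu)

sublocale PY: prob_space PY by (rule prob_PY)

lemma emeasure_PY: "A \<in> sets Y \<Longrightarrow> emeasure PY A = (\<integral>\<^sup>+x. emeasure (Px x) A \<partial>\<mu>)"
  unfolding PY_def by (rule emeasure_bind) (auto simp: nonempty_mu)

lemma nn_integral_PY: "F \<in> borel_measurable Y \<Longrightarrow> (\<integral>\<^sup>+y. F y \<partial>PY) = (\<integral>\<^sup>+x. \<integral>\<^sup>+y. F y \<partial>Px x \<partial>\<mu>)"
  unfolding PY_def by (rule nn_integral_bind) auto

lemma process_measure_eq: "process_measure (\<lambda>_. \<mu>) (\<lambda>_. \<psi>) m \<theta> = PY"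
  by (simp add: process_measure_def PY_def Px_def[abs_def] dens_def)

lemma tail_measurable [measurable]: "(\<lambda>y k. y (Suc k)) \<in> measurable Y Y"
  by (intro measurable_PiM_single') (auto simp: space_PiM)

text \<open>Stationarity of the observations: dropping the first one turns the conditional law for
  \<open>x\<close> into the one for \<open>shift x\<close>, and the hidden measure is shift
  invariant.\<close>

lemma distr_tail: "distr PY PY (\<lambda>y k. y (Suc k)) = PY"
proof (rule measure_eqI)
  let ?T = "\<lambda>y k. y (Suc k) :: 'u"
  fix A assume "A \<in> sets (distr PY PY ?T)"
  then have A [measurable]: "A \<in> sets Y" by simp
  have TA: "?T -` A \<inter> space Y \<in> sets Y" by (rule measurable_sets[OF tail_measurable A])
  then have TA': "?T -` A \<in> sets Y" by (simp add: space_PiM)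
  have Tm: "?T \<in> measurable (Px x) Y" for x by simp
  have Px_tail: "distr (Px x) Y ?T = Px (shift x)" if "x \<in> X" for x
  proof -
    have 1: "distr (PiM UNIV (\<lambda>k. dens ((shift ^^ k) x))) (PiM UNIV (\<lambda>k. dens ((shift ^^ Suc k) x)))
        (\<lambda>y. \<lambda>k\<in>UNIV. y (Suc k)) = PiM UNIV (\<lambda>k. dens ((shift ^^ Suc k) x))"
      by (rule distr_PiM_reindex) (auto intro!: prob_dens shift_in[OF that] simp del: funpow.simps)
    have E: "PiM UNIV (\<lambda>k. dens ((shift ^^ Suc k) x)) = Px (shift x)"
      unfolding Px_def by (simp only: funpow_Suc_right o_apply)
    have "distr (Px x) (Px (shift x)) ?T = Px (shift x)"
      using 1 unfolding E restrict_UNIV Px_def[of x, symmetric] .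
    moreover have "distr (Px x) (Px (shift x)) ?T = distr (Px x) Y ?T" by (intro distr_cong) auto
    ultimately show ?thesis by simp
  qed
  have "emeasure (distr PY PY ?T) A = emeasure PY (?T -` A)"
    by (subst emeasure_distr) auto
  also have "\<dots> = (\<integral>\<^sup>+x. emeasure (Px x) (?T -` A) \<partial>\<mu>)" by (rule emeasure_PY[OF TA'])
  also have "\<dots> = (\<integral>\<^sup>+x. emeasure (Px (shift x)) A \<partial>\<mu>)"
  proof (rule nn_integral_cong)
    fix x assume "x \<in> space \<mu>"
    then have "x \<in> X" by (simp add: space_mu)
    then show "emeasure (Px x) (?T -` A) = emeasure (Px (shift x)) A"
      unfolding Px_tail[OF \<open>x \<in> X\<close>, symmetric] using Tm by (subst emeasure_distr) auto
  qed
  also have "\<dots> = (\<integral>\<^sup>+x. emeasure (Px x) A \<partial>distr \<mu> \<mu> shift)"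
    by (rule nn_integral_distr[symmetric]) (auto intro: measurable_emeasure_subprob_algebra measurable_compose[OF Px_measurable_sub])
  also have "\<dots> = emeasure PY A" by (simp add: invariant emeasure_PY)
  finally show "emeasure (distr PY PY ?T) A = emeasure PY A" .
qed simp

end

section \<open>Laws of large numbers for the observed process\<close>

context hidden
begin

lemma integral_dens:
  assumes "x \<in> X" "g \<in> borel_measurable borel"
  shows "(\<integral>u. g u \<partial>dens x) = (\<integral>u. \<psi> x u * g u \<partial>m)"
  unfolding dens_def using assms psi_pos[OF assms(1)]
  by (subst integral_density) (auto simp: measurable_cong_sets[OF sets_m refl] less_imp_le)

lemma psi_integrable: "x \<in> X \<Longrightarrow> integrable m (\<psi> x)"
  using psi_prob[of x] psi_pos[of x]
  by (intro integrableI_nonneg) (auto simp: measurable_cong_sets[OF sets_m refl] less_imp_le)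

text \<open>The conditional mean, given the hidden path \<open>x\<close>, of the product of the
  \<open>g i\<close> over the first \<open>w\<close> observations; conditional independence turns it
  into a product.\<close>

definition block_mean :: "(nat \<Rightarrow> 'u \<Rightarrow> real) \<Rightarrow> nat \<Rightarrow> (int \<Rightarrow> 'a) \<Rightarrow> real" where
  "block_mean g w x = (\<Prod>i<w. \<integral>u. g i u \<partial>dens ((shift ^^ i) x))"

lemma integral_dens_01:
  assumes "x \<in> X" "g \<in> borel_measurable borel" "\<And>u. 0 \<le> g u" "\<And>u. g u \<le> (1 :: real)"
  shows "0 \<le> (\<integral>u. g u \<partial>dens x)" "(\<integral>u. g u \<partial>dens x) \<le> 1"
proof -
  interpret D: prob_space "dens x" by (rule prob_dens[OF assms(1)])
  show "0 \<le> (\<integral>u. g u \<partial>dens x)" using assms by (intro Bochner_Integration.integral_nonneg) auto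
  have "(\<integral>u. g u \<partial>dens x) \<le> (\<integral>u. 1 \<partial>dens x)"
    using assms by (intro integral_mono D.integrable_const_bound[where B = 1])
       (auto simp: measurable_cong_sets[OF sets_dens refl])
  moreover have "measure (dens x) UNIV = 1" using D.prob_space by simp
  ultimately show "(\<integral>u. g u \<partial>dens x) \<le> 1" by simp
qed

text \<open>A test function with values in the unit interval separates two emission laws by at most
  the \<open>L1\<close> distance of their densities.\<close>

lemma integral_dens_diff:
  assumes xy: "x \<in> X" "y \<in> X" and g: "g \<in> borel_measurable borel" "\<And>u. 0 \<le> g u" "\<And>u. g u \<le> (1 :: real)"
    and \<delta>: "0 \<le> \<delta>" "(\<integral>\<^sup>+u. ennreal \<bar>\<psi> x u - \<psi> y u\<bar> \<partial>m) \<le> ennreal \<delta>"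
  shows "\<bar>(\<integral>u. g u \<partial>dens x) - (\<integral>u. g u \<partial>dens y)\<bar> \<le> \<delta>"
proof -
  have ix: "integrable m (\<psi> z)" "integrable m (\<lambda>u. \<psi> z u * g u)" if "z \<in> X" for z
  proof -
    show "integrable m (\<psi> z)" by (rule psi_integrable[OF that])
    then show "integrable m (\<lambda>u. \<psi> z u * g u)"
      by (rule Bochner_Integration.integrable_bound)
        (use g psi_measurable[OF that] in \<open>auto simp: measurable_cong_sets[OF sets_m refl] abs_mult intro!: mult_left_le\<close>)
  qed
  have "\<bar>(\<integral>u. g u \<partial>dens x) - (\<integral>u. g u \<partial>dens y)\<bar> = \<bar>\<integral>u. \<psi> x u * g u - \<psi> y u * g u \<partial>m\<bar>"
    using xy g ix by (simp add: integral_dens)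
  also have "\<dots> \<le> (\<integral>u. \<bar>\<psi> x u * g u - \<psi> y u * g u\<bar> \<partial>m)" by (rule integral_abs_bound)
  also have "\<dots> \<le> (\<integral>u. \<bar>\<psi> x u - \<psi> y u\<bar> \<partial>m)"
  proof (rule integral_mono)
    show "integrable m (\<lambda>u. \<bar>\<psi> x u * g u - \<psi> y u * g u\<bar>)" "integrable m (\<lambda>u. \<bar>\<psi> x u - \<psi> y u\<bar>)"
      by (intro integrable_abs Bochner_Integration.integrable_diff ix xy)+
  qed (use g in \<open>auto simp: left_diff_distrib[symmetric] abs_mult intro!: mult_left_le\<close>)
  also have "\<dots> \<le> \<delta>"
  proof -
    have "ennreal (\<integral>u. \<bar>\<psi> x u - \<psi> y u\<bar> \<partial>m) = (\<integral>\<^sup>+u. ennreal \<bar>\<psi> x u - \<psi> y u\<bar> \<partial>m)"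
      using xy ix by (intro nn_integral_eq_integral[symmetric]) auto
    then have "ennreal (\<integral>u. \<bar>\<psi> x u - \<psi> y u\<bar> \<partial>m) \<le> ennreal \<delta>" using \<delta>(2) by metis
    then show ?thesis using \<delta>(1) ennreal_le_iff by blast
  qed
  finally show ?thesis .
qed

context
  fixes g :: "nat \<Rightarrow> 'u \<Rightarrow> real" and w :: nat
  assumes gm [measurable]: "\<And>i. g i \<in> borel_measurable borel"
    and g01: "\<And>i u. 0 \<le> g i u" "\<And>i u. g i u \<le> 1"
begin

lemma block_mean_01: "x \<in> X \<Longrightarrow> 0 \<le> block_mean g w x" "x \<in> X \<Longrightarrow> block_mean g w x \<le> 1"
  unfolding block_mean_def by (auto intro!: prod_nonneg prod_le_1 integral_dens_01 shift_in g01)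

lemma block_mean_measurable [measurable]: "block_mean g w \<in> borel_measurable \<mu>"
proof -
  have "(\<lambda>x. \<Prod>i<w. \<integral>u. \<psi> ((shift ^^ i) x) u * g i u \<partial>m) \<in> borel_measurable \<mu>"
    by measurable
  moreover have "block_mean g w x = (\<Prod>i<w. \<integral>u. \<psi> ((shift ^^ i) x) u * g i u \<partial>m)" if "x \<in> space \<mu>" for x
    unfolding block_mean_def using that by (intro prod.cong refl integral_dens shift_in) (auto simp: space_mu)
  ultimately show ?thesis by (subst measurable_cong) auto
qed

text \<open>Each factor depends on the path essentially through a window of radius \<open>j\<close>,
  and the difference of two products of numbers in the unit interval is at most the sum of the
  differences of the factors.\<close>

lemma block_mean_approx:
  assumes "0 < \<delta>"
  shows "\<exists>j n G. \<forall>x\<in>X. \<bar>block_mean g w ((shift ^^ j) x) - G (word x n)\<bar> \<le> \<delta>"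
proof -
  \<comment> \<open>One share for each of the \<open>w\<close> factors; the added 1 avoids division
    by 0 when \<open>w\<close> is 0.\<close>
  define \<delta>' where "\<delta>' = \<delta> / (real w + 1)"
  have d': "0 < \<delta>'" "real w * \<delta>' \<le> \<delta>" using assms by (auto simp: \<delta>'_def field_simps)
  obtain j where j: "\<And>x y. x \<in> X \<Longrightarrow> y \<in> X \<Longrightarrow> (\<forall>i. nat \<bar>i\<bar> < j \<longrightarrow> x i = y i) \<Longrightarrow>
      (\<integral>\<^sup>+u. ennreal \<bar>\<psi> x u - \<psi> y u\<bar> \<partial>m) \<le> ennreal \<delta>'"
    using psi_variation[OF d'(1)] by blast
  \<comment> \<open>After the shift by \<open>j\<close> the windows of radius \<open>j\<close>
    around the positions \<open>0..<w\<close> all lie inside \<open>0..<n\<close>.\<close>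
  define n where "n = 2 * j + w"
  define rep where "rep v = (SOME z. z \<in> X \<and> word z n = v)" for v
  define G where "G v = block_mean g w ((shift ^^ j) (rep v))" for v
  have "\<bar>block_mean g w ((shift ^^ j) x) - G (word x n)\<bar> \<le> \<delta>" if x: "x \<in> X" for x
  proof -
    let ?z = "rep (word x n)"
    have z: "?z \<in> X" "word ?z n = word x n"
      using someI_ex[of "\<lambda>z. z \<in> X \<and> word z n = word x n"] x unfolding rep_def by blast+
    let ?I = "\<lambda>i x. \<integral>u. g i u \<partial>dens ((shift ^^ i) ((shift ^^ j) x))"
    have "\<bar>block_mean g w ((shift ^^ j) x) - G (word x n)\<bar> \<le> (\<Sum>i<w. \<bar>?I i x - ?I i ?z\<bar>)"
      unfolding G_def block_mean_def
      using integral_dens_01[OF shift_in[OF shift_in[OF x]] gm g01] integral_dens_01[OF shift_in[OF shift_in[OF z(1)]] gm g01]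
      by (intro norm_prod_diff[where 'a = real, unfolded real_norm_def]) auto
    also have "\<dots> \<le> (\<Sum>i<w. \<delta>')"
    proof (rule sum_mono)
      fix i assume "i \<in> {..<w}"
      have "(shift ^^ i) ((shift ^^ j) x) t = (shift ^^ i) ((shift ^^ j) ?z) t" if "nat \<bar>t\<bar> < j" for t
      proof -
        have "nat (t + int i + int j) < n" "int (nat (t + int i + int j)) = t + int i + int j"
          using that \<open>i \<in> {..<w}\<close> unfolding n_def lessThan_iff by linarith+
        moreover have "?z (int k) = x (int k)" if "k < n" for k using z(2) that unfolding word_eq_iff by blast
        ultimately have "?z (t + int i + int j) = x (t + int i + int j)" by metis
        then show ?thesis by (simp add: shift_funpow)
      qed
      then show "\<bar>?I i x - ?I i ?z\<bar> \<le> \<delta>'"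
        using d'(1) by (intro integral_dens_diff[OF shift_in[OF shift_in[OF x]] shift_in[OF shift_in[OF z(1)]] gm g01]
          j[OF shift_in[OF shift_in[OF x]] shift_in[OF shift_in[OF z(1)]]]) auto
    qed
    also have "\<dots> \<le> \<delta>" using d' by simp
    finally show ?thesis .
  qed
  then show ?thesis by blast
qed

lemma obs_measurable [measurable]: "(\<lambda>y. \<Prod>i<w. g i (y (k + i))) \<in> borel_measurable Y"
  by measurable

lemma obs_01: "0 \<le> (\<Prod>i<w. g i (y (k + i)))" "(\<Prod>i<w. g i (y (k + i))) \<le> 1"
  using g01 by (auto intro!: prod_nonneg prod_le_1)

text \<open>Conditioning on the hidden path and \<open>window_expectation\<close>. The index is
  written \<open>0 + i\<close> to match windows starting at a general \<open>k\<close>.\<close>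

lemma expectation_obs: "(\<integral>y. (\<Prod>i<w. g i (y (0 + i))) \<partial>PY) = expectation (block_mean g w)"
proof -
  define o' where "o' y = (\<Prod>i<w. g i (y (0 + i)))" for y :: "nat \<Rightarrow> 'u"
  have om [measurable]: "o' \<in> borel_measurable Y" unfolding o'_def[abs_def] by (rule obs_measurable)
  have o01: "0 \<le> o' y" "o' y \<le> 1" for y unfolding o'_def by (rule obs_01)+
  have "ennreal (\<integral>y. o' y \<partial>PY) = (\<integral>\<^sup>+y. ennreal (o' y) \<partial>PY)"
    by (intro nn_integral_eq_integral[symmetric] PY.integrable_const_bound[where B = 1]) (auto simp: o01)
  also have "\<dots> = (\<integral>\<^sup>+x. \<integral>\<^sup>+y. ennreal (o' y) \<partial>Px x \<partial>\<mu>)" by (rule nn_integral_PY) simp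
  also have "\<dots> = (\<integral>\<^sup>+x. ennreal (block_mean g w x) \<partial>\<mu>)"
  proof (rule nn_integral_cong)
    fix x assume "x \<in> space \<mu>"
    then have x: "x \<in> X" by (simp add: space_mu)
    interpret Px: prob_space "Px x" by (rule prob_Px[OF x])
    have "(\<integral>\<^sup>+y. ennreal (o' y) \<partial>Px x) = ennreal (\<integral>y. o' y \<partial>Px x)"
      by (intro nn_integral_eq_integral Px.integrable_const_bound[where B = 1]) (auto simp: o01)
    also have "(\<integral>y. o' y \<partial>Px x) = (\<Prod>i<w. \<integral>u. g i u \<partial>dens ((shift ^^ (0 + i)) x))"
      unfolding Px_def o'_def by (rule window_expectation) (auto intro!: prob_dens shift_in x g01)
    finally show "(\<integral>\<^sup>+y. ennreal (o' y) \<partial>Px x) = ennreal (block_mean g w x)" by (simp add: block_mean_def)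
  qed
  also have "\<dots> = ennreal (expectation (block_mean g w))"
    using block_mean_01 by (intro nn_integral_eq_integral integrable_bounded[where B = 1]) (auto simp: space_mu)
  finally have "(\<integral>y. o' y \<partial>PY) = expectation (block_mean g w)"
    using block_mean_01 o01
    by (subst (asm) ennreal_inj) (auto intro!: Bochner_Integration.integral_nonneg simp: space_mu)
  then show ?thesis by (simp only: o'_def)
qed

text \<open>Two sources of randomness, each allowed \<epsilon>/2. The conditional mean of the sum
  given the path is a Birkhoff sum of \<open>block_mean\<close>, controlled by
  \<open>birkhoff_concentration\<close>; the fluctuation around it for a fixed path is controlled by
  \<open>window_concentration\<close>.\<close>

lemma obs_concentration:
  assumes w: "0 < w" and eps: "0 < \<epsilon>"
  shows "\<exists>C q. 0 < q \<and> q < 1 \<and> (\<forall>n. PY.prob {y. real n * \<epsilon> \<le>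
    \<bar>(\<Sum>k<n. \<Prod>i<w. g i (y (k + i))) - real n * (\<integral>y. (\<Prod>i<w. g i (y (0 + i))) \<partial>PY)\<bar>} \<le> C * q^n)"
proof -
  define a where "a = (\<integral>y. (\<Prod>i<w. g i (y (0 + i))) \<partial>PY)"
  have a: "a = expectation (block_mean g w)" unfolding a_def by (rule expectation_obs)
  obtain C q where Cq: "0 < q" "q < 1"
    "\<And>n. prob {x\<in>space \<mu>. real n * (\<epsilon> / 2) \<le> \<bar>birkhoff_sum (block_mean g w) n x - real n * a\<bar>} \<le> C * q^n"
    using birkhoff_concentration[of "block_mean g w" "\<epsilon> / 2", OF block_mean_measurable block_mean_01 block_mean_approx] eps
    unfolding a by auto
  have "C \<ge> 0" using order_trans[OF measure_nonneg Cq(3)[of 0]] by simp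
  define r where "r = exp (- 2 * (\<epsilon> / 2)\<^sup>2 / (real w)\<^sup>2)"
  have r: "0 < r" "r < 1" using w eps by (auto simp: r_def)
  have rn: "exp (- 2 * (\<epsilon> / 2)\<^sup>2 / (real w)\<^sup>2 * real n) = r^n" for n
    unfolding r_def exp_of_nat2_mult ..
  have "PY.prob {y. real n * \<epsilon> \<le> \<bar>(\<Sum>k<n. \<Prod>i<w. g i (y (k + i))) - real n * a\<bar>} \<le> (C + 2 * real w) * (max q r)^n" for n
  proof -
    let ?A = "{y. real n * \<epsilon> \<le> \<bar>(\<Sum>k<n. \<Prod>i<w. g i (y (k + i))) - real n * a\<bar>}"
    let ?B = "{x\<in>space \<mu>. real n * (\<epsilon> / 2) \<le> \<bar>birkhoff_sum (block_mean g w) n x - real n * a\<bar>}"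
    have A: "?A \<in> sets Y"
    proof -
      have "{y\<in>space Y. real n * \<epsilon> \<le> \<bar>(\<Sum>k<n. \<Prod>i<w. g i (y (k + i))) - real n * a\<bar>} \<in> sets Y" by measurable
      then show ?thesis by (simp add: space_PiM)
    qed
    have pt: "emeasure (Px x) ?A \<le> indicator ?B x + ennreal (2 * real w * r^n)" if "x \<in> space \<mu>" for x
    proof (cases "x \<in> ?B")
      case True
      have x: "x \<in> X" using that by (simp add: space_mu)
      interpret Px: prob_space "Px x" by (rule prob_Px[OF x])
      have "emeasure (Px x) ?A \<le> 1" by (rule Px.emeasure_le_1)
      then show ?thesis using True by (simp add: add_increasing2)
    next
      case False
      have x: "x \<in> X" using that by (simp add: space_mu)
      interpret Px: prob_space "Px x" by (rule prob_Px[OF x])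
      have b: "(\<Sum>k<n. \<Prod>i<w. \<integral>u. g i u \<partial>dens ((shift ^^ (k + i)) x)) = birkhoff_sum (block_mean g w) n x"
        by (simp add: birkhoff_sum_def block_mean_def shift_funpow_add)
      let ?A' = "{y\<in>space (Px x). real n * (\<epsilon> / 2) \<le> \<bar>(\<Sum>k<n. \<Prod>i<w. g i (y (k + i))) - birkhoff_sum (block_mean g w) n x\<bar>}"
      have "?A \<subseteq> ?A'"
      proof
        fix y assume "y \<in> ?A"
        moreover have "\<not> real n * (\<epsilon> / 2) \<le> \<bar>birkhoff_sum (block_mean g w) n x - real n * a\<bar>" using False that by blast
        moreover have "real n * \<epsilon> = real n * (\<epsilon> / 2) + real n * (\<epsilon> / 2)" by simp
        ultimately show "y \<in> ?A'" unfolding mem_Collect_eq space_Px by (intro conjI UNIV_I) linarith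
      qed
      moreover have "{y\<in>space Y. real n * (\<epsilon> / 2) \<le> \<bar>(\<Sum>k<n. \<Prod>i<w. g i (y (k + i))) - c\<bar>} \<in> sets Y" for c
        by measurable
      then have "?A' \<in> sets (Px x)" by (simp add: space_PiM)
      ultimately have "emeasure (Px x) ?A \<le> emeasure (Px x) ?A'" by (intro emeasure_mono)
      also have "\<dots> = ennreal (measure (Px x) ?A')" by (rule Px.emeasure_eq_measure)
      also have "measure (Px x) ?A' \<le> 2 * real w * r^n"
        using window_concentration[of "\<lambda>k. dens ((shift ^^ k) x)" g w "\<epsilon> / 2" n,
            OF prob_dens[OF shift_in[OF x]] sets_dens gm g01 w half_gt_zero[OF eps]]
        unfolding b rn Px_def[symmetric] .
      finally have "emeasure (Px x) ?A \<le> ennreal (2 * real w * r^n)" by (simp add: ennreal_leI)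
      then show ?thesis by (simp add: add_increasing)
    qed
    have "ennreal (PY.prob ?A) = (\<integral>\<^sup>+x. emeasure (Px x) ?A \<partial>\<mu>)"
      using emeasure_PY[OF A] by (simp add: PY.emeasure_eq_measure)
    also have "\<dots> \<le> (\<integral>\<^sup>+x. indicator ?B x + ennreal (2 * real w * r^n) \<partial>\<mu>)" by (intro nn_integral_mono pt)
    also have "\<dots> = ennreal (prob ?B) + ennreal (2 * real w * r^n)"
      by (subst nn_integral_add) (auto simp: emeasure_eq_measure prob_space)
    also have "\<dots> = ennreal (prob ?B + 2 * real w * r^n)" using r by (subst ennreal_plus) auto
    finally have "PY.prob ?A \<le> prob ?B + 2 * real w * r^n" using r by (subst (asm) ennreal_le_iff) auto
    also have "\<dots> \<le> C * q^n + 2 * real w * r^n" using Cq by simp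
    also have "\<dots> \<le> C * (max q r)^n + 2 * real w * (max q r)^n"
      using Cq r \<open>C \<ge> 0\<close> by (intro add_mono mult_left_mono power_mono) auto
    finally show ?thesis by (simp add: algebra_simps)
  qed
  then show ?thesis unfolding a_def[symmetric] using Cq r by (intro exI[of _ "C + 2 * real w"] exI[of _ "max q r"]) auto
qed

text \<open>The exceptional probabilities are summable, so Borel-Cantelli applies.\<close>

lemma obs_eventually:
  assumes w: "0 < w" and eps: "0 < \<epsilon>"
  shows "AE y in PY. eventually (\<lambda>n. \<bar>(\<Sum>k<n. \<Prod>i<w. g i (y (k + i)))
      - real n * (\<integral>y. (\<Prod>i<w. g i (y (0 + i))) \<partial>PY)\<bar> < real n * \<epsilon>) sequentially"
proof -
  define a where "a = (\<integral>y. (\<Prod>i<w. g i (y (0 + i))) \<partial>PY)"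
  let ?A = "\<lambda>n. {y. real n * \<epsilon> \<le> \<bar>(\<Sum>k<n. \<Prod>i<w. g i (y (k + i))) - real n * a\<bar>}"
  from obs_concentration[OF assms, folded a_def]
  obtain C q where Cq: "0 < q" "q < 1" "\<forall>n. PY.prob (?A n) \<le> C * q^n" by (elim exE conjE)
  have A: "?A n \<in> sets PY" for n
  proof -
    have "{y\<in>space Y. real n * \<epsilon> \<le> \<bar>(\<Sum>k<n. \<Prod>i<w. g i (y (k + i))) - real n * a\<bar>} \<in> sets Y" by measurable
    then show ?thesis by (simp add: space_PiM)
  qed
  have "AE y in PY. eventually (\<lambda>n. y \<in> space PY - ?A n) sequentially"
  proof (rule borel_cantelli_AE1)
    show "summable (\<lambda>n. PY.prob (?A n))"
      by (rule summable_comparison_test'[where g = "\<lambda>n. C * q^n" and N = 0])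
         (use Cq in \<open>auto intro!: summable_mult summable_geometric\<close>)
    show "emeasure PY (?A n) < \<infinity>" for n unfolding PY.emeasure_eq_measure by simp
  qed (rule A)
  then show ?thesis unfolding a_def[symmetric]
  proof eventually_elim
    case (elim y)
    then show ?case by (rule eventually_mono) (simp add: not_le)
  qed
qed

end

end

text \<open>Greedy covering: each bad index \<open>k\<close> starts a window of length at most \<open>N\<close> on which \<open>a\<close> has average
  larger than \<open>c\<close>; disjoint such windows cover all bad indices.\<close>

lemma covering_bound:
  fixes a :: "nat \<Rightarrow> real" and N :: nat
  assumes a: "\<And>k. 0 \<le> a k" and c: "0 \<le> c"
  defines "bad \<equiv> \<lambda>k. \<exists>n. 1 \<le> n \<and> n \<le> N \<and> c * real n < (\<Sum>i<n. a (k + i))"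
  shows "c * real (card {k\<in>{s..<s+K}. bad k}) \<le> (\<Sum>i\<in>{s..<s+K+N}. a i)"
proof (induction K arbitrary: s rule: less_induct)
  case (less K)
  have win: "(\<Sum>i<n. a (k + i)) = (\<Sum>i\<in>{k..<k+n}. a i)" for k n
    by (rule sum.reindex_bij_witness[of _ "\<lambda>i. i - k" "\<lambda>i. k + i"]) auto
  \<comment> \<open>A good \<open>s\<close> is skipped. At a bad \<open>s\<close> the whole window
    of length \<open>n\<close> is consumed: it contains at most \<open>n\<close> bad indices, and
    \<open>c * n\<close> is less than its sum. The surplus \<open>N\<close> in the summation range
    is the room for a last window that overruns \<open>s + K\<close>.\<close>
  consider "K = 0" | "K \<noteq> 0" "\<not> bad s" | n where "K \<noteq> 0" "1 \<le> n" "n \<le> N" "c * real n < (\<Sum>i<n. a (s + i))"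
    by (auto simp: bad_def)
  then show ?case
  proof cases
    case 1
    then show ?thesis by (auto intro!: sum_nonneg a)
  next
    case 2
    have "{k\<in>{s..<s+K}. bad k} = {k\<in>{Suc s..<Suc s+(K-1)}. bad k}"
      using 2 by (auto simp: Suc_le_eq le_less)
    then have "c * real (card {k\<in>{s..<s+K}. bad k}) \<le> (\<Sum>i\<in>{Suc s..<Suc s+(K-1)+N}. a i)"
      using less[of "K - 1" "Suc s"] 2 by simp
    also have "\<dots> \<le> (\<Sum>i\<in>{s..<s+K+N}. a i)" using 2 by (intro sum_mono2) (auto simp: a)
    finally show ?thesis .
  next
    case 3
    show ?thesis
    proof (cases "K \<le> n")
      case True
      have "card {k\<in>{s..<s+K}. bad k} \<le> card {s..<s+K}" by (intro card_mono) auto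
      then have "c * real (card {k\<in>{s..<s+K}. bad k}) \<le> c * real n" using True c by (intro mult_left_mono) auto
      also have "\<dots> \<le> (\<Sum>i\<in>{s..<s+n}. a i)" using 3 by (simp add: win)
      also have "\<dots> \<le> (\<Sum>i\<in>{s..<s+K+N}. a i)" using 3 by (intro sum_mono2) (auto simp: a)
      finally show ?thesis .
    next
      case False
      have "{k\<in>{s..<s+K}. bad k} \<subseteq> {s..<s+n} \<union> {k\<in>{s+n..<s+n+(K-n)}. bad k}" using False by auto
      then have "card {k\<in>{s..<s+K}. bad k} \<le> card ({s..<s+n} \<union> {k\<in>{s+n..<s+n+(K-n)}. bad k})" by (intro card_mono) auto
      also have "\<dots> \<le> n + card {k\<in>{s+n..<s+n+(K-n)}. bad k}" by (intro order_trans[OF card_Un_le]) simp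
      finally have "c * real (card {k\<in>{s..<s+K}. bad k}) \<le> c * real (n + card {k\<in>{s+n..<s+n+(K-n)}. bad k})"
        using c by (intro mult_left_mono) auto
      also have "\<dots> \<le> (\<Sum>i\<in>{s..<s+n}. a i) + (\<Sum>i\<in>{s+n..<s+n+(K-n)+N}. a i)"
        using less[of "K - n" "s + n"] 3 by (simp add: win distrib_left)
      also have "\<dots> = (\<Sum>i\<in>{s..<s+K+N}. a i)"
        using False by (subst sum.atLeastLessThan_concat) auto
      finally show ?thesis .
    qed
  qed
qed

context hidden
begin

section \<open>Averages of unbounded functions of a single observation\<close>

lemma translate_obs_measurable [measurable]: "(\<lambda>y i. y (i + k)) \<in> measurable Y Y" for k :: nat
  by (intro measurable_PiM_single') (auto simp: space_PiM)

lemma distr_translate: "distr PY PY (\<lambda>y i. y (i + k)) = PY" for k :: nat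
proof (induction k)
  case 0
  show ?case by (simp add: distr_id2)
next
  case (Suc k)
  have "distr PY PY (\<lambda>y i. y (i + Suc k)) = distr (distr PY PY (\<lambda>y i. y (i + k))) PY (\<lambda>y i. y (Suc i))"
    by (subst distr_distr) (auto simp: o_def)
  then show ?case by (simp only: Suc distr_tail)
qed

text \<open>Integrating \<open>covering_bound\<close> over the starting points below
  \<open>K\<close>, with \<open>bad N k\<close> of the same probability \<open>p\<close> for all
  \<open>k\<close> by stationarity, gives \<open>c * K * p \<le> (K + N) * e\<close>. Letting
  \<open>K\<close> and afterwards the window bound \<open>N\<close> tend to infinity yields the
  claim.\<close>

lemma maximal_inequality:
  fixes h :: "'u \<Rightarrow> real"
  assumes hm [measurable]: "h \<in> borel_measurable borel" and h0: "\<And>u. 0 \<le> h u"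
    and int: "integrable PY (\<lambda>y. h (y 0))" and c: "0 < c"
  shows "PY.prob {y. \<exists>n\<ge>1. c * real n < (\<Sum>i<n. h (y i))} \<le> (\<integral>y. h (y 0) \<partial>PY) / c"
proof -
  define e where "e = (\<integral>y. h (y 0) \<partial>PY)"
  define bad where "bad N k y \<longleftrightarrow> (\<exists>n. 1 \<le> n \<and> n \<le> N \<and> c * real n < (\<Sum>i<n. h (y (k + i))))" for N k and y :: "nat \<Rightarrow> 'u"
  have badm: "{y. bad N k y} \<in> sets PY" for N k
  proof -
    have "{y\<in>space Y. \<exists>n. 1 \<le> n \<and> n \<le> N \<and> c * real n < (\<Sum>i<n. h (y (k + i)))} \<in> sets Y" by measurable
    then show ?thesis by (simp add: space_PiM bad_def)
  qed
  have inth: "integrable PY (\<lambda>y. h (y k))" "(\<integral>y. h (y k) \<partial>PY) = e" for k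
  proof -
    have T: "(\<lambda>y i. y (i + k)) \<in> measurable PY PY" by simp
    have 1: "integrable (distr PY PY (\<lambda>y i. y (i + k))) (\<lambda>y. h (y 0))" unfolding distr_translate by (rule int)
    have "integrable PY (\<lambda>y. h (y (0 + k)))" by (rule integrable_distr[OF T 1])
    then show "integrable PY (\<lambda>y. h (y k))" by simp
    have "(\<lambda>y. h (y 0)) \<in> borel_measurable PY" using int by (rule borel_measurable_integrable)
    from integral_distr[OF T this] show "(\<integral>y. h (y k) \<partial>PY) = e" unfolding distr_translate by (simp add: e_def)
  qed
  have prob_bad: "PY.prob {y. bad N k y} = PY.prob {y. bad N 0 y}" for N k
  proof -
    have "PY.prob {y. bad N 0 y} = measure (distr PY PY (\<lambda>y i. y (i + k))) {y. bad N 0 y}"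
      by (simp add: distr_translate)
    also have "\<dots> = PY.prob ((\<lambda>y i. y (i + k)) -` {y. bad N 0 y} \<inter> space PY)"
      using badm by (intro measure_distr) auto
    also have "(\<lambda>y i. y (i + k)) -` {y. bad N 0 y} \<inter> space PY = {y. bad N k y}"
      by (auto simp: bad_def add.commute)
    finally show ?thesis by simp
  qed
  have finN: "PY.prob {y. bad N 0 y} \<le> e / c" for N
  proof -
    let ?p = "PY.prob {y. bad N 0 y}"
    have K: "c * (real K * ?p) \<le> real (K + N) * e" for K
    proof -
      have iI: "integrable PY (indicator {y. bad N k y} :: _ \<Rightarrow> real)" for k
        by (intro integrable_real_indicator badm) (simp add: PY.emeasure_eq_measure)
      have I: "(\<integral>y. (indicator {y. bad N k y} y :: real) \<partial>PY) = ?p" for k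
      proof -
        have "(\<integral>y. indicator {y. bad N k y} y \<partial>PY) = PY.prob ({y. bad N k y} \<inter> space PY)"
          by (rule Bochner_Integration.integral_indicator)
        then show ?thesis unfolding space_PY Int_UNIV_right prob_bad[of N k] .
      qed
      have iS: "integrable PY (\<lambda>y. \<Sum>k<K. indicator {y. bad N k y} y :: real)"
        by (rule Bochner_Integration.integrable_sum) (rule iI)
      have "(\<integral>y. c * (\<Sum>k<K. indicator {y. bad N k y} y) \<partial>PY) = c * (\<integral>y. (\<Sum>k<K. indicator {y. bad N k y} y) \<partial>PY)"
        by (rule integral_mult_right_zero)
      also have "(\<integral>y. (\<Sum>k<K. indicator {y. bad N k y} y :: real) \<partial>PY) =
          (\<Sum>k<K. \<integral>y. indicator {y. bad N k y} y \<partial>PY)"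
        by (rule Bochner_Integration.integral_sum) (rule iI)
      also have "\<dots> = (\<Sum>k<K. ?p)" by (simp only: I)
      finally have F: "(\<integral>y. c * (\<Sum>k<K. indicator {y. bad N k y} y) \<partial>PY) = c * (\<Sum>k<K. ?p)" .
      have "c * (real K * ?p) = (\<integral>y. c * (\<Sum>k<K. indicator {y. bad N k y} y) \<partial>PY)" unfolding F by simp
      also have "\<dots> \<le> (\<integral>y. (\<Sum>i<K + N. h (y i)) \<partial>PY)"
      proof (rule integral_mono)
        show "integrable PY (\<lambda>y. c * (\<Sum>k<K. indicator {y. bad N k y} y))"
          by (rule integrable_mult_right) (rule iS)
        show "integrable PY (\<lambda>y. \<Sum>i<K + N. h (y i))" by (rule Bochner_Integration.integrable_sum) (rule inth)
        fix y
        have "real (card {k\<in>{0..<0+K}. bad N k y}) = (\<Sum>k\<in>{k\<in>{0..<0+K}. bad N k y}. 1)" by simp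
        also have "\<dots> = (\<Sum>k\<in>{0..<0+K}. if bad N k y then 1 else 0)" by (rule sum.inter_filter) simp
        also have "\<dots> = (\<Sum>k<K. indicator {y. bad N k y} y)"
          by (intro sum.cong) (auto simp: indicator_def)
        finally have eq: "(\<Sum>k<K. indicator {y. bad N k y} y) = real (card {k\<in>{0..<0+K}. bad N k y})" ..
        have "c * real (card {k\<in>{0..<0+K}. bad N k y}) \<le> (\<Sum>i\<in>{0..<0+K+N}. h (y i))"
          unfolding bad_def using h0 c by (intro covering_bound) auto
        then show "c * (\<Sum>k<K. indicator {y. bad N k y} y) \<le> (\<Sum>i<K + N. h (y i))"
          unfolding eq by (simp only: add_0 lessThan_atLeast0)
      qed
      also have "\<dots> = (\<Sum>i<K + N. (\<integral>y. h (y i) \<partial>PY))" by (rule Bochner_Integration.integral_sum) (rule inth)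
      also have "\<dots> = real (K + N) * e" unfolding inth(2) by simp
      finally show ?thesis .
    qed
    \<comment> \<open>The inequality \<open>K\<close> is used at \<open>Suc K\<close> so that it can
      be divided by the number of starting points.\<close>
    have "(\<lambda>K. (1 + real N * inverse (real (Suc K))) * e) \<longlonglongrightarrow> (1 + real N * 0) * e"
      by (intro tendsto_intros LIMSEQ_inverse_real_of_nat)
    moreover have "c * ?p \<le> (1 + real N * inverse (real (Suc K))) * e" for K
    proof -
      have "c * (real (Suc K) * ?p) / real (Suc K) \<le> real (Suc K + N) * e / real (Suc K)"
        by (intro divide_right_mono K) auto
      then show ?thesis by (simp add: field_simps del: of_nat_Suc) (simp add: algebra_simps)
    qed
    ultimately have "c * ?p \<le> (1 + real N * 0) * e" by (intro LIMSEQ_le_const) auto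
    then show ?thesis using c by (simp add: field_simps)
  qed
  have "(\<lambda>N. PY.prob {y. bad N 0 y}) \<longlonglongrightarrow> PY.prob (\<Union>N. {y. bad N 0 y})"
  proof (rule PY.finite_Lim_measure_incseq)
    show "incseq (\<lambda>N. {y. bad N 0 y})" by (auto simp: incseq_def bad_def intro: order_trans)
  qed (use badm in auto)
  then have "PY.prob (\<Union>N. {y. bad N 0 y}) \<le> e / c" by (rule LIMSEQ_le_const2) (use finN in auto)
  also have "(\<Union>N. {y. bad N 0 y}) = {y. \<exists>n\<ge>1. c * real n < (\<Sum>i<n. h (y i))}"
    by (auto simp: bad_def)
  finally show ?thesis by (simp add: e_def)
qed

text \<open>The bounded part \<open>min h R\<close> is handled by concentration, the remainder by the maximal inequality.\<close>

lemma eventually_sum_le: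
  fixes h :: "'u \<Rightarrow> real"
  assumes hm [measurable]: "h \<in> borel_measurable borel" and h0: "\<And>u. 0 \<le> h u"
    and eps: "(\<integral>\<^sup>+y. ennreal (h (y 0)) \<partial>PY) < ennreal \<epsilon>"
  shows "AE y in PY. eventually (\<lambda>n. (\<Sum>k<n. h (y k)) \<le> real n * \<epsilon>) sequentially"
proof -
  have coord: "(\<lambda>y. h' (y k)) \<in> borel_measurable PY" if [measurable]: "h' \<in> borel_measurable borel" for h' :: "'u \<Rightarrow> real" and k
  proof -
    have "(\<lambda>y. h' (y k)) \<in> borel_measurable Y" by measurable
    then show ?thesis by (simp only: measurable_cong_sets[OF sets_PY refl])
  qed
  have int: "integrable PY (\<lambda>y. h (y 0))"
    by (rule integrableI_nonneg[OF coord[OF hm]]) (use h0 less_trans[OF eps ennreal_less_top] in simp_all)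
  define e where "e = (\<integral>y. h (y 0) \<partial>PY)"
  have "0 \<le> e" unfolding e_def by (rule Bochner_Integration.integral_nonneg) (rule h0)
  have "(\<integral>\<^sup>+y. ennreal (h (y 0)) \<partial>PY) = ennreal e"
    unfolding e_def by (rule nn_integral_eq_integral[OF int]) (simp add: h0)
  then have "e < \<epsilon>" using eps ennreal_less_iff[OF \<open>0 \<le> e\<close>] by simp
  \<comment> \<open>Then \<open>e + \<eta> + \<eta> = \<epsilon>\<close>: one \<eta> for the
    fluctuation of the truncated part, one for the average of the remainder
    \<open>t\<close>.\<close>
  define \<eta> where "\<eta> = (\<epsilon> - e) / 2"
  have eta: "0 < \<eta>" using \<open>e < \<epsilon>\<close> by (simp add: \<eta>_def)
  define t where "t R u = h u - min (h u) (real R)" for R u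
  have tm [measurable]: "t R \<in> borel_measurable borel" for R unfolding t_def by measurable
  have t0: "0 \<le> t R u" "t R u \<le> h u" for R u using h0[of u] by (auto simp: t_def min_def)
  have intt: "integrable PY (\<lambda>y. t R (y 0))" for R
    by (rule Bochner_Integration.integrable_bound[OF int coord[OF tm]]) (use t0 h0 in auto)
  have "(\<lambda>R. \<integral>y. t R (y 0) \<partial>PY) \<longlonglongrightarrow> (\<integral>y. 0 \<partial>PY)"
  proof (rule integral_dominated_convergence[where w = "\<lambda>y. h (y 0)"])
    show "AE y in PY. (\<lambda>R. t R (y 0)) \<longlonglongrightarrow> 0"
    proof (rule AE_I2)
      fix y :: "nat \<Rightarrow> 'u"
      obtain R0 where "h (y 0) \<le> real R0" using real_arch_simple by blast
      then have "eventually (\<lambda>R. t R (y 0) = 0) sequentially"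
        by (intro eventually_sequentiallyI[of R0]) (auto simp: t_def min_def)
      then show "(\<lambda>R. t R (y 0)) \<longlonglongrightarrow> 0" by (rule tendsto_eventually)
    qed
    show "AE y in PY. norm (t R (y 0)) \<le> h (y 0)" for R by (rule AE_I2) (use t0 in simp)
    show "(\<lambda>y. 0) \<in> borel_measurable PY" by simp
  qed (rule int coord[OF tm])+
  then have t_lim: "(\<lambda>R. (\<integral>y. t R (y 0) \<partial>PY) / \<eta>) \<longlonglongrightarrow> 0" by (intro tendsto_divide_zero) simp
  let ?S = "\<lambda>n (y :: nat \<Rightarrow> 'u). \<Sum>k<n. h (y k)"
  \<comment> \<open>The probability of this failure set does not depend on the truncation level,
    while its bound \<open>bd\<close> tends to 0 as the level grows; hence it is a null set.\<close>
  define B where "B = {y. \<not> eventually (\<lambda>n. ?S n y \<le> real n * \<epsilon>) sequentially}"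
  have Bm: "B \<in> sets PY"
  proof -
    have "{y\<in>space Y. \<not> (\<exists>n0. \<forall>n\<ge>n0. ?S n y \<le> real n * \<epsilon>)} \<in> sets Y" by measurable
    then show ?thesis by (simp add: space_PiM B_def eventually_sequentially)
  qed
  have bd: "PY.prob B \<le> (\<integral>y. t (Suc R) (y 0) \<partial>PY) / \<eta>" for R
  proof -
    \<comment> \<open>The truncated function is rescaled to the unit interval to fit the
      concentration result with windows of length 1; \<open>Suc R\<close> keeps the divisor
      positive.\<close>
    define g where "g = (\<lambda>(i::nat) u. min (h u) (real (Suc R)) / real (Suc R))"
    have gm: "g i \<in> borel_measurable borel" for i unfolding g_def by measurable
    have g01: "0 \<le> g i u" "g i u \<le> 1" for i u using h0[of u] by (auto simp: g_def)
    let ?a = "\<integral>y. (\<Prod>i<1. g i (y (0 + i))) \<partial>PY"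
    have a: "real (Suc R) * ?a \<le> e"
    proof -
      have "real (Suc R) * ?a = (\<integral>y. min (h (y 0)) (real (Suc R)) \<partial>PY)"
        by (simp add: g_def del: of_nat_Suc)
      also have "\<dots> \<le> e" unfolding e_def
      proof (rule integral_mono[OF _ int])
        have "(\<lambda>u. min (h u) (real (Suc R))) \<in> borel_measurable borel" by measurable
        from coord[OF this] show "integrable PY (\<lambda>y. min (h (y 0)) (real (Suc R)))"
          by (rule PY.integrable_const_bound[where B = "real (Suc R)", rotated])
             (rule AE_I2, use h0 in \<open>simp add: min_def\<close>)
      qed simp
      finally show ?thesis .
    qed
    let ?G = "\<lambda>y. eventually (\<lambda>n. \<bar>(\<Sum>k<n. \<Prod>i<1. g i (y (k + i))) - real n * ?a\<bar> < real n * (\<eta> / real (Suc R))) sequentially"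
    let ?M = "{y. \<exists>n\<ge>1. \<eta> * real n < (\<Sum>i<n. t (Suc R) (y i))}"
    have AE: "AE y in PY. ?G y" using eta by (intro obs_eventually gm g01) auto
    have Mm: "?M \<in> sets PY"
    proof -
      have "{y\<in>space Y. \<exists>n\<ge>1. \<eta> * real n < (\<Sum>i<n. t (Suc R) (y i))} \<in> sets Y" by measurable
      then show ?thesis by (simp add: space_PiM)
    qed
    have "AE y in PY. y \<in> B \<longrightarrow> y \<in> ?M"
      using AE
    proof eventually_elim
      case (elim y)
      show ?case
      proof (rule impI, rule ccontr)
        assume y: "y \<in> B" "y \<notin> ?M"
        have "eventually (\<lambda>n. ?S n y \<le> real n * \<epsilon>) sequentially"
          using elim eventually_ge_at_top[of 1]
        proof eventually_elim
          case (elim n)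
          have "?S n y = real (Suc R) * (\<Sum>k<n. g 0 (y k)) + (\<Sum>k<n. t (Suc R) (y k))"
            by (simp add: g_def t_def sum_distrib_left sum.distrib[symmetric] del: of_nat_Suc)
          moreover have "(\<Sum>k<n. t (Suc R) (y k)) \<le> \<eta> * real n" using y(2) elim(2) by (auto simp: not_less)
          moreover have "real (Suc R) * (\<Sum>k<n. g 0 (y k)) \<le> real (Suc R) * (real n * ?a + real n * (\<eta> / real (Suc R)))"
            using elim(1) by (intro mult_left_mono) (auto simp: abs_less_iff simp del: of_nat_Suc)
          moreover have "\<dots> = real n * (real (Suc R) * ?a) + real n * \<eta>"
            by (simp add: field_simps del: of_nat_Suc)
          moreover have "real n * (real (Suc R) * ?a) \<le> real n * e" using a by (intro mult_left_mono) auto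
          moreover have "real n * e + real n * \<eta> + \<eta> * real n = real n * \<epsilon>" by (simp add: \<eta>_def field_simps)
          ultimately show ?case by linarith
        qed
        then show False using y(1) by (simp add: B_def)
      qed
    qed
    then have "PY.prob B \<le> PY.prob ?M" using Mm by (intro PY.finite_measure_mono_AE) auto
    also have "\<dots> \<le> (\<integral>y. t (Suc R) (y 0) \<partial>PY) / \<eta>" using eta by (intro maximal_inequality tm t0 intt)
    finally show ?thesis .
  qed
  have "PY.prob B \<le> 0"
    by (rule LIMSEQ_le_const[OF LIMSEQ_Suc[OF t_lim]]) (use bd in auto)
  then have "PY.prob B = 0" using measure_nonneg[of PY B] by linarith
  then have "B \<in> null_sets PY" using Bm by (simp add: null_sets_def PY.emeasure_eq_measure)
  then have "AE y in PY. y \<notin> B" by (rule AE_not_in)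
  then show ?thesis by (simp add: B_def)
qed

end

section \<open>Likelihoods and exponential separation\<close>

lemma density_PiM:
  fixes m :: "'u measure" and h :: "nat \<Rightarrow> 'u \<Rightarrow> ennreal"
  assumes m: "sigma_finite_measure m" and I: "finite I"
    and h: "\<And>i. h i \<in> borel_measurable m" and p: "\<And>i. prob_space (density m (h i))"
  shows "PiM I (\<lambda>i. density m (h i)) = density (PiM I (\<lambda>_. m)) (\<lambda>v. \<Prod>i\<in>I. h i (v i))"
proof -
  interpret D: prob_space "density m (h i)" for i by (rule p)
  interpret D: product_sigma_finite "\<lambda>i. density m (h i)" by unfold_locales
  interpret m: sigma_finite_measure m by (rule m)
  interpret M: product_sigma_finite "\<lambda>_. m" by unfold_locales
  have hm [measurable]: "(\<lambda>v. h i (v i)) \<in> borel_measurable (PiM I (\<lambda>_. m))" if "i \<in> I" for i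
    using measurable_compose[OF measurable_component_singleton[OF that, of "\<lambda>_. m"] h] .
  have prodm: "(\<lambda>v. \<Prod>i\<in>I. h i (v i)) \<in> borel_measurable (PiM I (\<lambda>_. m))"
    by (rule borel_measurable_prod_ennreal) (rule hm)
  show ?thesis
  proof (rule D.PiM_eqI[OF I, symmetric])
    show "sets (density (PiM I (\<lambda>_. m)) (\<lambda>v. \<Prod>i\<in>I. h i (v i))) = sets (PiM I (\<lambda>i. density m (h i)))"
      unfolding sets_density by (intro sets_PiM_cong) auto
    fix A assume "\<And>i. i \<in> I \<Longrightarrow> A i \<in> sets (density m (h i))"
    then have A: "A i \<in> sets m" if "i \<in> I" for i using that by simp
    have "emeasure (density (PiM I (\<lambda>_. m)) (\<lambda>v. \<Prod>i\<in>I. h i (v i))) (Pi\<^sub>E I A) =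
      (\<integral>\<^sup>+v. (\<Prod>i\<in>I. h i (v i)) * indicator (Pi\<^sub>E I A) v \<partial>PiM I (\<lambda>_. m))"
      using A by (intro emeasure_density prodm sets_PiM_I_finite I)
    also have "\<dots> = (\<integral>\<^sup>+v. (\<Prod>i\<in>I. h i (v i) * indicator (A i) (v i)) \<partial>PiM I (\<lambda>_. m))"
    proof (rule nn_integral_cong)
      fix v assume "v \<in> space (PiM I (\<lambda>_. m))"
      then have "indicator (Pi\<^sub>E I A) v = (\<Prod>i\<in>I. indicator (A i) (v i) :: ennreal)"
        using I by (cases "v \<in> Pi\<^sub>E I A") (auto simp: space_PiM PiE_iff prod_zero_iff indicator_def)
      then show "(\<Prod>i\<in>I. h i (v i)) * indicator (Pi\<^sub>E I A) v = (\<Prod>i\<in>I. h i (v i) * indicator (A i) (v i))"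
        by (simp add: prod.distrib)
    qed
    also have "\<dots> = (\<Prod>i\<in>I. \<integral>\<^sup>+u. h i u * indicator (A i) u \<partial>m)"
      using A h by (intro M.product_nn_integral_prod I) auto
    also have "\<dots> = (\<Prod>i\<in>I. emeasure (density m (h i)) (A i))"
      using A h by (intro prod.cong refl emeasure_density[symmetric]) auto
    finally show "emeasure (density (PiM I (\<lambda>_. m)) (\<lambda>v. \<Prod>i\<in>I. h i (v i))) (Pi\<^sub>E I A) =
      (\<Prod>i\<in>I. emeasure (density m (h i)) (A i))" .
  qed
qed

context hidden
begin

definition lik :: "nat \<Rightarrow> (nat \<Rightarrow> 'u) \<Rightarrow> real" where
  "lik n u = expectation (\<lambda>x. \<Prod>k<n. \<psi> ((shift ^^ k) x) (u k))"

lemma prod_psi_measurable: "(\<lambda>x. \<Prod>k<n. \<psi> ((shift ^^ k) x) (u k)) \<in> borel_measurable \<mu>"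
  by measurable

lemma prod_psi_pos: "x \<in> X \<Longrightarrow> 0 < (\<Prod>k<n. \<psi> ((shift ^^ k) x) (u k))"
  by (intro prod_pos) (auto intro: psi_pos shift_in)

text \<open>For a fixed observation sequence each factor is bounded on all of \<open>X\<close>, so
  the product is a bounded measurable function of the path.\<close>

lemma prod_psi_integrable: "integrable \<mu> (\<lambda>x. \<Prod>k<n. \<psi> ((shift ^^ k) x) (u k))"
proof -
  have "\<forall>u. \<exists>B. \<forall>x\<in>X. \<psi> x u \<le> B" using psi_bounded by blast
  then obtain B where B: "\<And>u x. x \<in> X \<Longrightarrow> \<psi> x u \<le> B u" by metis
  show ?thesis
  proof (rule integrable_bounded[OF prod_psi_measurable, of _ _ "\<Prod>k<n. B (u k)"])
    fix x assume x: "x \<in> X"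
    have "(\<Prod>k<n. \<psi> ((shift ^^ k) x) (u k)) \<le> (\<Prod>k<n. B (u k))"
      using B[OF shift_in[OF x]] psi_pos[OF shift_in[OF x]] by (intro prod_mono) (auto simp: less_imp_le)
    then show "\<bar>\<Prod>k<n. \<psi> ((shift ^^ k) x) (u k)\<bar> \<le> (\<Prod>k<n. B (u k))"
      using prod_psi_pos[OF x, of u n] by simp
  qed
qed

text \<open>A nonnegative integrand with zero integral vanishes almost surely, whereas this one is
  positive at every point of \<open>X\<close>. Positivity for every sequence allows likelihood
  ratios without exceptional sets.\<close>

lemma lik_pos: "0 < lik n u"
proof -
  have "0 \<le> lik n u" unfolding lik_def
    using prod_psi_pos by (intro integral_nonneg_AE AE_I2) (auto simp: space_mu less_imp_le)
  moreover have "lik n u \<noteq> 0"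
  proof
    assume "lik n u = 0"
    then have "AE x in \<mu>. (\<Prod>k<n. \<psi> ((shift ^^ k) x) (u k)) = 0"
      unfolding lik_def
      by (subst (asm) integral_nonneg_eq_0_iff_AE[OF prod_psi_integrable])
         (auto simp: space_mu intro!: AE_I2 less_imp_le[OF prod_psi_pos])
    then have "AE x in \<mu>. False"
      using AE_space
    proof eventually_elim
      case (elim x)
      then have "x \<in> X" by (simp add: space_mu)
      then show ?case using elim(1) prod_psi_pos[of x u n] by (metis less_irrefl)
    qed
    then show False by simp
  qed
  ultimately show ?thesis by simp
qed

lemma lik_restrict: "lik n (restrict y {..<n}) = lik n y"
  unfolding lik_def by (intro Bochner_Integration.integral_cong refl prod.cong) auto

lemma psi_prod_measurable_pair:
  "(\<lambda>(x, v). \<Prod>k<n. \<psi> ((shift ^^ k) x) (v k)) \<in> borel_measurable (\<mu> \<Otimes>\<^sub>M PiM {..<n} (\<lambda>_. m))"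
proof -
  have "(\<lambda>p. \<psi> ((shift ^^ k) (fst p)) (snd p k)) \<in> borel_measurable (\<mu> \<Otimes>\<^sub>M PiM {..<n} (\<lambda>_. m))" if "k < n" for k
  proof (rule psi_measurable2)
    show "(\<lambda>p. (shift ^^ k) (fst p)) \<in> measurable (\<mu> \<Otimes>\<^sub>M PiM {..<n} (\<lambda>_. m)) \<mu>"
      by (rule measurable_compose[OF measurable_fst funpow_shift_measurable])
    have "(\<lambda>p. snd p k) \<in> measurable (\<mu> \<Otimes>\<^sub>M PiM {..<n} (\<lambda>_. m)) m"
      using that by (intro measurable_compose[OF measurable_snd measurable_component_singleton]) simp
    then show "(\<lambda>p. snd p k) \<in> measurable (\<mu> \<Otimes>\<^sub>M PiM {..<n} (\<lambda>_. m)) borel"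
      using measurable_cong_sets[OF refl sets_m] by blast
  qed
  then have "(\<lambda>p. \<Prod>k<n. \<psi> ((shift ^^ k) (fst p)) (snd p k)) \<in> borel_measurable (\<mu> \<Otimes>\<^sub>M PiM {..<n} (\<lambda>_. m))"
    by (intro borel_measurable_prod) auto
  then show ?thesis by (simp add: case_prod_beta)
qed

lemma sets_PiM_m: "sets (PiM {..<n} (\<lambda>_. m)) = sets (PiM {..<n} (\<lambda>_. borel))"
  by (intro sets_PiM_cong) (auto simp: sets_m)

lemma lik_measurable_PiM: "lik n \<in> borel_measurable (PiM {..<n} (\<lambda>_. borel))"
proof -
  have "(\<lambda>(v, x). \<Prod>k<n. \<psi> ((shift ^^ k) x) (v k)) \<in> borel_measurable (PiM {..<n} (\<lambda>_. m) \<Otimes>\<^sub>M \<mu>)"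
    using measurable_pair_swap[OF psi_prod_measurable_pair[of n]] unfolding case_prod_conv .
  then have "(\<lambda>v. \<integral>x. (\<Prod>k<n. \<psi> ((shift ^^ k) x) (v k)) \<partial>\<mu>) \<in> borel_measurable (PiM {..<n} (\<lambda>_. m))"
    by (rule borel_measurable_lebesgue_integral)
  then show ?thesis unfolding lik_def[abs_def] using measurable_cong_sets[OF sets_PiM_m refl] by blast
qed

lemma restrict_measurable: "(\<lambda>y. restrict y {..<n}) \<in> measurable Y (PiM {..<n} (\<lambda>_. borel))"
  by (rule measurable_restrict_subset) auto

text \<open>\<open>lik n\<close> is the density of the law of the first \<open>n\<close>
  observations with respect to the \<open>n\<close>-fold product of \<open>m\<close>: for a fixed
  path the law is a finite product of densities, and Fubini averages over the path.\<close>

lemma nn_integral_PY_prefix: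
  assumes F: "F \<in> borel_measurable (PiM {..<n} (\<lambda>_. borel))"
  shows "(\<integral>\<^sup>+y. F (restrict y {..<n}) \<partial>PY) = (\<integral>\<^sup>+v. F v * ennreal (lik n v) \<partial>PiM {..<n} (\<lambda>_. m))"
proof -
  let ?M = "PiM {..<n} (\<lambda>_. m)"
  interpret M: product_sigma_finite "\<lambda>_. m" by unfold_locales
  interpret pm: pair_sigma_finite ?M \<mu>
    by (rule pair_sigma_finite.intro[OF M.sigma_finite[OF finite_lessThan] sigma_finite_measure_axioms])
  have Fm: "F \<in> borel_measurable ?M"
    using F measurable_cong_sets[OF sets_PiM_m refl] by blast
  let ?p = "\<lambda>x v. \<Prod>k<n. \<psi> ((shift ^^ k) x) (v k)"
  have inner: "(\<integral>\<^sup>+y. F (restrict y {..<n}) \<partial>Px x) = (\<integral>\<^sup>+v. ennreal (?p x v) * F v \<partial>?M)" if x: "x \<in> X" for x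
  proof -
    let ?D = "\<lambda>k. dens ((shift ^^ k) x)"
    interpret D: prob_space "?D k" for k by (rule prob_dens[OF shift_in[OF x]])
    interpret D: product_prob_space ?D UNIV by unfold_locales
    have "(\<lambda>y. restrict y {..<n}) \<in> measurable (PiM UNIV ?D) (PiM {..<n} ?D)"
      by (rule measurable_restrict_subset) auto
    moreover have "F \<in> borel_measurable (PiM {..<n} ?D)"
    proof -
      have "sets (PiM {..<n} ?D) = sets (PiM {..<n} (\<lambda>_. borel))" by (rule sets_PiM_cong) (rule refl sets_dens)+
      from measurable_cong_sets[OF this refl] F show ?thesis by blast
    qed
    ultimately have "(\<integral>\<^sup>+y. F (restrict y {..<n}) \<partial>Px x) = (\<integral>\<^sup>+v. F v \<partial>distr (PiM UNIV ?D) (PiM {..<n} ?D) (\<lambda>y. restrict y {..<n}))"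
      unfolding Px_def by (subst nn_integral_distr) (simp_all only: measurable_distr_eq1)
    also have "distr (PiM UNIV ?D) (PiM {..<n} ?D) (\<lambda>y. restrict y {..<n}) = PiM {..<n} ?D"
      by (rule D.distr_PiM_restrict_finite) auto
    also have "PiM {..<n} ?D = density ?M (\<lambda>v. \<Prod>k<n. ennreal (\<psi> ((shift ^^ k) x) (v k)))"
      unfolding dens_def
    proof (rule density_PiM[OF sigma_finite_m])
      show "(\<lambda>u. ennreal (\<psi> ((shift ^^ i) x) u)) \<in> borel_measurable m" for i
        using measurable_compose[OF psi_measurable[OF shift_in[OF x]] measurable_ennreal]
        by (simp only: measurable_cong_sets[OF sets_m refl])
      show "prob_space (density m (\<lambda>u. ennreal (\<psi> ((shift ^^ i) x) u)))" for i
        using prob_dens[OF shift_in[OF x, of i]] by (simp only: dens_def)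
    qed auto
    also have "(\<lambda>v. \<Prod>k<n. ennreal (\<psi> ((shift ^^ k) x) (v k))) = (\<lambda>v. ennreal (?p x v))"
      using psi_pos[OF shift_in[OF x]] by (intro ext prod_ennreal) (auto simp: less_imp_le)
    also have "(\<integral>\<^sup>+v. F v \<partial>density ?M (\<lambda>v. ennreal (?p x v))) = (\<integral>\<^sup>+v. ennreal (?p x v) * F v \<partial>?M)"
    proof (rule nn_integral_density[OF _ Fm])
      have "(\<lambda>v. ?p x v) \<in> borel_measurable ?M"
        using measurable_compose[OF measurable_Pair1'[of x \<mu> ?M] psi_prod_measurable_pair[of n]] x
        unfolding space_mu case_prod_conv .
      then show "(\<lambda>v. ennreal (?p x v)) \<in> borel_measurable ?M" by (rule measurable_compose[OF _ measurable_ennreal])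
    qed
    finally show ?thesis .
  qed
  have pm2: "(\<lambda>(v, x). ennreal (?p x v) * F v) \<in> borel_measurable (?M \<Otimes>\<^sub>M \<mu>)"
  proof -
    have 1: "(\<lambda>q. ?p (snd q) (fst q)) \<in> borel_measurable (?M \<Otimes>\<^sub>M \<mu>)"
      using measurable_pair_swap[OF psi_prod_measurable_pair[of n]] unfolding case_prod_beta fst_conv snd_conv .
    have 2: "(\<lambda>q. F (fst q)) \<in> borel_measurable (?M \<Otimes>\<^sub>M \<mu>)" by (rule measurable_compose[OF measurable_fst Fm])
    have "(\<lambda>q. ennreal (?p (snd q) (fst q)) * F (fst q)) \<in> borel_measurable (?M \<Otimes>\<^sub>M \<mu>)"
      by (rule borel_measurable_times_ennreal[OF measurable_compose[OF 1 measurable_ennreal] 2])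
    then show ?thesis unfolding case_prod_beta .
  qed
  have "(\<integral>\<^sup>+y. F (restrict y {..<n}) \<partial>PY) = (\<integral>\<^sup>+x. \<integral>\<^sup>+y. F (restrict y {..<n}) \<partial>Px x \<partial>\<mu>)"
    by (rule nn_integral_PY) (rule measurable_compose[OF restrict_measurable F])
  also have "\<dots> = (\<integral>\<^sup>+x. \<integral>\<^sup>+v. ennreal (?p x v) * F v \<partial>?M \<partial>\<mu>)"
    by (intro nn_integral_cong inner) (simp add: space_mu)
  also have "\<dots> = (\<integral>\<^sup>+v. \<integral>\<^sup>+x. ennreal (?p x v) * F v \<partial>\<mu> \<partial>?M)"
    by (rule pm.Fubini'[OF pm2])
  also have "\<dots> = (\<integral>\<^sup>+v. F v * ennreal (lik n v) \<partial>?M)"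
  proof (rule nn_integral_cong)
    fix v :: "nat \<Rightarrow> 'u"
    have "(\<integral>\<^sup>+x. ennreal (?p x v) * F v \<partial>\<mu>) = (\<integral>\<^sup>+x. ennreal (?p x v) \<partial>\<mu>) * F v"
      by (rule nn_integral_multc) (intro measurable_compose[OF prod_psi_measurable measurable_ennreal])
    also have "(\<integral>\<^sup>+x. ennreal (?p x v) \<partial>\<mu>) = ennreal (lik n v)"
      unfolding lik_def using prod_psi_pos by (intro nn_integral_eq_integral prod_psi_integrable AE_I2) (auto simp: space_mu less_imp_le)
    finally show "(\<integral>\<^sup>+x. ennreal (?p x v) * F v \<partial>\<mu>) = F v * ennreal (lik n v)" by (simp add: mult.commute)
  qed
  finally show ?thesis .
qed

end

declare [[simproc del: measurable]]

text \<open>Change of measure: on the event, the density of the second law is at most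
  \<open>1 / c\<close> times that of the first. Restricting to \<open>A\<close> keeps the
  probability of \<open>A\<close> under the first law in the bound, and that is where the
  exponential smallness will enter.\<close>

lemma likelihood_ratio_markov:
  fixes X :: "(int \<Rightarrow> 'a::finite) set" and m :: "'u::polish_space measure"
  assumes h1: "hidden X f1 \<mu>1 P1 K1 B1 N1 m \<psi>1" and h2: "hidden X f2 \<mu>2 P2 K2 B2 N2 m \<psi>2"
    and A: "A \<in> sets (PiM {..<n} (\<lambda>_. borel))" and c: "0 < c"
  shows "measure (hidden.PY \<mu>2 m \<psi>2) {y. restrict y {..<n} \<in> A \<and> c * hidden.lik \<mu>2 \<psi>2 n y \<le> hidden.lik \<mu>1 \<psi>1 n y}
    \<le> measure (hidden.PY \<mu>1 m \<psi>1) {y. restrict y {..<n} \<in> A} / c"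
    (is "measure ?P2 ?S \<le> measure ?P1 ?T / c")
proof -
  interpret h1: hidden X f1 \<mu>1 P1 K1 B1 N1 m \<psi>1 by (rule h1)
  interpret h2: hidden X f2 \<mu>2 P2 K2 B2 N2 m \<psi>2 by (rule h2)
  let ?Q = "PiM {..<n} (\<lambda>_. borel) :: (nat \<Rightarrow> 'u) measure"
  define S' where "S' = {v\<in>space ?Q. v \<in> A \<and> c * h2.lik n v \<le> h1.lik n v}"
  have S'_eq: "S' = A \<inter> {v\<in>space ?Q. c * h2.lik n v \<le> h1.lik n v}" unfolding S'_def by blast
  have S'm: "S' \<in> sets ?Q"
    unfolding S'_eq
    by (rule sets.Int[OF A borel_measurable_le[OF borel_measurable_times[OF borel_measurable_const h2.lik_measurable_PiM] h1.lik_measurable_PiM]])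
  have restr: "restrict y {..<n} \<in> space ?Q" for y by (auto simp: space_PiM)
  have "emeasure ?P2 ?S = (\<integral>\<^sup>+y. indicator S' (restrict y {..<n}) \<partial>?P2)"
  proof -
    have S: "?S = (\<lambda>y. restrict y {..<n}) -` S' \<inter> space h1.Y"
      using restr by (auto simp: S'_def h1.lik_restrict h2.lik_restrict space_PiM)
    then have "?S \<in> sets h1.Y" using measurable_sets[OF h1.restrict_measurable S'm] by simp
    then have "emeasure ?P2 ?S = (\<integral>\<^sup>+y. indicator ?S y \<partial>?P2)" by simp
    also have "\<dots> = (\<integral>\<^sup>+y. indicator S' (restrict y {..<n}) \<partial>?P2)"
      unfolding S by (intro nn_integral_cong) (auto simp: indicator_def space_PiM)
    finally show ?thesis .
  qed
  also have "\<dots> = (\<integral>\<^sup>+v. indicator S' v * ennreal (h2.lik n v) \<partial>PiM {..<n} (\<lambda>_. m))"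
    by (rule h2.nn_integral_PY_prefix[OF borel_measurable_indicator[OF S'm]])
  also have "\<dots> \<le> (\<integral>\<^sup>+v. ennreal (1 / c) * (indicator A v * ennreal (h1.lik n v)) \<partial>PiM {..<n} (\<lambda>_. m))"
  proof (rule nn_integral_mono)
    fix v
    show "indicator S' v * ennreal (h2.lik n v) \<le> ennreal (1 / c) * (indicator A v * ennreal (h1.lik n v))"
    proof (cases "v \<in> S'")
      case True
      then have "h2.lik n v \<le> 1 / c * h1.lik n v" using c by (simp add: S'_def field_simps)
      then have "ennreal (h2.lik n v) \<le> ennreal (1 / c) * ennreal (h1.lik n v)"
        using c h1.lik_pos[of n v] by (subst ennreal_mult'[symmetric]) (auto intro!: ennreal_leI)
      then show ?thesis using True by (simp add: S'_def)
    qed simp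
  qed
  also have "\<dots> = ennreal (1 / c) * (\<integral>\<^sup>+v. indicator A v * ennreal (h1.lik n v) \<partial>PiM {..<n} (\<lambda>_. m))"
  proof (rule nn_integral_cmult)
    have "(\<lambda>v. indicator A v * ennreal (h1.lik n v)) \<in> borel_measurable ?Q"
      by (rule borel_measurable_times_ennreal[OF borel_measurable_indicator[OF A]
          measurable_compose[OF h1.lik_measurable_PiM measurable_ennreal]])
    then show "(\<lambda>v. indicator A v * ennreal (h1.lik n v)) \<in> borel_measurable (PiM {..<n} (\<lambda>_. m))"
      using measurable_cong_sets[OF h1.sets_PiM_m refl] by blast
  qed
  also have "(\<integral>\<^sup>+v. indicator A v * ennreal (h1.lik n v) \<partial>PiM {..<n} (\<lambda>_. m)) = (\<integral>\<^sup>+y. indicator A (restrict y {..<n}) \<partial>?P1)"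
    by (rule h1.nn_integral_PY_prefix[OF borel_measurable_indicator[OF A], symmetric])
  also have "\<dots> = emeasure ?P1 ?T"
  proof -
    have T: "?T = (\<lambda>y. restrict y {..<n}) -` A \<inter> space h1.Y" by (auto simp: space_PiM)
    then have "?T \<in> sets h1.Y" using measurable_sets[OF h1.restrict_measurable A] by simp
    then have "emeasure ?P1 ?T = (\<integral>\<^sup>+y. indicator ?T y \<partial>?P1)" by simp
    also have "\<dots> = (\<integral>\<^sup>+y. indicator A (restrict y {..<n}) \<partial>?P1)"
      by (intro nn_integral_cong) (auto simp: indicator_def)
    finally show ?thesis ..
  qed
  finally have "ennreal (measure ?P2 ?S) \<le> ennreal (1 / c) * ennreal (measure ?P1 ?T)"
    unfolding h1.PY.emeasure_eq_measure h2.PY.emeasure_eq_measure .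
  also have "\<dots> = ennreal (measure ?P1 ?T / c)"
    using c by (subst ennreal_mult'[symmetric]) auto
  finally show ?thesis using c by (subst (asm) ennreal_le_iff) auto
qed

text \<open>Finite-dimensional rectangles determine a law on sequences, so some rectangle has
  different probabilities. Its indicator is a product over a window, and the event that its
  frequency is typical for the second law is exponentially unlikely under the first.\<close>

lemma exponential_separation:
  fixes X :: "(int \<Rightarrow> 'a::finite) set" and m :: "'u::polish_space measure"
  assumes h1: "hidden X f1 \<mu>1 P1 K1 B1 N1 m \<psi>1" and h2: "hidden X f2 \<mu>2 P2 K2 B2 N2 m \<psi>2"
    and ne: "hidden.PY \<mu>1 m \<psi>1 \<noteq> hidden.PY \<mu>2 m \<psi>2"
  shows "\<exists>c>0. AE y in hidden.PY \<mu>2 m \<psi>2. eventually (\<lambda>n.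
    hidden.lik \<mu>1 \<psi>1 n y \<le> exp (- c * real n) * hidden.lik \<mu>2 \<psi>2 n y) sequentially"
proof -
  interpret h1: hidden X f1 \<mu>1 P1 K1 B1 N1 m \<psi>1 by (rule h1)
  interpret h2: hidden X f2 \<mu>2 P2 K2 B2 N2 m \<psi>2 by (rule h2)
  have "\<exists>A J. finite J \<and> (\<forall>i\<in>J. A i \<in> sets borel) \<and>
    emeasure h1.PY (prod_emb UNIV (\<lambda>_. borel) J (Pi\<^sub>E J A)) \<noteq> emeasure h2.PY (prod_emb UNIV (\<lambda>_. borel) J (Pi\<^sub>E J A))"
  proof (rule ccontr)
    assume "\<not> ?thesis"
    then have "h1.PY = h2.PY"
      by (intro measure_eqI_PiM_infinite[where I = UNIV and M = "\<lambda>_. borel"]) (auto intro: h1.PY.finite_measure_axioms)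
    then show False using ne by simp
  qed
  then obtain A :: "nat \<Rightarrow> 'u set" and J where A: "finite J" "\<And>i. i \<in> J \<Longrightarrow> A i \<in> sets borel"
    "emeasure h1.PY (prod_emb UNIV (\<lambda>_. borel) J (Pi\<^sub>E J A)) \<noteq> emeasure h2.PY (prod_emb UNIV (\<lambda>_. borel) J (Pi\<^sub>E J A))"
    by blast
  define w where "w = Suc (Max (insert 0 J))"
  have Jw: "i < w" if "i \<in> J" for i using A(1) that by (simp add: w_def less_Suc_eq_le)
  have w0: "0 < w" by (simp add: w_def)
  \<comment> \<open>Coordinates outside \<open>J\<close> get the factor 1, so that the rectangle
    indicator becomes a product over the full window \<open>0..<w\<close>.\<close>
  define g where "g i u = (if i \<in> J then indicator (A i) u else 1 :: real)" for i u
  have gm: "g i \<in> borel_measurable borel" for i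
    using A(2) by (cases "i \<in> J") (auto simp: g_def[abs_def] intro: borel_measurable_indicator borel_measurable_const)
  have g01: "0 \<le> g i u" "g i u \<le> 1" for i u by (auto simp: g_def indicator_def)
  let ?o = "\<lambda>k y. \<Prod>i<w. g i (y (k + i))"
  let ?E = "prod_emb UNIV (\<lambda>_. borel) J (Pi\<^sub>E J A) :: (nat \<Rightarrow> 'u) set"
  have Em: "?E \<in> sets h1.Y" using A by (intro sets_PiM_I) auto
  have o0: "?o 0 y = indicator ?E y" for y
  proof (cases "\<forall>i\<in>J. y i \<in> A i")
    case True
    then have "?o 0 y = 1" by (intro prod.neutral) (auto simp: g_def)
    then show ?thesis using True by (simp add: prod_emb_def indicator_def PiE_iff)
  next
    case False
    then obtain i where "i \<in> J" "y i \<notin> A i" by blast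
    then have "?o 0 y = 0" using Jw by (intro prod_zero) (auto simp: g_def intro!: bexI[of _ i])
    then show ?thesis using False by (auto simp: prod_emb_def indicator_def PiE_iff)
  qed
  define a1 where "a1 = (\<integral>y. ?o 0 y \<partial>h1.PY)"
  define a2 where "a2 = (\<integral>y. ?o 0 y \<partial>h2.PY)"
  have "a1 = measure h1.PY ?E" "a2 = measure h2.PY ?E"
    unfolding a1_def a2_def o0 Bochner_Integration.integral_indicator by simp_all
  then have "a1 \<noteq> a2" using A(3) unfolding h1.PY.emeasure_eq_measure h2.PY.emeasure_eq_measure by auto
  \<comment> \<open>Half the distance of the means: a frequency within \<epsilon> of
    \<open>a2\<close> is at least \<epsilon> away from \<open>a1\<close>.\<close>
  define \<epsilon> where "\<epsilon> = \<bar>a1 - a2\<bar> / 2"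
  have eps: "0 < \<epsilon>" using \<open>a1 \<noteq> a2\<close> by (simp add: \<epsilon>_def)
  from h1.obs_concentration[where g = g, OF gm g01 w0 eps, folded a1_def]
  obtain C q where Cq: "0 < q" "q < 1" "\<forall>n. h1.PY.prob {y. real n * \<epsilon> \<le> \<bar>(\<Sum>k<n. ?o k y) - real n * a1\<bar>} \<le> C * q^n"
    by (elim exE conjE)
  have AE2: "AE y in h2.PY. eventually (\<lambda>n. \<bar>(\<Sum>k<n. ?o k y) - real n * a2\<bar> < real n * \<epsilon>) sequentially"
    unfolding a2_def by (rule h2.obs_eventually[where g = g, OF gm g01 w0 eps])
  \<comment> \<open>Only half of the rate \<open>- ln q\<close> is claimed for the likelihood ratio,
    so that \<open>q^n\<close> divided by the ratio threshold is still summable.\<close>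
  define c where "c = - ln q / 2"
  have c: "0 < c" using Cq by (simp add: c_def)
  have q: "q = exp (- 2 * c)" using Cq by (simp add: c_def)
  \<comment> \<open>Windows starting below \<open>n\<close> read the coordinates below
    \<open>n + w\<close>; hence likelihoods are compared at \<open>n + w\<close> and the index is
    shifted back at the end.\<close>
  define D where "D n = {v\<in>space (PiM {..<n+w} (\<lambda>_. borel)). \<bar>(\<Sum>k<n. ?o k v) - real n * a2\<bar> < real n * \<epsilon>}" for n
  have Dm: "D n \<in> sets (PiM {..<n+w} (\<lambda>_. borel))" for n
  proof -
    have "(\<lambda>v. ?o k v) \<in> borel_measurable (PiM {..<n+w} (\<lambda>_. borel))" if "k < n" for k
    proof (rule borel_measurable_prod)
      fix i assume "i \<in> {..<w}"
      then have "(\<lambda>v. v (k + i)) \<in> measurable (PiM {..<n+w} (\<lambda>_. borel)) (borel :: 'u measure)"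
        using that by (intro measurable_component_singleton[of _ _ "\<lambda>_. borel"]) auto
      from measurable_compose[OF this gm[of i]]
      show "(\<lambda>v. g i (v (k + i))) \<in> borel_measurable (PiM {..<n+w} (\<lambda>_. borel))" .
    qed
    then have "(\<lambda>v. \<Sum>k<n. ?o k v) \<in> borel_measurable (PiM {..<n+w} (\<lambda>_. borel))"
      by (intro borel_measurable_sum) auto
    then show ?thesis unfolding D_def by measurable
  qed
  have oD: "restrict y {..<n+w} \<in> D n \<longleftrightarrow> \<bar>(\<Sum>k<n. ?o k y) - real n * a2\<bar> < real n * \<epsilon>" for y n
  proof -
    have "(\<Sum>k<n. ?o k (restrict y {..<n+w})) = (\<Sum>k<n. ?o k y)"
      by (intro sum.cong prod.cong refl) auto
    then show ?thesis by (auto simp: D_def space_PiM)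
  qed
  let ?S = "\<lambda>n. {y. restrict y {..<n+w} \<in> D n \<and> exp (- c * real (n + w)) * h2.lik (n + w) y \<le> h1.lik (n + w) y}"
  have Sm: "?S n \<in> sets h1.Y" for n
  proof -
    let ?Q = "PiM {..<n+w} (\<lambda>_. borel) :: (nat \<Rightarrow> 'u) measure"
    have "{v\<in>space ?Q. exp (- c * real (n + w)) * h2.lik (n + w) v \<le> h1.lik (n + w) v} \<in> sets ?Q"
      by (rule borel_measurable_le[OF borel_measurable_times[OF borel_measurable_const h2.lik_measurable_PiM] h1.lik_measurable_PiM])
    then have "D n \<inter> {v\<in>space ?Q. exp (- c * real (n + w)) * h2.lik (n + w) v \<le> h1.lik (n + w) v} \<in> sets ?Q"
      by (rule sets.Int[OF Dm])
    from measurable_sets[OF h1.restrict_measurable this] show ?thesis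
      by (rule back_subst[where P = "\<lambda>A. A \<in> sets h1.Y"]) (auto simp: h1.lik_restrict h2.lik_restrict space_PiM)
  qed
  have bound: "h2.PY.prob (?S n) \<le> C * exp (c * real w) * exp (- c)^n" for n
  proof -
    have b1: "h2.PY.prob (?S n) \<le> h1.PY.prob {y. restrict y {..<n+w} \<in> D n} / exp (- c * real (n + w))"
      by (rule likelihood_ratio_markov[OF h1 h2 Dm]) simp
    have "h1.PY.prob {y. restrict y {..<n+w} \<in> D n} \<le> h1.PY.prob {y. real n * \<epsilon> \<le> \<bar>(\<Sum>k<n. ?o k y) - real n * a1\<bar>}"
    proof (rule h1.PY.finite_measure_mono)
      show "{y. restrict y {..<n+w} \<in> D n} \<subseteq> {y. real n * \<epsilon> \<le> \<bar>(\<Sum>k<n. ?o k y) - real n * a1\<bar>}"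
      proof
        fix y assume "y \<in> {y. restrict y {..<n+w} \<in> D n}"
        then have 1: "\<bar>(\<Sum>k<n. ?o k y) - real n * a2\<bar> < real n * \<epsilon>" by (simp add: oD)
        have "\<bar>real n * a1 - real n * a2\<bar> = real n * \<epsilon> + real n * \<epsilon>"
          by (simp add: \<epsilon>_def right_diff_distrib[symmetric] abs_mult)
        then show "y \<in> {y. real n * \<epsilon> \<le> \<bar>(\<Sum>k<n. ?o k y) - real n * a1\<bar>}" using 1 unfolding mem_Collect_eq by linarith
      qed
      have "(\<lambda>y. ?o k y) \<in> borel_measurable h1.Y" for k by (rule h1.obs_measurable[where g = g, OF gm g01])
      then have "(\<lambda>y. \<Sum>k<n. ?o k y) \<in> borel_measurable h1.Y" by (intro borel_measurable_sum) auto
      then have "{y\<in>space h1.Y. real n * \<epsilon> \<le> \<bar>(\<Sum>k<n. ?o k y) - real n * a1\<bar>} \<in> sets h1.Y" by measurable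
      then show "{y. real n * \<epsilon> \<le> \<bar>(\<Sum>k<n. ?o k y) - real n * a1\<bar>} \<in> sets h1.PY" by (simp add: space_PiM)
    qed
    also have "\<dots> \<le> C * q^n" using Cq by blast
    finally have b2: "h1.PY.prob {y. restrict y {..<n+w} \<in> D n} \<le> C * q^n" .
    have b3: "q^n / exp (- c * real (n + w)) = exp (c * real w) * exp (- c)^n"
      by (simp add: q exp_of_nat_mult[symmetric] exp_add[symmetric] exp_diff[symmetric] algebra_simps)
    note b1
    also have "h1.PY.prob {y. restrict y {..<n+w} \<in> D n} / exp (- c * real (n + w)) \<le> C * q^n / exp (- c * real (n + w))"
      by (rule divide_right_mono[OF b2]) simp
    also have "\<dots> = C * (exp (c * real w) * exp (- c)^n)" unfolding b3[symmetric] by simp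
    finally show ?thesis unfolding mult.assoc .
  qed
  have "AE y in h2.PY. eventually (\<lambda>n. y \<in> space h2.PY - ?S n) sequentially"
  proof (rule borel_cantelli_AE1)
    show "?S n \<in> sets h2.PY" for n unfolding h2.sets_PY by (rule Sm)
    show "emeasure h2.PY (?S n) < \<infinity>" for n unfolding h2.PY.emeasure_eq_measure by simp
    show "summable (\<lambda>n. h2.PY.prob (?S n))"
    proof (rule summable_comparison_test'[where g = "\<lambda>n. C * exp (c * real w) * exp (- c)^n" and N = 0])
      show "summable (\<lambda>n. C * exp (c * real w) * exp (- c)^n)"
        using c by (intro summable_mult summable_geometric) simp
    qed (use bound in simp)
  qed
  then have "AE y in h2.PY. eventually (\<lambda>n. h1.lik n y \<le> exp (- c * real n) * h2.lik n y) sequentially"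
    using AE2
  proof eventually_elim
    case (elim y)
    then have "eventually (\<lambda>n. h1.lik (n + w) y \<le> exp (- c * real (n + w)) * h2.lik (n + w) y) sequentially"
    proof eventually_elim
      case (elim n)
      then show ?case using oD[of y n] by auto
    qed
    then show ?case by (rule eventually_sequentially_seg[THEN iffD1])
  qed
  then show ?thesis using c by blast
qed

section \<open>Comparison of parameters\<close>

text \<open>Both measures are estimated at one common point of the cylinder, from above for the
  first and from below for the second, at the price of one Gibbs constant each.\<close>

lemma gibbs_word_le:
  assumes 1: "gibbs X f1 \<mu>1 P1 K1 B1 N1" and 2: "gibbs X f2 \<mu>2 P2 K2 B2 N2"
    and le: "\<And>x. x \<in> X \<Longrightarrow> f1 x \<le> f2 x + \<eta>"
  shows "gibbs.cw X \<mu>1 v \<le> K1 * K2 * exp (real (length v) * (\<eta> + P2 - P1)) * gibbs.cw X \<mu>2 v"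
proof -
  interpret A: gibbs X f1 \<mu>1 P1 K1 B1 N1 by (rule 1)
  interpret B: gibbs X f2 \<mu>2 P2 K2 B2 N2 by (rule 2)
  let ?n = "length v"
  show ?thesis
  proof (cases "A.cw v = 0")
    case True
    then show ?thesis using B.cw_nonneg[of v] A.K_ge1 B.K_ge1 by simp
  next
    case False
    then obtain x where x: "x \<in> X" "word x ?n = v" using A.cw_pos_ex by blast
    have "birkhoff_sum f1 ?n x \<le> (\<Sum>k<?n. f2 ((shift ^^ k) x) + \<eta>)"
      unfolding birkhoff_sum_def by (intro sum_mono le A.shift_in x)
    then have S: "birkhoff_sum f1 ?n x \<le> birkhoff_sum f2 ?n x + real ?n * \<eta>"
      by (simp add: birkhoff_sum_def sum.distrib)
    have "A.cw v \<le> K1 * exp (birkhoff_sum f1 ?n x - real ?n * P1)"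
      using A.cyl_le[OF x(1), of ?n] A.cw_word[OF x(1), of ?n] x(2) by simp
    also have "\<dots> \<le> K1 * exp (real ?n * (\<eta> + P2 - P1) + (birkhoff_sum f2 ?n x - real ?n * P2))"
      using S A.K_ge1 by (intro mult_left_mono) (auto simp: algebra_simps)
    also have "\<dots> = K1 * (exp (real ?n * (\<eta> + P2 - P1)) * exp (birkhoff_sum f2 ?n x - real ?n * P2))"
      by (simp only: exp_add)
    also have "\<dots> \<le> K1 * (exp (real ?n * (\<eta> + P2 - P1)) * (K2 * B.cw v))"
      using B.cyl_ge[OF x(1), of ?n] B.cw_word[OF x(1), of ?n] x(2) A.K_ge1 by (intro mult_left_mono) auto
    finally show ?thesis by (simp add: mult_ac)
  qed
qed

text \<open>Summing the word comparison over all words of length \<open>n\<close> gives 1 on the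
  left and \<open>K1 * K2 * exp (n * (\<eta> + P2 - P1))\<close> on the right; if the exponent were
  negative this would fail for large \<open>n\<close>.\<close>

lemma gibbs_pressure_le:
  assumes 1: "gibbs X f1 \<mu>1 P1 K1 B1 N1" and 2: "gibbs X f2 \<mu>2 P2 K2 B2 N2"
    and le: "\<And>x. x \<in> X \<Longrightarrow> f1 x \<le> f2 x + \<eta>"
  shows "P1 \<le> P2 + \<eta>"
proof (rule ccontr)
  interpret A: gibbs X f1 \<mu>1 P1 K1 B1 N1 by (rule 1)
  interpret B: gibbs X f2 \<mu>2 P2 K2 B2 N2 by (rule 2)
  assume "\<not> P1 \<le> P2 + \<eta>"
  then have d: "0 < P1 - P2 - \<eta>" by simp
  have "1 \<le> K1 * K2 * exp (real n * (\<eta> + P2 - P1))" for n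
  proof -
    have "(\<Sum>v | length v = n. A.cw v) \<le> (\<Sum>v | length v = n. K1 * K2 * exp (real n * (\<eta> + P2 - P1)) * B.cw v)"
      using gibbs_word_le[OF 1 2 le] by (intro sum_mono) auto
    then show ?thesis by (simp add: A.sum_cw B.sum_cw flip: sum_distrib_left)
  qed
  then have "exp (real n * (P1 - P2 - \<eta>)) \<le> K1 * K2" for n
  proof -
    have "exp (real n * (P1 - P2 - \<eta>)) * 1 \<le> exp (real n * (P1 - P2 - \<eta>)) * (K1 * K2 * exp (real n * (\<eta> + P2 - P1)))"
      using \<open>\<And>n. 1 \<le> K1 * K2 * exp (real n * (\<eta> + P2 - P1))\<close> by (intro mult_left_mono) auto
    also have "\<dots> = K1 * K2 * exp (real n * (P1 - P2 - \<eta>) + real n * (\<eta> + P2 - P1))"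
      unfolding exp_add by (simp only: mult_ac)
    also have "\<dots> = K1 * K2" by (simp add: algebra_simps)
    finally show ?thesis by simp
  qed
  then have bd: "real n * (P1 - P2 - \<eta>) \<le> ln (K1 * K2)" for n
    using A.K_ge1 B.K_ge1 by (subst ln_ge_iff) auto
  obtain n :: nat where "ln (K1 * K2) < real n * (P1 - P2 - \<eta>)"
    using reals_Archimedean3[OF d] by blast
  then show False using bd[of n] by simp
qed

text \<open>The emission factor \<rho> is paid twice: to replace \<psi>1 at a path by \<psi>2 at the
  representative of its word, and, after exchanging the measures of words, to return from the
  representative to paths drawn from \<mu>2. The rate \<eta> is also paid twice: for the potentials
  and for the pressures.\<close>

lemma likelihood_le:
  fixes X :: "(int \<Rightarrow> 'a::finite) set" and m :: "'u::polish_space measure"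
  assumes h1: "hidden X f1 \<mu>1 P1 K1 B1 N1 m \<psi>1" and h2: "hidden X f2 \<mu>2 P2 K2 B2 N2 m \<psi>2"
    and close: "\<And>x. x \<in> X \<Longrightarrow> \<bar>f1 x - f2 x\<bar> \<le> \<eta>"
    and r12: "\<And>x x' u. x \<in> X \<Longrightarrow> x' \<in> X \<Longrightarrow> dX x x' \<le> 2 powr (- real j) \<Longrightarrow> \<psi>1 x u \<le> exp (\<rho> u) * \<psi>2 x' u"
    and r22: "\<And>x x' u. x \<in> X \<Longrightarrow> x' \<in> X \<Longrightarrow> dX x x' \<le> 2 powr (- real j) \<Longrightarrow> \<psi>2 x u \<le> exp (\<rho> u) * \<psi>2 x' u"
  shows "hidden.lik \<mu>1 \<psi>1 n u \<le>
    K1 * K2 * exp (2 * \<eta> * real (n + 2 * j)) * exp (2 * (\<Sum>k<n. \<rho> (u k))) * hidden.lik \<mu>2 \<psi>2 n u"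
proof -
  interpret h1: hidden X f1 \<mu>1 P1 K1 B1 N1 m \<psi>1 by (rule h1)
  interpret h2: hidden X f2 \<mu>2 P2 K2 B2 N2 m \<psi>2 by (rule h2)
  have g1: "gibbs X f1 \<mu>1 P1 K1 B1 N1" and g2: "gibbs X f2 \<mu>2 P2 K2 B2 N2" by unfold_locales
  \<comment> \<open>After a shift by \<open>j\<close>, the windows of radius \<open>j\<close> around
    the times \<open>0..<n\<close> lie in the coordinates \<open>0..<L\<close>.\<close>
  define L where "L = n + 2 * j"
  define R where "R = (\<Sum>k<n. \<rho> (u k))"
  define F1 where "F1 x = (\<Prod>k<n. \<psi>1 ((shift ^^ k) x) (u k))" for x
  define F2 where "F2 x = (\<Prod>k<n. \<psi>2 ((shift ^^ k) x) (u k))" for x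
  have F1m: "F1 \<in> borel_measurable \<mu>1" unfolding F1_def[abs_def] by (rule h1.prod_psi_measurable)
  have F2m: "F2 \<in> borel_measurable \<mu>2" unfolding F2_def[abs_def] by (rule h2.prod_psi_measurable)
  have lik1: "h1.lik n u = h1.expectation (\<lambda>x. F1 ((shift ^^ j) x))"
    unfolding h1.lik_def F1_def[symmetric] by (rule h1.expectation_shift[OF F1m, symmetric])
  have lik2: "h2.lik n u = h2.expectation (\<lambda>x. F2 ((shift ^^ j) x))"
    unfolding h2.lik_def F2_def[symmetric] by (rule h2.expectation_shift[OF F2m, symmetric])
  have i1: "integrable \<mu>1 (\<lambda>x. F1 ((shift ^^ j) x))"
    by (rule integrable_distr[OF h1.funpow_shift_measurable])
      (unfold h1.distr_funpow_shift F1_def, rule h1.prod_psi_integrable)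
  have i2: "integrable \<mu>2 (\<lambda>x. F2 ((shift ^^ j) x))"
    by (rule integrable_distr[OF h2.funpow_shift_measurable])
      (unfold h2.distr_funpow_shift F2_def, rule h2.prod_psi_integrable)
  have near: "dX ((shift ^^ k) ((shift ^^ j) x)) ((shift ^^ k) ((shift ^^ j) z)) \<le> 2 powr (- real j)"
    if "word x L = word z L" "k < n" for x z :: "int \<Rightarrow> 'a" and k
  proof (rule dX_le)
    fix i :: int assume i: "nat \<bar>i\<bar> < j"
    have "nat (i + int k + int j) < L" "int (nat (i + int k + int j)) = i + int k + int j"
      using i that(2) unfolding L_def by linarith+
    then have "x (i + int k + int j) = z (i + int k + int j)" using that(1) unfolding word_eq_iff by metis
    then show "(shift ^^ k) ((shift ^^ j) x) i = (shift ^^ k) ((shift ^^ j) z) i" by (simp add: shift_funpow)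
  qed
  have prodR: "(\<Prod>k<n. exp (\<rho> (u k)) * c k) = exp R * (\<Prod>k<n. c k)" for c
    by (simp add: prod.distrib R_def exp_sum)
  have le12: "F1 ((shift ^^ j) x) \<le> exp R * F2 ((shift ^^ j) z)"
    if "x \<in> X" "z \<in> X" "word x L = word z L" for x z
    unfolding F1_def F2_def prodR[symmetric]
    using that near[OF that(3)] h1.psi_pos
    by (intro prod_mono conjI r12 h1.shift_in less_imp_le[OF h1.psi_pos]) auto
  have le22: "F2 ((shift ^^ j) x) \<le> exp R * F2 ((shift ^^ j) z)"
    if "x \<in> X" "z \<in> X" "word x L = word z L" for x z
    unfolding F2_def prodR[symmetric]
    using that near[OF that(3)]
    by (intro prod_mono conjI r22 h1.shift_in less_imp_le[OF h2.psi_pos]) auto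
  define rep where "rep v = (SOME z. z \<in> X \<and> word z L = v)" for v
  have rep: "rep (word x L) \<in> X" "word (rep (word x L)) L = word x L" if "x \<in> X" for x
    using someI_ex[of "\<lambda>z. z \<in> X \<and> word z L = word x L"] that unfolding rep_def by blast+
  \<comment> \<open>For words not occurring in \<open>X\<close> the representative is arbitrary; the
    value 0 keeps \<open>b\<close> nonnegative.\<close>
  define b where "b v = (if v \<in> (\<lambda>x. word x L) ` X then F2 ((shift ^^ j) (rep v)) else 0)" for v
  have b0: "0 \<le> b v" for v
    using h2.prod_psi_pos[OF h2.shift_in[OF rep(1)]] by (auto simp: b_def F2_def intro: less_imp_le)
  define \<kappa> where "\<kappa> = K1 * K2 * exp (2 * \<eta> * real L)"
  have kap: "h1.cw v \<le> \<kappa> * h2.cw v" if "length v = L" for v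
  proof -
    have c1: "f1 x \<le> f2 x + \<eta>" "f2 x \<le> f1 x + \<eta>" if "x \<in> X" for x using close[OF that] by linarith+
    have "P2 \<le> P1 + \<eta>" by (rule gibbs_pressure_le[OF g2 g1 c1(2)])
    then have "real L * (\<eta> + P2 - P1) \<le> real L * (2 * \<eta>)" by (intro mult_left_mono) auto
    then have "exp (real L * (\<eta> + P2 - P1)) \<le> exp (2 * \<eta> * real L)" by (simp add: mult.commute)
    then have "K1 * K2 * exp (real L * (\<eta> + P2 - P1)) * h2.cw v \<le> \<kappa> * h2.cw v"
      unfolding \<kappa>_def using h1.K_ge1 h2.K_ge1 by (intro mult_right_mono mult_left_mono h2.cw_nonneg) auto
    then show ?thesis using gibbs_word_le[OF g1 g2 c1(1), of v] that by simp
  qed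
  have kap0: "0 \<le> \<kappa>" using h1.K_ge1 h2.K_ge1 by (simp add: \<kappa>_def)
  have "h1.lik n u \<le> h1.expectation (\<lambda>x. exp R * b (word x L))"
    unfolding lik1
  proof (rule integral_mono[OF i1 h1.integrable_word])
    fix x assume "x \<in> space \<mu>1"
    then have x: "x \<in> X" by (simp add: h1.space_mu)
    show "F1 ((shift ^^ j) x) \<le> exp R * b (word x L)"
      using le12[OF x rep(1)[OF x]] rep(2)[OF x] x by (simp add: b_def)
  qed
  also have "\<dots> = exp R * (\<Sum>v | length v = L. b v * h1.cw v)"
    using h1.expectation_word[of "\<lambda>v. exp R * b v" L] by (simp add: sum_distrib_left mult.assoc)
  also have "\<dots> \<le> exp R * (\<Sum>v | length v = L. b v * (\<kappa> * h2.cw v))"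
    using kap b0 by (intro mult_left_mono sum_mono) auto
  also have "\<dots> = exp R * \<kappa> * (\<Sum>v | length v = L. b v * h2.cw v)"
    by (simp add: sum_distrib_left mult_ac)
  also have "(\<Sum>v | length v = L. b v * h2.cw v) = h2.expectation (\<lambda>x. b (word x L))"
    by (rule h2.expectation_word[symmetric])
  also have "exp R * \<kappa> * \<dots> \<le> exp R * \<kappa> * h2.expectation (\<lambda>x. exp R * F2 ((shift ^^ j) x))"
  proof (intro mult_left_mono integral_mono h2.integrable_word integrable_mult_right i2)
    fix x assume "x \<in> space \<mu>2"
    then have x: "x \<in> X" by (simp add: h2.space_mu)
    show "b (word x L) \<le> exp R * F2 ((shift ^^ j) x)"
      using le22[OF rep(1)[OF x] x] rep(2)[OF x] x by (simp add: b_def)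
  qed (use kap0 in auto)
  also have "\<dots> = \<kappa> * (exp R * exp R) * h2.lik n u" by (simp add: lik2)
  also have "exp R * exp R = exp (2 * R)" by (simp add: exp_add[symmetric])
  finally show ?thesis by (simp add: \<kappa>_def L_def R_def)
qed

text \<open>At time \<open>k\<close> two paths with a common word on \<open>0..<n\<close> agree up
  to the nearer end of the word. In a two-sided space both ends contribute, whence two geometric
  series and the factor 2; the bound does not depend on \<open>n\<close>.\<close>

lemma birkhoff_variation:
  assumes tr: "\<And>x k. x \<in> X \<Longrightarrow> (\<lambda>i. x (i + k)) \<in> X"
    and H: "\<And>x y. x \<in> X \<Longrightarrow> y \<in> X \<Longrightarrow> \<bar>f x - f y\<bar> \<le> H * dX x y powr r" and r: "0 < r" and H0: "0 \<le> H"
    and xy: "x \<in> X" "y \<in> X" "word x n = word y n"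
  shows "\<bar>birkhoff_sum f n x - birkhoff_sum f n y\<bar> \<le> 2 * H / (1 - 2 powr (- r))"
proof -
  define q :: real where "q = 2 powr (- r)"
  have q: "0 < q" "q < 1" using r powr_less_mono[of "- r" 0 "2::real"] by (auto simp: q_def)
  have in_X: "(shift ^^ k) z \<in> X" if "z \<in> X" for k z using tr[OF that] by (simp add: shift_funpow)
  have trm: "\<bar>f ((shift ^^ k) x) - f ((shift ^^ k) y)\<bar> \<le> H * (q^k + q^(n - Suc k))" if k: "k < n" for k
  proof -
    \<comment> \<open>Coordinates at distance less than \<open>j\<close> from \<open>k\<close> are
      still in \<open>0..<n\<close>: there are \<open>k\<close> of them to the left of
      \<open>k\<close> and \<open>n - k - 1\<close> to the right.\<close>
    define j where "j = min (Suc k) (n - k)"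
    have "dX ((shift ^^ k) x) ((shift ^^ k) y) \<le> 2 powr (- real j)"
    proof (rule dX_le)
      fix i :: int assume i: "nat \<bar>i\<bar> < j"
      have "nat (i + int k) < n" "int (nat (i + int k)) = i + int k" using i k unfolding j_def by linarith+
      then have "x (i + int k) = y (i + int k)" using xy(3) unfolding word_eq_iff by metis
      then show "(shift ^^ k) x i = (shift ^^ k) y i" by (simp add: shift_funpow)
    qed
    then have "dX ((shift ^^ k) x) ((shift ^^ k) y) powr r \<le> (2 powr (- real j)) powr r"
      using r by (intro powr_mono2) (auto simp: dX_nonneg)
    also have "\<dots> = q powr real j" by (simp add: q_def powr_powr mult.commute)
    also have "\<dots> = q^j" using q by (simp add: powr_realpow)
    also have "\<dots> \<le> q^k + q^(n - Suc k)"
    proof (cases "Suc k \<le> n - k")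
      case True
      then have "q^j \<le> q^k" using q by (intro power_decreasing) (auto simp: j_def)
      then show ?thesis using q by (simp add: add_increasing2)
    next
      case False
      then have "q^j \<le> q^(n - Suc k)" using q by (intro power_decreasing) (auto simp: j_def)
      then show ?thesis using q by (simp add: add_increasing)
    qed
    finally have d: "dX ((shift ^^ k) x) ((shift ^^ k) y) powr r \<le> q^k + q^(n - Suc k)" .
    have "\<bar>f ((shift ^^ k) x) - f ((shift ^^ k) y)\<bar> \<le> H * dX ((shift ^^ k) x) ((shift ^^ k) y) powr r"
      by (intro H in_X xy)
    also have "\<dots> \<le> H * (q^k + q^(n - Suc k))" by (rule mult_left_mono[OF d H0])
    finally show ?thesis .
  qed
  have geo: "(\<Sum>k<n. q^k) \<le> 1 / (1 - q)"
  proof -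
    have "(\<Sum>k<n. q^k) = (1 - q^n) / (1 - q)" using q by (simp add: sum_gp_strict)
    also have "\<dots> \<le> 1 / (1 - q)" using q by (intro divide_right_mono) auto
    finally show ?thesis .
  qed
  have "\<bar>birkhoff_sum f n x - birkhoff_sum f n y\<bar> \<le> (\<Sum>k<n. \<bar>f ((shift ^^ k) x) - f ((shift ^^ k) y)\<bar>)"
    unfolding birkhoff_sum_def sum_subtractf[symmetric] by (rule sum_abs)
  also have "\<dots> \<le> (\<Sum>k<n. H * (q^k + q^(n - Suc k)))" by (intro sum_mono trm) auto
  also have "\<dots> = H * ((\<Sum>k<n. q^k) + (\<Sum>k<n. q^(n - Suc k)))" by (simp add: sum_distrib_left[symmetric] sum.distrib)
  also have "(\<Sum>k<n. q^(n - Suc k)) = (\<Sum>k<n. q^k)" by (rule sum.nat_diff_reindex)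
  also have "H * ((\<Sum>k<n. q^k) + (\<Sum>k<n. q^k)) \<le> H * (1 / (1 - q) + 1 / (1 - q))"
    using geo H0 by (intro mult_left_mono add_mono) auto
  finally show ?thesis by (simp add: q_def mult.commute)
qed

text \<open>Hoelder continuity of both functions makes the two sets bounded above, so that their
  real suprema dominate the elements. Containing 0, both suprema are nonnegative, and each is
  therefore bounded by the norm.\<close>

lemma holder_norm_bounds:
  assumes g: "holder r X g1" "holder r X g2" and le: "holder_norm r X (\<lambda>x. g1 x - g2 x) \<le> \<epsilon>"
  shows "x \<in> X \<Longrightarrow> \<bar>g1 x - g2 x\<bar> \<le> \<epsilon>"
    and "x \<in> X \<Longrightarrow> y \<in> X \<Longrightarrow> \<bar>(g1 x - g2 x) - (g1 y - g2 y)\<bar> \<le> \<epsilon> * dX x y powr r"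
proof -
  let ?g = "\<lambda>x. g1 x - g2 x"
  let ?A = "insert 0 ((\<lambda>x. \<bar>?g x\<bar>) ` X)"
  let ?B = "insert 0 ((\<lambda>(x, y). \<bar>?g x - ?g y\<bar> / dX x y powr r) ` {(x, y). x \<in> X \<and> y \<in> X \<and> x \<noteq> y})"
  obtain b1 b2 where b: "\<And>x. x \<in> X \<Longrightarrow> \<bar>g1 x\<bar> \<le> b1" "\<And>x. x \<in> X \<Longrightarrow> \<bar>g2 x\<bar> \<le> b2"
    using g unfolding holder_def by metis
  obtain H1 H2 where H: "\<And>x y. x \<in> X \<Longrightarrow> y \<in> X \<Longrightarrow> \<bar>g1 x - g1 y\<bar> \<le> H1 * dX x y powr r"
    "\<And>x y. x \<in> X \<Longrightarrow> y \<in> X \<Longrightarrow> \<bar>g2 x - g2 y\<bar> \<le> H2 * dX x y powr r"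
    using g unfolding holder_def by blast
  have pos: "0 < dX x y powr r" if "x \<noteq> y" for x y using that by (simp add: dX_def)
  have bA: "bdd_above ?A"
  proof (rule bdd_aboveI[of _ "\<bar>b1\<bar> + \<bar>b2\<bar>"])
    fix a assume "a \<in> ?A"
    then show "a \<le> \<bar>b1\<bar> + \<bar>b2\<bar>" using b by (force simp: abs_le_iff)
  qed
  have ratio: "\<bar>?g x - ?g y\<bar> / dX x y powr r \<le> \<bar>H1\<bar> + \<bar>H2\<bar>" if "x \<in> X" "y \<in> X" "x \<noteq> y" for x y
  proof -
    have "\<bar>?g x - ?g y\<bar> \<le> (H1 + H2) * dX x y powr r"
      using H(1)[OF that(1,2)] H(2)[OF that(1,2)] by (simp add: distrib_right)
    also have "\<dots> \<le> (\<bar>H1\<bar> + \<bar>H2\<bar>) * dX x y powr r" by (intro mult_right_mono) auto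
    finally show ?thesis using pos[OF that(3)] by (simp add: divide_le_eq)
  qed
  have bB: "bdd_above ?B"
    by (rule bdd_aboveI[of _ "\<bar>H1\<bar> + \<bar>H2\<bar>"]) (use ratio in auto)
  have A0: "0 \<le> Sup ?A" using bA by (intro cSup_upper) auto
  have B0: "0 \<le> Sup ?B" using bB by (intro cSup_upper) auto
  have AB: "Sup ?A \<le> \<epsilon>" "Sup ?B \<le> \<epsilon>" using le A0 B0 unfolding holder_norm_def by linarith+
  show "\<bar>g1 x - g2 x\<bar> \<le> \<epsilon>" if "x \<in> X"
    using cSup_upper[of "\<bar>?g x\<bar>" ?A] bA that AB(1) by auto
  show "\<bar>(g1 x - g2 x) - (g1 y - g2 y)\<bar> \<le> \<epsilon> * dX x y powr r" if "x \<in> X" "y \<in> X"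
  proof (cases "x = y")
    case False
    have "\<bar>?g x - ?g y\<bar> / dX x y powr r \<le> Sup ?B" using False that bB by (intro cSup_upper) auto
    then have "\<bar>?g x - ?g y\<bar> / dX x y powr r \<le> \<epsilon>" using AB(2) by linarith
    then show ?thesis using pos[OF False] by (simp add: divide_le_eq)
  qed (simp add: dX_def)
qed

text \<open>The case \<open>n = 0\<close> is supplied: the cylinder is then all of \<open>X\<close>
  and the Birkhoff sum is empty, so the estimates reduce to \<open>1 \<le> K\<close>. That follows
  because some quotient lies between \<open>inverse K\<close> and \<open>K\<close>.\<close>

lemma gibbs_of_invariant:
  fixes X :: "(int \<Rightarrow> 'a::finite) set"
  assumes inv: "invariant_gibbs X f \<mu>"
    and tr: "\<And>x k. x \<in> X \<Longrightarrow> (\<lambda>i. x (i + k)) \<in> X"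
    and glue: "\<And>x y. x \<in> X \<Longrightarrow> y \<in> X \<Longrightarrow> \<exists>z\<in>X. (\<forall>i<0. z i = x i) \<and> (\<forall>i\<ge>0. z (i + int N) = y i)"
    and bd: "\<And>x. x \<in> X \<Longrightarrow> \<bar>f x\<bar> \<le> Bf"
  shows "\<exists>K. gibbs X f \<mu> (pressure X f) K Bf N"
proof -
  interpret prob_space \<mu> using inv by (simp add: invariant_gibbs_def)
  have sp: "space \<mu> = X" and st: "sets \<mu> = sets (hidden_space X)" and iv: "distr \<mu> \<mu> shift = \<mu>"
    using inv by (auto simp: invariant_gibbs_def)
  obtain K where K: "0 < K" "\<And>x m. x \<in> X \<Longrightarrow> m \<ge> 1 \<Longrightarrow>
      inverse K \<le> measure \<mu> (cylinder X x m) / exp (- real m * pressure X f + birkhoff_sum f m x) \<and>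
      measure \<mu> (cylinder X x m) / exp (- real m * pressure X f + birkhoff_sum f m x) \<le> K"
    using inv unfolding invariant_gibbs_def by blast
  obtain x0 where "x0 \<in> X" using not_empty sp by blast
  then have "inverse K \<le> K" using K(2)[of x0 1] by linarith
  then have "1 \<le> K * K" using K(1) by (simp add: field_simps)
  have K1: "1 \<le> K"
  proof (rule ccontr)
    assume "\<not> 1 \<le> K"
    then have "K * K < 1 * 1" using K(1) by (intro mult_strict_mono) auto
    then show False using \<open>1 \<le> K * K\<close> by simp
  qed
  have zero: "measure \<mu> (cylinder X x 0) = 1" for x
    using prob_space sp by (simp add: cylinder_def word_def)
  have e: "exp (- real m * pressure X f + birkhoff_sum f m x) = exp (birkhoff_sum f m x - real m * pressure X f)" for m x
    by (simp add: algebra_simps)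
  have "gibbs X f \<mu> (pressure X f) K Bf N"
  proof unfold_locales
    fix x n assume x: "x \<in> X"
    have "measure \<mu> (cylinder X x n) \<le> K * exp (birkhoff_sum f n x - real n * pressure X f) \<and>
      exp (birkhoff_sum f n x - real n * pressure X f) \<le> K * measure \<mu> (cylinder X x n)"
    proof (cases "n = 0")
      case True
      then show ?thesis using zero[of x] K1 by (simp add: birkhoff_sum_def)
    next
      case False
      then have "inverse K \<le> measure \<mu> (cylinder X x n) / exp (birkhoff_sum f n x - real n * pressure X f)"
        "measure \<mu> (cylinder X x n) / exp (birkhoff_sum f n x - real n * pressure X f) \<le> K"
        using K(2)[OF x, of n] unfolding e by auto
      then show ?thesis using K(1) by (simp add: field_simps)
    qed
    then show "measure \<mu> (cylinder X x n) \<le> K * exp (birkhoff_sum f n x - real n * pressure X f)"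
      "exp (birkhoff_sum f n x - real n * pressure X f) \<le> K * measure \<mu> (cylinder X x n)" by blast+
  qed (use sp st iv tr glue bd K1 in auto)
  then show ?thesis by blast
qed

section \<open>Posterior consistency\<close>

lemma abs_one_minus_exp_le: "\<bar>1 - exp t\<bar> \<le> exp \<bar>t\<bar> - (1 :: real)"
proof (cases "0 \<le> t")
  case False
  then have t: "\<bar>t\<bar> = - t" "exp t < 1" by simp_all
  have "1 + t \<le> exp t" "1 + - t \<le> exp (- t)" by (rule exp_ge_add_one_self)+
  then show ?thesis unfolding t(1) using t(2) by linarith
qed auto

text \<open>With \<open>t\<close> the difference of the two values of \<open>l\<close>, the density
  difference is \<psi> times \<open>1 - exp t\<close>, and \<open>t\<close> is at most \<eta> times
  \<open>C u\<close> when the paths agree on a large window. The point is to extract the small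
  factor \<eta> from the exponential, leaving the integrable function
  \<open>exp (C u)\<close>.\<close>

lemma emission_variation:
  fixes m :: "'u::topological_space measure"
  assumes sets_m: "sets m = sets borel"
    and psi: "\<And>x u. x \<in> X \<Longrightarrow> \<psi> x u = exp (- l x u)"
    and psi_m: "\<And>x. x \<in> X \<Longrightarrow> \<psi> x \<in> borel_measurable borel"
    and Cm: "C \<in> borel_measurable borel" and C0: "\<And>u. 0 \<le> C u" and \<alpha>: "0 < \<alpha>"
    and lip: "\<And>x y u. x \<in> X \<Longrightarrow> y \<in> X \<Longrightarrow> \<bar>l x u - l y u\<bar> \<le> C u * dX x y powr \<alpha>"
    and B: "\<And>x. x \<in> X \<Longrightarrow> (\<integral>\<^sup>+u. ennreal (exp (C u) * \<psi> x u) \<partial>m) \<le> ennreal B"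
    and \<delta>: "0 < \<delta>"
  shows "\<exists>j. \<forall>x\<in>X. \<forall>y\<in>X. (\<forall>i. nat \<bar>i\<bar> < j \<longrightarrow> x i = y i) \<longrightarrow>
    (\<integral>\<^sup>+u. ennreal \<bar>\<psi> x u - \<psi> y u\<bar> \<partial>m) \<le> ennreal \<delta>"
proof -
  define q :: real where "q = 2 powr (- \<alpha>)"
  have q: "0 < q" "q < 1" using \<alpha> powr_less_mono[of "- \<alpha>" 0 "2::real"] by (auto simp: q_def)
  obtain j where j: "q^j < \<delta> / (\<bar>B\<bar> + 1)" using real_arch_pow_inv[of "\<delta> / (\<bar>B\<bar> + 1)" q] \<delta> q by auto
  define \<eta> where "\<eta> = q^j"
  have eta: "0 \<le> \<eta>" "\<eta> \<le> 1" using q by (auto simp: \<eta>_def power_le_one)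
  have "\<eta> * B \<le> \<eta> * (\<bar>B\<bar> + 1)" using eta by (intro mult_left_mono) auto
  also have "\<dots> \<le> \<delta>" using j by (simp add: \<eta>_def field_simps)
  finally have etaB: "\<eta> * B \<le> \<delta>" .
  have "(\<integral>\<^sup>+u. ennreal \<bar>\<psi> x u - \<psi> y u\<bar> \<partial>m) \<le> ennreal \<delta>"
    if x: "x \<in> X" and y: "y \<in> X" and xy: "\<forall>i. nat \<bar>i\<bar> < j \<longrightarrow> x i = y i" for x y
  proof -
    have "dX x y powr \<alpha> \<le> (2 powr (- real j)) powr \<alpha>"
      using xy \<alpha> by (intro powr_mono2 dX_le) (auto simp: dX_nonneg)
    also have "\<dots> = q powr real j" by (simp add: q_def powr_powr mult.commute)
    also have "\<dots> = \<eta>" using q by (simp add: powr_realpow \<eta>_def)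
    finally have d: "dX x y powr \<alpha> \<le> \<eta>" .
    have pt: "\<bar>\<psi> x u - \<psi> y u\<bar> \<le> \<eta> * (exp (C u) * \<psi> x u)" for u
    proof -
      let ?t = "l x u - l y u"
      have px: "0 < \<psi> x u" using psi[OF x] by simp
      have "\<psi> x u - \<psi> y u = \<psi> x u * (1 - exp ?t)"
        using psi[OF x] psi[OF y] by (simp add: right_diff_distrib exp_add[symmetric])
      then have "\<bar>\<psi> x u - \<psi> y u\<bar> = \<psi> x u * \<bar>1 - exp ?t\<bar>" using px by (simp add: abs_mult)
      also have "\<dots> \<le> \<psi> x u * (\<eta> * exp (C u))"
      proof (rule mult_left_mono)
        have "\<bar>?t\<bar> \<le> \<eta> * C u"
          using lip[OF x y, of u] mult_left_mono[OF d C0[of u]] by (simp add: mult.commute)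
        then have "\<bar>1 - exp ?t\<bar> \<le> exp (\<eta> * C u) - 1"
          using abs_one_minus_exp_le[of ?t] by (smt (verit) exp_le_cancel_iff)
        \<comment> \<open>Convexity of the exponential between 0 and \<open>C u\<close> is what
          makes \<eta> a linear factor.\<close>
        also have "exp (\<eta> * C u) \<le> (1 - \<eta>) + \<eta> * exp (C u)"
          using convex_onD[OF convex_on_exp[of 1], of \<eta> 0 "C u"] eta by simp
        finally show "\<bar>1 - exp ?t\<bar> \<le> \<eta> * exp (C u)" using eta by linarith
      qed (use px in simp)
      finally show ?thesis by (simp add: mult_ac)
    qed
    have me: "(\<lambda>u. ennreal (exp (C u) * \<psi> x u)) \<in> borel_measurable m"
    proof -
      have "(\<lambda>u. exp (C u) * \<psi> x u) \<in> borel_measurable borel"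
        using Cm psi_m[OF x] by measurable
      then have "(\<lambda>u. exp (C u) * \<psi> x u) \<in> borel_measurable m"
        using measurable_cong_sets[OF sets_m refl] by blast
      then show ?thesis by (rule measurable_compose[OF _ measurable_ennreal])
    qed
    have "(\<integral>\<^sup>+u. ennreal \<bar>\<psi> x u - \<psi> y u\<bar> \<partial>m) \<le> (\<integral>\<^sup>+u. ennreal \<eta> * ennreal (exp (C u) * \<psi> x u) \<partial>m)"
      using pt eta by (intro nn_integral_mono) (auto simp: ennreal_mult'[symmetric] intro!: ennreal_leI)
    also have "\<dots> = ennreal \<eta> * (\<integral>\<^sup>+u. ennreal (exp (C u) * \<psi> x u) \<partial>m)" by (rule nn_integral_cmult[OF me])
    also have "\<dots> \<le> ennreal \<eta> * ennreal B" by (intro mult_left_mono B x) auto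
    also have "\<dots> = ennreal (\<eta> * B)" using eta by (simp add: ennreal_mult')
    also have "\<dots> \<le> ennreal \<delta>" using etaB by (rule ennreal_leI)
    finally show ?thesis .
  qed
  then show ?thesis by blast
qed

text \<open>If the numerator or the denominator is not integrable, its Bochner integral is \<open>0\<close> and so is the
  quotient.\<close>

lemma posterior_quotient_le:
  fixes l :: "'p \<Rightarrow> real"
  assumes "prob_space M" and V: "V \<in> sets M" "0 < measure M V"
    and l0: "\<And>\<theta>. \<theta> \<in> space M \<Longrightarrow> 0 \<le> l \<theta>"
    and up: "\<And>\<theta>. \<theta> \<in> space M \<Longrightarrow> \<theta> \<in> F \<Longrightarrow> l \<theta> \<le> U" and U: "0 \<le> U"
    and low: "\<And>\<theta>. \<theta> \<in> V \<Longrightarrow> W \<le> l \<theta>" and W: "0 < W"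
  shows "\<bar>(\<integral>\<theta>. indicator F \<theta> * l \<theta> \<partial>M) / (\<integral>\<theta>. l \<theta> \<partial>M)\<bar> \<le> U / (W * measure M V)"
proof (cases "integrable M l")
  case False
  then show ?thesis using U W V by (simp add: not_integrable_integral_eq)
next
  case True
  interpret prob_space M by fact
  have "(\<integral>\<theta>. W * indicator V \<theta> \<partial>M) \<le> (\<integral>\<theta>. l \<theta> \<partial>M)"
  proof (rule integral_mono[OF _ True])
    show "integrable M (\<lambda>\<theta>. W * indicator V \<theta>)"
      by (intro integrable_mult_right integrable_real_indicator V) (simp add: emeasure_eq_measure)
    show "W * indicator V \<theta> \<le> l \<theta>" if "\<theta> \<in> space M" for \<theta>
      using low[of \<theta>] l0[OF that] by (simp add: indicator_def)
  qed
  then have D: "W * measure M V \<le> (\<integral>\<theta>. l \<theta> \<partial>M)"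
    using sets.sets_into_space[OF V(1)] by (simp add: Int_absorb2)
  have N0: "0 \<le> (\<integral>\<theta>. indicator F \<theta> * l \<theta> \<partial>M)"
    using l0 by (intro Bochner_Integration.integral_nonneg) (auto simp: indicator_def)
  have N1: "(\<integral>\<theta>. indicator F \<theta> * l \<theta> \<partial>M) \<le> U"
  proof (cases "integrable M (\<lambda>\<theta>. indicator F \<theta> * l \<theta>)")
    case True
    have "(\<integral>\<theta>. indicator F \<theta> * l \<theta> \<partial>M) \<le> (\<integral>\<theta>. U \<partial>M)"
      by (rule integral_mono[OF True]) (use up U in \<open>auto simp: indicator_def\<close>)
    then show ?thesis by (simp add: prob_space)
  qed (use U in \<open>simp add: not_integrable_integral_eq\<close>)
  have "0 < W * measure M V" using W V by simp
  then show ?thesis using D N0 N1 U by (simp add: abs_of_nonneg frac_le)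
qed

theorem theorem2p2:
  fixes X :: "(int \<Rightarrow> 'a::finite) set"
    and \<Theta> :: "'p::metric_space set"
    and f :: "'p \<Rightarrow> (int \<Rightarrow> 'a) \<Rightarrow> real"
    and \<mu> :: "'p \<Rightarrow> (int \<Rightarrow> 'a) measure"
    and \<Pi>0 :: "'p measure"
    and m :: "'u::polish_space measure"
    and \<phi> :: "'p \<Rightarrow> (int \<Rightarrow> 'a) \<Rightarrow> 'u \<Rightarrow> real"
    and L :: "'p \<Rightarrow> (int \<Rightarrow> 'a) \<Rightarrow> 'u \<Rightarrow> real"
    and \<theta>s :: 'p
    and E :: "'p set"
  assumes X: "mixing_sft X"
    and \<Theta>: "compact \<Theta>" "\<Theta> \<noteq> {}"
    and f: "regular_family \<Theta> X f"
    and \<mu>: "\<forall>\<theta>\<in>\<Theta>. invariant_gibbs X (f \<theta>) (\<mu> \<theta>)"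
    and \<Pi>0: "prob_space \<Pi>0" "sets \<Pi>0 = sets (restrict_space borel \<Theta>)"
      "\<forall>G. open G \<and> G \<inter> \<Theta> \<noteq> {} \<longrightarrow> emeasure \<Pi>0 (G \<inter> \<Theta>) > 0"
    and m: "sigma_finite_measure m" "sets m = sets borel"
    and \<phi>_nonneg: "\<forall>\<theta>\<in>\<Theta>. \<forall>x\<in>X. \<forall>u. \<phi> \<theta> x u \<ge> 0"
    and \<phi>_cont: "jointly_continuous \<Theta> X \<phi>"
    and \<phi>_prob: "\<forall>\<theta>\<in>\<Theta>. \<forall>x\<in>X. (\<integral>\<^sup>+u. ennreal (\<phi> \<theta> x u) \<partial>m) = 1"
    and \<theta>s: "\<theta>s \<in> \<Theta>"
    and L_def: "\<forall>\<theta>\<in>\<Theta>. \<forall>x\<in>X. \<forall>u. \<phi> \<theta> x u > 0 \<and> L \<theta> x u = - ln (\<phi> \<theta> x u)"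
    and L_cont: "jointly_continuous \<Theta> X L"
    and L_bound: "\<exists>Lstar :: 'u \<Rightarrow> real. Lstar \<in> borel_measurable borel \<and>
        (\<forall>\<theta>\<in>\<Theta>. \<forall>x\<in>X. \<forall>u. \<bar>L \<theta> x u\<bar> \<le> Lstar u) \<and>
        (\<integral>\<^sup>+y. ennreal (Lstar (y 0)) \<partial>process_measure \<mu> \<phi> m \<theta>s) < \<infinity>"
    and L_modulus: "\<exists>\<rho> :: real \<Rightarrow> 'u \<Rightarrow> real.
        (\<forall>\<delta>>0. \<rho> \<delta> \<in> borel_measurable borel \<and> (\<forall>u. \<rho> \<delta> u > 0) \<and>
           (\<forall>\<theta>\<in>\<Theta>. \<forall>\<theta>'\<in>\<Theta>. \<forall>x\<in>X. \<forall>x'\<in>X. \<forall>u.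
              max (dist \<theta> \<theta>') (dX x x') \<le> \<delta> \<longrightarrow> \<bar>L \<theta> x u - L \<theta>' x' u\<bar> \<le> \<rho> \<delta> u)) \<and>
        ((\<lambda>\<delta>. \<integral>\<^sup>+y. ennreal (\<rho> \<delta> (y 0)) \<partial>process_measure \<mu> \<phi> m \<theta>s) \<longlongrightarrow> 0) (at_right 0)"
    and L2: "\<exists>\<alpha>>0. \<exists>C :: 'p \<Rightarrow> 'u \<Rightarrow> real.
        (\<lambda>(\<theta>, u). C \<theta> u) \<in> borel_measurable (restrict_space borel (\<Theta> \<times> UNIV)) \<and>
        (\<forall>\<theta>\<in>\<Theta>. \<forall>u. C \<theta> u \<ge> 0) \<and>
        (\<forall>\<theta>\<in>\<Theta>. \<forall>u. \<forall>x\<in>X. \<forall>y\<in>X. \<bar>L \<theta> x u - L \<theta> y u\<bar> \<le> C \<theta> u * dX x y powr \<alpha>) \<and>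
        (\<forall>\<beta>>0. \<exists>B::real. \<forall>\<theta>\<in>\<Theta>. \<forall>x\<in>X.
            (\<integral>\<^sup>+u. ennreal (exp (\<beta> * C \<theta> u) * \<phi> \<theta> x u) \<partial>m) \<le> ennreal B)"
    and E: "openin (top_of_set \<Theta>) E"
      "{\<theta>\<in>\<Theta>. process_measure \<mu> \<phi> m \<theta> = process_measure \<mu> \<phi> m \<theta>s} \<subseteq> E"
  shows "AE y in process_measure \<mu> \<phi> m \<theta>s.
           (\<lambda>n. posterior \<Pi>0 \<mu> \<phi> n (\<Theta> - E) y) \<longlonglongrightarrow> 0"
proof -
  obtain N where glue: "\<And>x y. x \<in> X \<Longrightarrow> y \<in> X \<Longrightarrow> \<exists>z\<in>X. (\<forall>i<0. z i = x i) \<and> (\<forall>i\<ge>0. z (i + int N) = y i)"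
    using mixing_sft_specification[OF X] by blast
  note tr = mixing_sft_translate[OF X]
  obtain r where r: "0 < r" and hol: "\<And>\<theta>. \<theta> \<in> \<Theta> \<Longrightarrow> holder r X (f \<theta>)"
    and hcont: "\<And>\<theta> \<epsilon>. \<theta> \<in> \<Theta> \<Longrightarrow> 0 < \<epsilon> \<Longrightarrow> \<exists>\<delta>>0. \<forall>\<theta>'\<in>\<Theta>. dist \<theta>' \<theta> < \<delta> \<longrightarrow> holder_norm r X (\<lambda>x. f \<theta>' x - f \<theta> x) < \<epsilon>"
    using f unfolding regular_family_def by blast
  have "\<exists>B\<ge>0. \<forall>x\<in>X. \<bar>f \<theta> x\<bar> \<le> B" if th: "\<theta> \<in> \<Theta>" for \<theta>
  proof -
    obtain B where "\<forall>x\<in>X. \<bar>f \<theta> x\<bar> \<le> B" using hol[OF th] unfolding holder_def by blast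
    then show ?thesis by (intro exI[of _ "max 0 B"]) (auto simp: le_max_iff_disj)
  qed
  then obtain Bf where Bf: "\<And>\<theta>. \<theta> \<in> \<Theta> \<Longrightarrow> 0 \<le> Bf \<theta>" "\<And>\<theta> x. \<theta> \<in> \<Theta> \<Longrightarrow> x \<in> X \<Longrightarrow> \<bar>f \<theta> x\<bar> \<le> Bf \<theta>" by metis
  define P where "P \<theta> = pressure X (f \<theta>)" for \<theta>
  obtain Lstar where Lstar: "\<And>\<theta> x u. \<theta> \<in> \<Theta> \<Longrightarrow> x \<in> X \<Longrightarrow> \<bar>L \<theta> x u\<bar> \<le> Lstar u"
    using L_bound by blast
  from L_modulus obtain \<rho> :: "real \<Rightarrow> 'u \<Rightarrow> real" where R: "\<forall>\<delta>>0. \<rho> \<delta> \<in> borel_measurable borel \<and> (\<forall>u. \<rho> \<delta> u > 0) \<and>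
       (\<forall>\<theta>\<in>\<Theta>. \<forall>\<theta>'\<in>\<Theta>. \<forall>x\<in>X. \<forall>x'\<in>X. \<forall>u. max (dist \<theta> \<theta>') (dX x x') \<le> \<delta> \<longrightarrow> \<bar>L \<theta> x u - L \<theta>' x' u\<bar> \<le> \<rho> \<delta> u)"
    and rho_lim: "((\<lambda>\<delta>. \<integral>\<^sup>+y. ennreal (\<rho> \<delta> (y 0)) \<partial>process_measure \<mu> \<phi> m \<theta>s) \<longlongrightarrow> 0) (at_right 0)"
    by (elim exE conjE)
  have rho_m: "\<rho> \<delta> \<in> borel_measurable borel" and rho_pos: "\<rho> \<delta> u > 0" if "0 < \<delta>" for \<delta> u
    using R[rule_format, OF that] by blast+
  have rho: "\<bar>L \<theta> x u - L \<theta>' x' u\<bar> \<le> \<rho> \<delta> u" if "0 < \<delta>" "\<theta> \<in> \<Theta>" "\<theta>' \<in> \<Theta>" "x \<in> X" "x' \<in> X"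
      "max (dist \<theta> \<theta>') (dX x x') \<le> \<delta>" for \<delta> \<theta> \<theta>' x x' u
    using R that by blast
  from L2 obtain \<alpha> and C :: "'p \<Rightarrow> 'u \<Rightarrow> real" where al: "0 < \<alpha>"
    and Cm: "(\<lambda>(\<theta>, u). C \<theta> u) \<in> borel_measurable (restrict_space borel (\<Theta> \<times> UNIV))"
    and C0': "\<forall>\<theta>\<in>\<Theta>. \<forall>u. C \<theta> u \<ge> 0"
    and lip': "\<forall>\<theta>\<in>\<Theta>. \<forall>u. \<forall>x\<in>X. \<forall>y\<in>X. \<bar>L \<theta> x u - L \<theta> y u\<bar> \<le> C \<theta> u * dX x y powr \<alpha>"
    and Cexp: "\<forall>\<beta>>0. \<exists>B::real. \<forall>\<theta>\<in>\<Theta>. \<forall>x\<in>X. (\<integral>\<^sup>+u. ennreal (exp (\<beta> * C \<theta> u) * \<phi> \<theta> x u) \<partial>m) \<le> ennreal B"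
    by (elim exE conjE)
  have C0: "C \<theta> u \<ge> 0" if "\<theta> \<in> \<Theta>" for \<theta> u using C0' that by blast
  have lip: "\<bar>L \<theta> x u - L \<theta> y u\<bar> \<le> C \<theta> u * dX x y powr \<alpha>" if "\<theta> \<in> \<Theta>" "x \<in> X" "y \<in> X" for \<theta> u x y
    using lip' that by blast
  obtain B where B: "\<And>\<theta> x. \<theta> \<in> \<Theta> \<Longrightarrow> x \<in> X \<Longrightarrow> (\<integral>\<^sup>+u. ennreal (exp (C \<theta> u) * \<phi> \<theta> x u) \<partial>m) \<le> ennreal B"
    using Cexp[rule_format, of 1] by auto
  have phi: "\<phi> \<theta> x u = exp (- L \<theta> x u)" and phi_pos: "0 < \<phi> \<theta> x u" if "\<theta> \<in> \<Theta>" "x \<in> X" for \<theta> x u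
    using L_def that by auto
  have phi_c: "\<exists>\<delta>>0. \<forall>x'\<in>X. \<forall>u'. dX x' x < \<delta> \<and> dist u' u < \<delta> \<longrightarrow> \<bar>\<phi> \<theta> x' u' - \<phi> \<theta> x u\<bar> < \<epsilon>"
    if th: "\<theta> \<in> \<Theta>" "x \<in> X" "0 < \<epsilon>" for \<theta> x u \<epsilon>
  proof -
    obtain \<delta> where "\<delta> > 0" and d: "\<forall>\<theta>'\<in>\<Theta>. \<forall>x'\<in>X. \<forall>u'. dist \<theta>' \<theta> < \<delta> \<and> dX x' x < \<delta> \<and> dist u' u < \<delta> \<longrightarrow> \<bar>\<phi> \<theta>' x' u' - \<phi> \<theta> x u\<bar> < \<epsilon>"
      using \<phi>_cont[unfolded jointly_continuous_def, rule_format, OF th(1,2,3), of u] by blast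
    then show ?thesis using th(1) by (intro exI[of _ \<delta>]) auto
  qed
  have phi_m: "\<phi> \<theta> x \<in> borel_measurable borel" if th: "\<theta> \<in> \<Theta>" "x \<in> X" for \<theta> x
  proof (rule borel_measurable_continuous_onI)
    show "continuous_on UNIV (\<phi> \<theta> x)"
      unfolding continuous_on_iff
    proof (intro ballI allI impI)
      fix u and \<epsilon> :: real assume "0 < \<epsilon>"
      from phi_c[OF th this, of u] obtain \<delta> where "\<delta> > 0"
        "\<forall>x'\<in>X. \<forall>u'. dX x' x < \<delta> \<and> dist u' u < \<delta> \<longrightarrow> \<bar>\<phi> \<theta> x' u' - \<phi> \<theta> x u\<bar> < \<epsilon>" by blast
      then show "\<exists>d>0. \<forall>x'\<in>UNIV. dist x' u < d \<longrightarrow> dist (\<phi> \<theta> x x') (\<phi> \<theta> x u) < \<epsilon>"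
        using th by (intro exI[of _ \<delta>]) (auto simp: dist_real_def dX_def)
    qed
  qed
  have C_m: "C \<theta> \<in> borel_measurable borel" if th: "\<theta> \<in> \<Theta>" for \<theta>
  proof -
    have "(\<lambda>u. (\<theta>, u)) \<in> measurable borel (restrict_space borel (\<Theta> \<times> UNIV))"
      using th by (intro measurable_restrict_space2 borel_measurable_continuous_onI continuous_intros) auto
    from measurable_compose[OF this Cm] show ?thesis by simp
  qed
  \<comment> \<open>The emission part is separated from the Gibbs part because it will be combined
    with different Gibbs constants for the same parameter.\<close>
  have hax: "hidden_axioms X m (\<phi> \<theta>)" if th: "\<theta> \<in> \<Theta>" for \<theta>
  proof (rule hidden_axioms.intro)
    show "\<exists>B. \<forall>x\<in>X. \<phi> \<theta> x u \<le> B" for u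
    proof (intro exI ballI)
      fix x assume x: "x \<in> X"
      show "\<phi> \<theta> x u \<le> exp (Lstar u)" using Lstar[OF th x, of u] phi[OF th x, of u] by simp
    qed
    show "\<exists>j. \<forall>x\<in>X. \<forall>y\<in>X. (\<forall>i. nat \<bar>i\<bar> < j \<longrightarrow> x i = y i) \<longrightarrow>
        (\<integral>\<^sup>+u. ennreal \<bar>\<phi> \<theta> x u - \<phi> \<theta> y u\<bar> \<partial>m) \<le> ennreal \<delta>" if "0 < \<delta>" for \<delta>
      by (rule emission_variation[OF m(2) phi[OF th] phi_m[OF th] C_m[OF th] C0[OF th] al lip[OF th] B[OF th] that])
  qed (use m phi_pos[OF th] phi_c[OF th] \<phi>_prob th in auto)
  \<comment> \<open>The bound \<open>B'\<close> for the potential is left free, so that all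
    parameters of a ball can share one.\<close>
  have gib: "\<exists>K. gibbs X (f \<theta>) (\<mu> \<theta>) (P \<theta>) K B' N" if "\<theta> \<in> \<Theta>" "\<And>x. x \<in> X \<Longrightarrow> \<bar>f \<theta> x\<bar> \<le> B'" for \<theta> B'
    unfolding P_def by (rule gibbs_of_invariant) (use \<mu> tr glue that in auto)
  have "\<exists>K. hidden X (f \<theta>) (\<mu> \<theta>) (P \<theta>) K (Bf \<theta>) N m (\<phi> \<theta>)" if "\<theta> \<in> \<Theta>" for \<theta>
    using gib[OF that Bf(2)[OF that]] hidden.intro[OF _ hax[OF that]] by blast
  then obtain K where hid: "\<And>\<theta>. \<theta> \<in> \<Theta> \<Longrightarrow> hidden X (f \<theta>) (\<mu> \<theta>) (P \<theta>) (K \<theta>) (Bf \<theta>) N m (\<phi> \<theta>)" by metis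
  define lk where "lk \<theta> = hidden.lik (\<mu> \<theta>) (\<phi> \<theta>)" for \<theta>
  have lk_eq: "likelihood \<mu> \<phi> \<theta> n u = lk \<theta> n u" if "\<theta> \<in> \<Theta>" for \<theta> n u
    unfolding lk_def hidden.lik_def[OF hid[OF that]] likelihood_def ..
  have lk_pos: "0 < lk \<theta> n u" if "\<theta> \<in> \<Theta>" for \<theta> n u
    unfolding lk_def by (rule hidden.lik_pos[OF hid[OF that]])
  \<comment> \<open>The locale states the identity for constant families, where the parameter is a
    dummy.\<close>
  have pm_eq: "process_measure \<mu> \<phi> m \<theta> = hidden.PY (\<mu> \<theta>) m (\<phi> \<theta>)" if "\<theta> \<in> \<Theta>" for \<theta>
    using hidden.process_measure_eq[OF hid[OF that], of undefined]
    by (simp add: process_measure_def)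
  let ?PS = "process_measure \<mu> \<phi> m \<theta>s"
  have rho_small: "\<exists>\<delta>>0. (\<integral>\<^sup>+y. ennreal (\<rho> \<delta> (y 0)) \<partial>?PS) < ennreal \<epsilon>" if "0 < \<epsilon>" for \<epsilon>
  proof -
    have "eventually (\<lambda>\<delta>. (\<integral>\<^sup>+y. ennreal (\<rho> \<delta> (y 0)) \<partial>?PS) < ennreal \<epsilon>) (at_right 0)"
      using rho_lim that by (intro order_tendstoD(2)) auto
    then obtain b where "b > 0" "\<forall>\<delta>>0. \<delta> < b \<longrightarrow> (\<integral>\<^sup>+y. ennreal (\<rho> \<delta> (y 0)) \<partial>?PS) < ennreal \<epsilon>"
      unfolding eventually_at_right_field by blast
    then show ?thesis by (intro exI[of _ "b / 2"]) auto
  qed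
  have rho_sum: "AE y in ?PS. eventually (\<lambda>n. (\<Sum>k<n. \<rho> \<delta> (y k)) \<le> real n * \<epsilon>) sequentially"
    if "0 < \<delta>" "(\<integral>\<^sup>+y. ennreal (\<rho> \<delta> (y 0)) \<partial>?PS) < ennreal \<epsilon>" for \<delta> \<epsilon>
    unfolding pm_eq[OF \<theta>s]
    by (rule hidden.eventually_sum_le[OF hid[OF \<theta>s] rho_m less_imp_le[OF rho_pos]])
      (use that in \<open>simp_all add: pm_eq[OF \<theta>s]\<close>)
  \<comment> \<open>The constant depends on the centre, \<eta> and \<delta>, but neither on the
    neighbour nor on \<open>n\<close> and the observations. Both directions are stated: the first
    transports decay to neighbours, the second bounds the evidence from below near
    \<open>\<theta>s\<close>.\<close>
  have compare: "\<exists>s>0. \<exists>C>0. \<forall>\<theta>'\<in>\<Theta>. dist \<theta>' \<theta>0 < s \<longrightarrow> (\<forall>n u.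
      lk \<theta>' n u \<le> C * exp (2 * \<eta> * real n + 2 * (\<Sum>k<n. \<rho> \<delta> (u k))) * lk \<theta>0 n u \<and>
      lk \<theta>0 n u \<le> C * exp (2 * \<eta> * real n + 2 * (\<Sum>k<n. \<rho> \<delta> (u k))) * lk \<theta>' n u)"
    if th: "\<theta>0 \<in> \<Theta>" and eta: "0 < \<eta>" "\<eta> \<le> 1" and del: "0 < \<delta>" for \<theta>0 \<eta> \<delta>
  proof -
    obtain H where H: "\<And>x y. x \<in> X \<Longrightarrow> y \<in> X \<Longrightarrow> \<bar>f \<theta>0 x - f \<theta>0 y\<bar> \<le> H * dX x y powr r"
      using hol[OF th] unfolding holder_def by blast
    define H1 where "H1 = \<bar>H\<bar> + 1"
    obtain \<delta>1 where d1: "\<delta>1 > 0" "\<And>\<theta>'. \<theta>' \<in> \<Theta> \<Longrightarrow> dist \<theta>' \<theta>0 < \<delta>1 \<Longrightarrow> holder_norm r X (\<lambda>x. f \<theta>' x - f \<theta>0 x) < \<eta>"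
      using hcont[OF th eta(1)] by blast
    \<comment> \<open>\<delta>1 controls the potentials in the Hoelder norm, \<delta> the modulus of
      \<open>L\<close> in the parameter.\<close>
    define s where "s = min \<delta>1 \<delta>"
    have s: "0 < s" using d1 del by (simp add: s_def)
    obtain j where j: "(1/2 :: real)^j < \<delta>" using real_arch_pow_inv[of \<delta> "1/2"] del by auto
    have pj: "2 powr (- real j) \<le> \<delta>"
      using j by (simp add: powr_minus powr_realpow power_divide inverse_eq_divide)
    \<comment> \<open>The variation bound for every potential in the ball: \<open>H1\<close> adds to
      the Hoelder constant at the centre the perturbation, which is at most \<eta> and hence at most
      1.\<close>
    define V where "V = 2 * H1 / (1 - 2 powr (- r))"
    have V0: "0 \<le> V" using r powr_less_mono[of "- r" 0 "2::real"] by (simp add: V_def H1_def)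
    define B' where "B' = Bf \<theta>0 + 1"
    \<comment> \<open>The constant of \<open>uniform_gibbs\<close> with bounds valid on the whole
      ball: closeness of the potentials keeps sup norm and pressure within 1 of their values at the
      centre.\<close>
    define K1 where "K1 = exp (16 * V + 3 * (real N * ((\<bar>P \<theta>0\<bar> + 1) + B')))"
    have fclose: "\<bar>f \<theta>' x - f \<theta>0 x\<bar> \<le> \<eta>" if "\<theta>' \<in> \<Theta>" "dist \<theta>' \<theta>0 < s" "x \<in> X" for \<theta>' x
      using holder_norm_bounds(1)[OF hol[OF that(1)] hol[OF th] less_imp_le[OF d1(2)[OF that(1)]] that(3)] that(2)
      by (simp add: s_def)
    have fholder: "\<bar>f \<theta>' x - f \<theta>' y\<bar> \<le> H1 * dX x y powr r"
      if "\<theta>' \<in> \<Theta>" "dist \<theta>' \<theta>0 < s" "x \<in> X" "y \<in> X" for \<theta>' x y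
    proof -
      have "\<bar>(f \<theta>' x - f \<theta>0 x) - (f \<theta>' y - f \<theta>0 y)\<bar> \<le> \<eta> * dX x y powr r"
        using holder_norm_bounds(2)[OF hol[OF that(1)] hol[OF th] less_imp_le[OF d1(2)[OF that(1)]] that(3,4)] that(2)
        by (simp add: s_def)
      moreover have "\<eta> * dX x y powr r \<le> 1 * dX x y powr r" using eta by (intro mult_right_mono) auto
      moreover have "\<bar>f \<theta>0 x - f \<theta>0 y\<bar> \<le> H * dX x y powr r" by (rule H[OF that(3,4)])
      moreover have "H * dX x y powr r \<le> \<bar>H\<bar> * dX x y powr r" by (intro mult_right_mono) auto
      moreover have "H1 * dX x y powr r = \<bar>H\<bar> * dX x y powr r + 1 * dX x y powr r"
        by (simp add: H1_def distrib_right)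
      ultimately show ?thesis by linarith
    qed
    have uni: "hidden X (f \<theta>') (\<mu> \<theta>') (P \<theta>') K1 B' N m (\<phi> \<theta>')" if t: "\<theta>' \<in> \<Theta>" "dist \<theta>' \<theta>0 < s" for \<theta>'
    proof (rule hidden.intro[OF _ hax[OF t(1)]])
      have fb: "\<bar>f \<theta>' x\<bar> \<le> B'" if "x \<in> X" for x
        using fclose[OF t that] Bf(2)[OF th that] eta unfolding B'_def by linarith
      obtain K' where g': "gibbs X (f \<theta>') (\<mu> \<theta>') (P \<theta>') K' B' N" using gib[OF t(1) fb] by blast
      have g0: "gibbs X (f \<theta>0) (\<mu> \<theta>0) (P \<theta>0) (K \<theta>0) (Bf \<theta>0) N"
        using hid[OF th] by (rule hidden.axioms(1))
      have "f \<theta>' x \<le> f \<theta>0 x + 1" "f \<theta>0 x \<le> f \<theta>' x + 1" if "x \<in> X" for x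
        using fclose[OF t that] eta by linarith+
      then have "P \<theta>' \<le> P \<theta>0 + 1" "P \<theta>0 \<le> P \<theta>' + 1"
        using gibbs_pressure_le[OF g' g0] gibbs_pressure_le[OF g0 g'] by blast+
      then have Pb: "\<bar>P \<theta>'\<bar> \<le> \<bar>P \<theta>0\<bar> + 1" by linarith
      have var: "\<bar>birkhoff_sum (f \<theta>') n x - birkhoff_sum (f \<theta>') n y\<bar> \<le> V"
        if "x \<in> X" "y \<in> X" "word x n = word y n" for x y n
        unfolding V_def by (rule birkhoff_variation[OF tr fholder[OF t] r _ that]) (auto simp: H1_def)
      show "gibbs X (f \<theta>') (\<mu> \<theta>') (P \<theta>') K1 B' N"
        unfolding K1_def by (rule gibbs.uniform_gibbs[OF g' var V0 _ Pb]) (use Bf(1)[OF th] in \<open>simp_all add: B'_def\<close>)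
    qed
    have ratio: "\<phi> \<theta>1 x u \<le> exp (\<rho> \<delta> u) * \<phi> \<theta>2 x' u"
      if "\<theta>1 \<in> \<Theta>" "\<theta>2 \<in> \<Theta>" "dist \<theta>1 \<theta>2 \<le> \<delta>" "x \<in> X" "x' \<in> X" "dX x x' \<le> 2 powr (- real j)" for \<theta>1 \<theta>2 x x' u
    proof -
      have "\<bar>L \<theta>1 x u - L \<theta>2 x' u\<bar> \<le> \<rho> \<delta> u" using that pj by (intro rho del) auto
      then show ?thesis using phi[OF that(1,4)] phi[OF that(2,5)] by (simp add: exp_add[symmetric])
    qed
    \<comment> \<open>The \<open>2 * j\<close> boundary letters contribute a factor independent of
      \<open>n\<close>, which is absorbed here.\<close>
    define Cc where "Cc = K1 * K1 * exp (2 * \<eta> * (2 * real j))"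
    have Cc: "0 < Cc" by (simp add: Cc_def K1_def)
    have bd: "K1 * K1 * exp (2 * \<eta> * real (n + 2 * j)) * exp (2 * S) = Cc * exp (2 * \<eta> * real n + 2 * S)" for n S
      by (simp add: Cc_def exp_add distrib_left)
    have "lk \<theta>' n u \<le> Cc * exp (2 * \<eta> * real n + 2 * (\<Sum>k<n. \<rho> \<delta> (u k))) * lk \<theta>0 n u \<and>
      lk \<theta>0 n u \<le> Cc * exp (2 * \<eta> * real n + 2 * (\<Sum>k<n. \<rho> \<delta> (u k))) * lk \<theta>' n u"
      if t: "\<theta>' \<in> \<Theta>" "dist \<theta>' \<theta>0 < s" for \<theta>' n u
    proof -
      have h': "hidden X (f \<theta>') (\<mu> \<theta>') (P \<theta>') K1 B' N m (\<phi> \<theta>')" by (rule uni[OF t])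
      have h0: "hidden X (f \<theta>0) (\<mu> \<theta>0) (P \<theta>0) K1 B' N m (\<phi> \<theta>0)" using uni[OF th] s by simp
      have d: "dist \<theta>' \<theta>0 \<le> \<delta>" "dist \<theta>0 \<theta>' \<le> \<delta>" "dist \<theta>0 \<theta>0 \<le> \<delta>" "dist \<theta>' \<theta>' \<le> \<delta>"
        using t(2) del by (auto simp: s_def dist_commute)
      have c: "\<bar>f \<theta>' x - f \<theta>0 x\<bar> \<le> \<eta>" "\<bar>f \<theta>0 x - f \<theta>' x\<bar> \<le> \<eta>" if "x \<in> X" for x
        using fclose[OF t that] by linarith+
      show ?thesis unfolding bd[symmetric] lk_def
        using likelihood_le[OF h' h0 c(1) ratio[OF t(1) th d(1)] ratio[OF th th d(3)], where n = n and u = u]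
          likelihood_le[OF h0 h' c(2) ratio[OF th t(1) d(2)] ratio[OF t(1) t(1) d(4)], where n = n and u = u] by blast
    qed
    then show ?thesis using s Cc by blast
  qed
  have upper: "\<exists>s>0. \<exists>c>0. \<exists>C>0. AE y in ?PS. eventually (\<lambda>n. \<forall>\<theta>'\<in>\<Theta>. dist \<theta>' \<theta> < s \<longrightarrow>
      lk \<theta>' n y \<le> C * exp (- c * real n) * lk \<theta>s n y) sequentially"
    if th: "\<theta> \<in> \<Theta> - E" for \<theta>
  proof -
    have thT: "\<theta> \<in> \<Theta>" using th by blast
    have "process_measure \<mu> \<phi> m \<theta> \<noteq> ?PS" using th E(2) by blast
    then have ne: "hidden.PY (\<mu> \<theta>) m (\<phi> \<theta>) \<noteq> hidden.PY (\<mu> \<theta>s) m (\<phi> \<theta>s)" unfolding pm_eq[OF thT] pm_eq[OF \<theta>s] .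
    obtain c where c: "c > 0" and sep: "AE y in ?PS. eventually (\<lambda>n. lk \<theta> n y \<le> exp (- c * real n) * lk \<theta>s n y) sequentially"
      using exponential_separation[OF hid[OF thT] hid[OF \<theta>s] ne] unfolding pm_eq[OF \<theta>s] lk_def by blast
    obtain \<delta> where del: "\<delta> > 0" "(\<integral>\<^sup>+y. ennreal (\<rho> \<delta> (y 0)) \<partial>?PS) < ennreal (c / 8)"
      using rho_small[of "c / 8"] c by auto
    \<comment> \<open>With \<eta> and the average of \<open>\<rho> \<delta>\<close> both at most
      \<open>c / 8\<close>, twice their sum is at most \<open>c / 2\<close>, so half of the
      separation rate survives. The cap at 1 is required by \<open>compare\<close>.\<close>
    define \<eta> where "\<eta> = min 1 (c / 8)"
    have eta: "0 < \<eta>" "\<eta> \<le> 1" "\<eta> \<le> c / 8" using c by (auto simp: \<eta>_def)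
    obtain s C where s: "s > 0" and C: "C > 0" and cmp: "\<And>\<theta>' n u. \<theta>' \<in> \<Theta> \<Longrightarrow> dist \<theta>' \<theta> < s \<Longrightarrow>
        lk \<theta>' n u \<le> C * exp (2 * \<eta> * real n + 2 * (\<Sum>k<n. \<rho> \<delta> (u k))) * lk \<theta> n u"
      using compare[OF thT eta(1,2) del(1)] by blast
    have "AE y in ?PS. eventually (\<lambda>n. \<forall>\<theta>'\<in>\<Theta>. dist \<theta>' \<theta> < s \<longrightarrow>
        lk \<theta>' n y \<le> C * exp (- (c / 2) * real n) * lk \<theta>s n y) sequentially"
      using sep rho_sum[OF del]
    proof eventually_elim
      case (elim y)
      then show ?case
      proof eventually_elim
        case (elim n)
        show ?case
        proof (intro ballI impI)
          fix \<theta>' assume t: "\<theta>' \<in> \<Theta>" "dist \<theta>' \<theta> < s"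
          have "\<eta> * real n \<le> c / 8 * real n" using eta by (intro mult_right_mono) auto
          then have ex: "2 * \<eta> * real n + 2 * (\<Sum>k<n. \<rho> \<delta> (y k)) \<le> c / 2 * real n"
            using elim(2) by (simp add: algebra_simps)
          have "lk \<theta>' n y \<le> C * exp (2 * \<eta> * real n + 2 * (\<Sum>k<n. \<rho> \<delta> (y k))) * lk \<theta> n y" by (rule cmp[OF t])
          also have "\<dots> \<le> C * exp (c / 2 * real n) * (exp (- c * real n) * lk \<theta>s n y)"
            using ex C elim(1) lk_pos[OF thT, of n y] by (intro mult_mono) auto
          also have "\<dots> = C * (exp (c / 2 * real n) * exp (- c * real n)) * lk \<theta>s n y" by (simp only: mult_ac)
          also have "exp (c / 2 * real n) * exp (- c * real n) = exp (- (c / 2) * real n)"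
            by (simp add: exp_add[symmetric] algebra_simps)
          finally show "lk \<theta>' n y \<le> C * exp (- (c / 2) * real n) * lk \<theta>s n y" .
        qed
      qed
    qed
    then show ?thesis using s C c by (intro exI[of _ s] exI[of _ "c / 2"] exI[of _ C] conjI) auto
  qed
  have lower: "\<exists>s>0. \<exists>C>0. AE y in ?PS. eventually (\<lambda>n. \<forall>\<theta>'\<in>\<Theta>. dist \<theta>' \<theta>s < s \<longrightarrow>
      lk \<theta>s n y \<le> C * exp (c / 2 * real n) * lk \<theta>' n y) sequentially"
    if c: "0 < c" for c
  proof -
    obtain \<delta> where del: "\<delta> > 0" "(\<integral>\<^sup>+y. ennreal (\<rho> \<delta> (y 0)) \<partial>?PS) < ennreal (c / 8)"
      using rho_small[of "c / 8"] c by auto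
    define \<eta> where "\<eta> = min 1 (c / 8)"
    have eta: "0 < \<eta>" "\<eta> \<le> 1" "\<eta> \<le> c / 8" using c by (auto simp: \<eta>_def)
    obtain s C where s: "s > 0" and C: "C > 0" and cmp: "\<And>\<theta>' n u. \<theta>' \<in> \<Theta> \<Longrightarrow> dist \<theta>' \<theta>s < s \<Longrightarrow>
        lk \<theta>s n u \<le> C * exp (2 * \<eta> * real n + 2 * (\<Sum>k<n. \<rho> \<delta> (u k))) * lk \<theta>' n u"
      using compare[OF \<theta>s eta(1,2) del(1)] by blast
    have "AE y in ?PS. eventually (\<lambda>n. \<forall>\<theta>'\<in>\<Theta>. dist \<theta>' \<theta>s < s \<longrightarrow>
        lk \<theta>s n y \<le> C * exp (c / 2 * real n) * lk \<theta>' n y) sequentially"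
      using rho_sum[OF del]
    proof eventually_elim
      case (elim y)
      then show ?case
      proof eventually_elim
        case (elim n)
        show ?case
        proof (intro ballI impI)
          fix \<theta>' assume t: "\<theta>' \<in> \<Theta>" "dist \<theta>' \<theta>s < s"
          have "\<eta> * real n \<le> c / 8 * real n" using eta by (intro mult_right_mono) auto
          then have ex: "2 * \<eta> * real n + 2 * (\<Sum>k<n. \<rho> \<delta> (y k)) \<le> c / 2 * real n"
            using elim by (simp add: algebra_simps)
          have "lk \<theta>s n y \<le> C * exp (2 * \<eta> * real n + 2 * (\<Sum>k<n. \<rho> \<delta> (y k))) * lk \<theta>' n y" by (rule cmp[OF t])
          also have "\<dots> \<le> C * exp (c / 2 * real n) * lk \<theta>' n y"
            using ex C lk_pos[OF t(1), of n y] by (intro mult_right_mono mult_left_mono) auto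
          finally show "lk \<theta>s n y \<le> C * exp (c / 2 * real n) * lk \<theta>' n y" .
        qed
      qed
    qed
    then show ?thesis using s C by blast
  qed
  have "\<exists>c>0. \<exists>C>0. AE y in ?PS. eventually (\<lambda>n. \<forall>\<theta>'\<in>\<Theta> - E. lk \<theta>' n y \<le> C * exp (- c * real n) * lk \<theta>s n y) sequentially"
  proof -
    have "\<forall>\<theta>\<in>\<Theta> - E. \<exists>s c C. s > 0 \<and> c > 0 \<and> C > 0 \<and> (AE y in ?PS. eventually (\<lambda>n. \<forall>\<theta>'\<in>\<Theta>. dist \<theta>' \<theta> < s \<longrightarrow>
      lk \<theta>' n y \<le> C * exp (- c * real n) * lk \<theta>s n y) sequentially)"
      using upper by blast
    from bchoice[OF this] obtain s where "\<forall>\<theta>\<in>\<Theta> - E. \<exists>c C. s \<theta> > 0 \<and> c > 0 \<and> C > 0 \<and> (AE y in ?PS. eventually (\<lambda>n. \<forall>\<theta>'\<in>\<Theta>. dist \<theta>' \<theta> < s \<theta> \<longrightarrow>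
      lk \<theta>' n y \<le> C * exp (- c * real n) * lk \<theta>s n y) sequentially)" by (elim exE)
    from bchoice[OF this] obtain c where "\<forall>\<theta>\<in>\<Theta> - E. \<exists>C. s \<theta> > 0 \<and> c \<theta> > 0 \<and> C > 0 \<and> (AE y in ?PS. eventually (\<lambda>n. \<forall>\<theta>'\<in>\<Theta>. dist \<theta>' \<theta> < s \<theta> \<longrightarrow>
      lk \<theta>' n y \<le> C * exp (- c \<theta> * real n) * lk \<theta>s n y) sequentially)" by (elim exE)
    from bchoice[OF this] obtain C where all: "\<forall>\<theta>\<in>\<Theta> - E. s \<theta> > 0 \<and> c \<theta> > 0 \<and> C \<theta> > 0 \<and> (AE y in ?PS. eventually (\<lambda>n. \<forall>\<theta>'\<in>\<Theta>. dist \<theta>' \<theta> < s \<theta> \<longrightarrow>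
      lk \<theta>' n y \<le> C \<theta> * exp (- c \<theta> * real n) * lk \<theta>s n y) sequentially)" by (elim exE)
    have sc: "s \<theta> > 0" "c \<theta> > 0" "C \<theta> > 0" if "\<theta> \<in> \<Theta> - E" for \<theta> using bspec[OF all that] by blast+
    have ev: "AE y in ?PS. eventually (\<lambda>n. \<forall>\<theta>'\<in>\<Theta>. dist \<theta>' \<theta> < s \<theta> \<longrightarrow>
        lk \<theta>' n y \<le> C \<theta> * exp (- c \<theta> * real n) * lk \<theta>s n y) sequentially" if "\<theta> \<in> \<Theta> - E" for \<theta>
      using bspec[OF all that] by blast
    \<comment> \<open>\<open>E\<close> is relatively open in the compact parameter set, so its
      complement there is compact.\<close>
    have "compact (\<Theta> - E)"
    proof -
      obtain G where "open G" "E = \<Theta> \<inter> G" using E(1) by (auto simp: openin_open)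
      then have "\<Theta> - E = \<Theta> \<inter> (- G)" by blast
      then show ?thesis using \<Theta>(1) \<open>open G\<close> by (simp add: compact_Int_closed closed_Compl)
    qed
    then obtain T where T: "T \<subseteq> \<Theta> - E" "finite T" "\<Theta> - E \<subseteq> (\<Union>\<theta>\<in>T. ball \<theta> (s \<theta>))"
      by (rule compactE_image[of _ "\<Theta> - E" "\<lambda>\<theta>. ball \<theta> (s \<theta>)"]) (use sc in auto)
    \<comment> \<open>The smallest rate and the largest constant of the finite cover; inserting 1
      makes minimum and maximum meaningful when the cover is empty.\<close>
    define c' where "c' = Min (insert 1 (c ` T))"
    define C' where "C' = Max (insert 1 (C ` T))"
    have c': "0 < c'" using T sc unfolding c'_def by (subst Min_gr_iff) auto
    have c'_le: "c' \<le> c \<theta>" and C'_ge: "C \<theta> \<le> C'" if "\<theta> \<in> T" for \<theta>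
      using T(2) that by (auto simp: c'_def C'_def)
    have "1 \<le> C'" using T(2) by (auto simp: C'_def)
    have "AE y in ?PS. \<forall>\<theta>\<in>T. eventually (\<lambda>n. \<forall>\<theta>'\<in>\<Theta>. dist \<theta>' \<theta> < s \<theta> \<longrightarrow>
        lk \<theta>' n y \<le> C \<theta> * exp (- c \<theta> * real n) * lk \<theta>s n y) sequentially"
      using T(1) ev by (intro AE_finite_allI T(2)) auto
    then have "AE y in ?PS. eventually (\<lambda>n. \<forall>\<theta>'\<in>\<Theta> - E. lk \<theta>' n y \<le> C' * exp (- c' * real n) * lk \<theta>s n y) sequentially"
    proof eventually_elim
      case (elim y)
      from eventually_ball_finite[OF T(2) elim] show ?case
      proof eventually_elim
        case (elim n)
        show ?case
        proof
          fix \<theta>' assume t: "\<theta>' \<in> \<Theta> - E"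
          then obtain \<theta> where th: "\<theta> \<in> T" "dist \<theta>' \<theta> < s \<theta>" using T(3) by (auto simp: dist_commute)
          then have "lk \<theta>' n y \<le> C \<theta> * exp (- c \<theta> * real n) * lk \<theta>s n y" using elim t by blast
          also have "\<dots> \<le> C' * exp (- c' * real n) * lk \<theta>s n y"
          proof (intro mult_right_mono mult_mono)
            have "c' * real n \<le> c \<theta> * real n" by (intro mult_right_mono c'_le th) simp
            then show "exp (- c \<theta> * real n) \<le> exp (- c' * real n)" by simp
          qed (use C'_ge[OF th(1)] \<open>1 \<le> C'\<close> lk_pos[OF \<theta>s, of n y] in auto)
          finally show "lk \<theta>' n y \<le> C' * exp (- c' * real n) * lk \<theta>s n y" .
        qed
      qed
    qed
    then show ?thesis using c' \<open>1 \<le> C'\<close> by (intro exI[of _ c'] exI[of _ C'] conjI) auto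
  qed
  then obtain c C where c: "c > 0" and C: "C > 0" and up: "AE y in ?PS. eventually (\<lambda>n. \<forall>\<theta>'\<in>\<Theta> - E.
      lk \<theta>' n y \<le> C * exp (- c * real n) * lk \<theta>s n y) sequentially" by blast
  obtain s C2 where s: "s > 0" and C2: "C2 > 0" and low: "AE y in ?PS. eventually (\<lambda>n. \<forall>\<theta>'\<in>\<Theta>. dist \<theta>' \<theta>s < s \<longrightarrow>
      lk \<theta>s n y \<le> C2 * exp (c / 2 * real n) * lk \<theta>' n y) sequentially"
    using lower[OF c] by blast
  interpret Pi0: prob_space \<Pi>0 by (rule \<Pi>0(1))
  have sp: "space \<Pi>0 = \<Theta>" using sets_eq_imp_space_eq[OF \<Pi>0(2)] by (simp add: space_restrict_space)
  \<comment> \<open>The neighbourhood of \<open>\<theta>s\<close> on which the likelihood is bounded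
    below; full support gives it positive prior mass.\<close>
  define V where "V = ball \<theta>s s \<inter> \<Theta>"
  have V: "V \<in> sets \<Pi>0" unfolding V_def \<Pi>0(2) sets_restrict_space
    by (rule image_eqI[where x = "ball \<theta>s s"]) (auto intro: borel_open)
  have "emeasure \<Pi>0 V > 0" unfolding V_def using \<Pi>0(3) s \<theta>s by (metis IntI centre_in_ball empty_iff open_ball)
  then have Vpos: "0 < measure \<Pi>0 V" by (simp add: Pi0.emeasure_eq_measure)
  show ?thesis
    using up low
  proof eventually_elim
    case (elim y)
    \<comment> \<open>The numerator carries \<open>exp (- c * n)\<close>, the denominator loses at
      most \<open>exp (c / 2 * n)\<close>, and the common factor \<open>lk \<theta>s n y\<close>
      cancels; what remains is geometric with ratio \<open>exp (- (c / 2))\<close>.\<close>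
    define g where "g n = C * C2 / measure \<Pi>0 V * exp (- (c / 2))^n" for n
    have "eventually (\<lambda>n. norm (posterior \<Pi>0 \<mu> \<phi> n (\<Theta> - E) y) \<le> g n) sequentially"
      using elim
    proof eventually_elim
      case (elim n)
      let ?U = "C * exp (- c * real n) * lk \<theta>s n y"
      let ?W = "lk \<theta>s n y / (C2 * exp (c / 2 * real n))"
      have ls: "0 < lk \<theta>s n y" by (rule lk_pos[OF \<theta>s])
      have "\<bar>posterior \<Pi>0 \<mu> \<phi> n (\<Theta> - E) y\<bar> \<le> ?U / (?W * measure \<Pi>0 V)"
        unfolding posterior_def
      proof (rule posterior_quotient_le[OF \<Pi>0(1) V Vpos])
        show "0 \<le> likelihood \<mu> \<phi> \<theta> n y" if "\<theta> \<in> space \<Pi>0" for \<theta>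
          using that lk_pos[of \<theta> n y] by (simp add: sp lk_eq)
        show "likelihood \<mu> \<phi> \<theta> n y \<le> ?U" if "\<theta> \<in> space \<Pi>0" "\<theta> \<in> \<Theta> - E" for \<theta>
          using that elim(1) by (simp add: lk_eq)
        show "?W \<le> likelihood \<mu> \<phi> \<theta> n y" if "\<theta> \<in> V" for \<theta>
        proof -
          have "\<theta> \<in> \<Theta>" "dist \<theta> \<theta>s < s" using that by (auto simp: V_def dist_commute)
          then have "lk \<theta>s n y \<le> C2 * exp (c / 2 * real n) * lk \<theta> n y" using elim(2) by blast
          then show ?thesis using C2 lk_eq[OF \<open>\<theta> \<in> \<Theta>\<close>] by (simp add: divide_le_eq mult.commute)
        qed
      qed (use ls C C2 in auto)
      also have "?U / (?W * measure \<Pi>0 V) = C * C2 / measure \<Pi>0 V * (exp (- c * real n) * exp (c / 2 * real n))"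
        using ls C2 Vpos by (simp add: field_simps)
      also have "exp (- c * real n) * exp (c / 2 * real n) = exp (- (c / 2))^n"
        by (simp add: exp_add[symmetric] exp_of_nat_mult[symmetric] algebra_simps)
      finally show ?case by (simp add: g_def)
    qed
    moreover have "g \<longlonglongrightarrow> 0"
      unfolding g_def using c by (intro tendsto_mult_right_zero LIMSEQ_realpow_zero) auto
    ultimately show ?case by (rule Lim_null_comparison)
  qed
qed

end
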